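(* Consider a triangular array (indexed by $T$) of stationary Gaussian VARs as in the context. Let $k,p\in O(e^{T^a})$ and let $i=i_T\in\{1,\dots,k_T\}$ be an equation index with $s_i\in O(T^b)$, for some $a,b\ge0$ with $7a+2b<1$. Assume that there is a constant $c>0$ such that $\kappa_i^2\ge c$ for all $T$, and that $\sup_T\sigma_T<\infty$ and $\sup_T\|\Gamma\|\sum_{j=0}^T\|F^j\|<\infty$. Let $0<q<1$, let $\lambda_T=\sqrt{8\ln(1+T)^5\ln(1+k)^4\ln(1+p)^2\ln(k^2p)\,\sigma_T^4/T}$ and let $\hat\beta_i$ be a minimizer over $\beta\in\mathbb{R}^{kp}$ of $\frac1T\|y_i-X\beta\|^2+2\lambda_T\|\beta\|_{\ell_1}$. Then, as $T\to\infty$: (i) $\frac1T\|X\hat\beta_i-X\beta_i^*\|^2\to0$ in probability; (ii) $\|\hat\beta_i-\beta_i^*\|_{\ell_1}\to0$ in probability; (iii) with probability tending to one no relevant variables are excluded (i.e. $\hat\beta_{i,j}\neq0$ for all $j\in J_i$) if there exists a $T_0\ge1$ such that $\beta_{\min,i}>\frac{16}{qc}s_i\lambda_T$ for all $T\ge T_0$.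
   Context: Setting (VAR model). $T\ge1$ is the sample size; $k=k_T\ge1$ and $p=p_T\ge1$ are integers that may depend on $T$. For each $T$, the $\mathbb{R}^k$-valued data $y_t=(y_{t,1},\dots,y_{t,k})'$, $t=1-p,\dots,T$, satisfy $y_t=\sum_{l=1}^p\Phi_l y_{t-l}+\epsilon_t$ for $t=1,\dots,T$, where $\Phi_1,\dots,\Phi_p$ are $k\times k$ matrices (possibly depending on $T$ but not on $t$), $\epsilon_t$ are i.i.d. $N_k(0,\Sigma)$, all roots of $\det(I_k-\sum_{j=1}^p\Phi_jz^j)$ lie outside the unit disc, and $(y_t)$ is the stationary causal solution (so $y_t$ is centered Gaussian and $\epsilon_t$ is independent of $y_s$, $s<t$). All parameters and dimensions may vary with $T$. $\sigma_{i,y}^2$ is the variance of $y_{t,i}$, $\sigma_{i,\epsilon}^2$ the variance of $\epsilon_{t,i}$, and $\sigma_T=\max_{1\le i\le k}(\sigma_{i,y}\vee\sigma_{i,\epsilon})$. $F$ is the $kp\times kp$ companion matrix of the VAR. Stacked form: $Z_t=(y_{t-1}',\dots,y_{t-p}')'\in\mathbb{R}^{kp}$, $X=(Z_T,\dots,Z_1)'$ ($T\times kp$), $y_i=(y_{T,i},\dots,y_{1,i})'$, $\epsilon_i=(\epsilon_{T,i},\dots,\epsilon_{1,i})'$, so $y_i=X\beta_i^*+\epsilon_i$, where $\beta_i^*\in\mathbb{R}^{kp}$ is the true parameter vector of equation $i$. $J_i=\{j:\beta^*_{i,j}\neq0\}$, $s_i=|J_i|\ge1$, $\beta_{\min,i}=\min\{|\beta^*_{i,j}|:j\in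 J_i\}$. $\|\cdot\|$ is the Euclidean norm of a vector or the spectral norm of a matrix; $\|\cdot\|_{\ell_1}$ is the $\ell_1$ norm; $\delta_R$ is the subvector of $\delta$ indexed by $R$. $\Gamma=E(Z_tZ_t')$ and $\kappa_i=\kappa_\Gamma(s_i)$, where for $1\le r\le kp$ $$\kappa_\Gamma^2(r)=\min_{R\subseteq\{1,\dots,kp\},\,|R|\le r}\ \min_{\delta\in\mathbb{R}^{kp}\setminus\{0\},\ \|\delta_{R^c}\|_{\ell_1}\le3\|\delta_R\|_{\ell_1}}\frac{\delta'\Gamma\delta}{\|\delta_R\|^2}.$$ *)

theory Defs
  imports
    "HOL-Probability.Probability"
    "HOL-Library.Landau_Symbols"
    "Jordan_Normal_Form.Determinant"
begin

(* Below, $ and \<bullet> are those of Jordan_Normal_Form, since all dimensions vary with the sample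
   size. Coordinates are numbered from 0, lags from 1. *)
unbundle no vec_syntax
unbundle no inner_syntax

definition l2_norm :: "real vec \<Rightarrow> real" where
  "l2_norm v = L2_set (\<lambda>j. v $ j) {..<dim_vec v}"

definition l1_norm :: "real vec \<Rightarrow> real" where
  "l1_norm v = (\<Sum>j<dim_vec v. \<bar>v $ j\<bar>)"

definition spectral_norm :: "real mat \<Rightarrow> real" where
  "spectral_norm A = (SUP v\<in>{v \<in> carrier_vec (dim_col A). l2_norm v \<le> 1}. l2_norm (A *\<^sub>v v))"

definition centered_normal_law :: "real \<Rightarrow> real measure" where
  "centered_normal_law v =
     (if v = 0 then return borel 0
      else density lborel (\<lambda>x. ennreal (normal_density 0 (sqrt v) x)))"

text \<open>The law $N_k(0,\Sigma)$, where $\Sigma$ may be singular: every linear combination of the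
  coordinates has the corresponding, possibly degenerate, normal law.\<close>

definition centered_gaussian_vector ::
  "'a measure \<Rightarrow> nat \<Rightarrow> real mat \<Rightarrow> (nat \<Rightarrow> 'a \<Rightarrow> real) \<Rightarrow> bool" where
  "centered_gaussian_vector M k \<Sigma> X \<longleftrightarrow>
     \<Sigma> \<in> carrier_mat k k \<and> transpose_mat \<Sigma> = \<Sigma> \<and>
     (\<forall>a\<in>carrier_vec k. 0 \<le> a \<bullet> (\<Sigma> *\<^sub>v a)) \<and>
     (\<forall>i<k. X i \<in> borel_measurable M) \<and>
     (\<forall>a\<in>carrier_vec k.
        distr M borel (\<lambda>\<omega>. \<Sum>i<k. a $ i * X i \<omega>) = centered_normal_law (a \<bullet> (\<Sigma> *\<^sub>v a)))"

definition var_char_mat :: "nat \<Rightarrow> nat \<Rightarrow> (nat \<Rightarrow> real mat) \<Rightarrow> complex \<Rightarrow> complex mat" where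
  "var_char_mat k p \<Phi> z =
     1\<^sub>m k - mat k k (\<lambda>(r, c). \<Sum>l=1..p. complex_of_real (\<Phi> l $$ (r, c)) * z ^ l)"

text \<open>\<open>y t i \<omega>\<close> is the \<open>i\<close>-th coordinate of $y_t$. The processes are indexed by all integers, so that
  stationarity and causality can be expressed; a sample of size \<open>T\<close> consists of the $y_t$ with
  $1 - p \le t \le T$.\<close>

locale stationary_gaussian_var = prob_space M
  for M :: "'a measure" +
  fixes k p :: nat
    and \<Phi> :: "nat \<Rightarrow> real mat"
    and \<Sigma> :: "real mat"
    and y \<epsilon> :: "int \<Rightarrow> nat \<Rightarrow> 'a \<Rightarrow> real"
  assumes k_pos: "1 \<le> k"
    and p_pos: "1 \<le> p"
    and coeff_carrier: "\<And>l. l \<in> {1..p} \<Longrightarrow> \<Phi> l \<in> carrier_mat k k"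
    and stable: "\<And>z. det (var_char_mat k p \<Phi> z) = 0 \<Longrightarrow> 1 < cmod z"
    and noise_gaussian: "\<And>t. centered_gaussian_vector M k \<Sigma> (\<epsilon> t)"
    and noise_indep:
      "indep_vars (\<lambda>_. PiM {..<k} (\<lambda>_. borel)) (\<lambda>t \<omega>. \<lambda>i\<in>{..<k}. \<epsilon> t i \<omega>) UNIV"
    and y_measurable: "\<And>t i. i < k \<Longrightarrow> random_variable borel (y t i)"
    and var_equation:
      "\<And>t i. i < k \<Longrightarrow>
         AE \<omega> in M. y t i \<omega> = (\<Sum>l=1..p. \<Sum>j<k. \<Phi> l $$ (i, j) * y (t - int l) j \<omega>) + \<epsilon> t i \<omega>"
    and stationary:
      "\<And>h I. finite I \<Longrightarrow> I \<subseteq> UNIV \<times> {..<k} \<Longrightarrow>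
         distr M (PiM I (\<lambda>_. borel)) (\<lambda>\<omega>. \<lambda>(t, i)\<in>I. y (t + h) i \<omega>) =
         distr M (PiM I (\<lambda>_. borel)) (\<lambda>\<omega>. \<lambda>(t, i)\<in>I. y t i \<omega>)"
    and causal:
      "\<exists>\<Psi> :: nat \<Rightarrow> real mat.
         (\<forall>n. \<Psi> n \<in> carrier_mat k k) \<and>
         (\<forall>i<k. \<forall>j<k. summable (\<lambda>n. \<bar>\<Psi> n $$ (i, j)\<bar>)) \<and>
         (\<forall>t. \<forall>i<k. AE \<omega> in M. (\<lambda>n. \<Sum>j<k. \<Psi> n $$ (i, j) * \<epsilon> (t - int n) j \<omega>) sums y t i \<omega>)"

text \<open>$\sigma_T$; by stationarity the variances do not depend on the time, here 1.\<close>

definition max_sd ::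
  "'a measure \<Rightarrow> nat \<Rightarrow> (int \<Rightarrow> nat \<Rightarrow> 'a \<Rightarrow> real) \<Rightarrow> (int \<Rightarrow> nat \<Rightarrow> 'a \<Rightarrow> real) \<Rightarrow> real" where
  "max_sd M k y \<epsilon> =
     Max ((\<lambda>i. max (sqrt (prob_space.variance M (y 1 i)))
                    (sqrt (prob_space.variance M (\<epsilon> 1 i)))) ` {..<k})"

definition companion_mat :: "nat \<Rightarrow> nat \<Rightarrow> (nat \<Rightarrow> real mat) \<Rightarrow> real mat" where
  "companion_mat k p \<Phi> = mat (k * p) (k * p) (\<lambda>(r, c).
     if r < k then \<Phi> (c div k + 1) $$ (r, c mod k) else if r = c + k then 1 else 0)"

text \<open>The regressor with index \<open>j\<close> is variable \<open>j mod k\<close> at lag \<open>j div k + 1\<close>.\<close>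

definition lag_vec :: "nat \<Rightarrow> nat \<Rightarrow> (int \<Rightarrow> nat \<Rightarrow> 'a \<Rightarrow> real) \<Rightarrow> int \<Rightarrow> 'a \<Rightarrow> real vec" where
  "lag_vec k p y t \<omega> = vec (k * p) (\<lambda>j. y (t - int (j div k + 1)) (j mod k) \<omega>)"

definition true_param :: "nat \<Rightarrow> nat \<Rightarrow> (nat \<Rightarrow> real mat) \<Rightarrow> nat \<Rightarrow> real vec" where
  "true_param k p \<Phi> i = vec (k * p) (\<lambda>j. \<Phi> (j div k + 1) $$ (i, j mod k))"

text \<open>As in $X = (Z_T,\ldots,Z_1)'$ and $y_i = (y_{T,i},\ldots,y_{1,i})'$, row \<open>r\<close> belongs to time \<open>T - r\<close>.\<close>

definition design_mat ::
  "nat \<Rightarrow> nat \<Rightarrow> nat \<Rightarrow> (int \<Rightarrow> nat \<Rightarrow> 'a \<Rightarrow> real) \<Rightarrow> 'a \<Rightarrow> real mat" where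
  "design_mat T k p y \<omega> = mat T (k * p) (\<lambda>(r, j). lag_vec k p y (int T - int r) \<omega> $ j)"

definition response_vec :: "nat \<Rightarrow> (int \<Rightarrow> nat \<Rightarrow> 'a \<Rightarrow> real) \<Rightarrow> nat \<Rightarrow> 'a \<Rightarrow> real vec" where
  "response_vec T y i \<omega> = vec T (\<lambda>r. y (int T - int r) i \<omega>)"

text \<open>$\Gamma = E(Z_tZ_t')$, which by stationarity does not depend on \<open>t\<close>.\<close>

definition lag_cov_mat ::
  "'a measure \<Rightarrow> nat \<Rightarrow> nat \<Rightarrow> (int \<Rightarrow> nat \<Rightarrow> 'a \<Rightarrow> real) \<Rightarrow> real mat" where
  "lag_cov_mat M k p y = mat (k * p) (k * p)
     (\<lambda>(r, c). prob_space.expectation M (\<lambda>\<omega>. lag_vec k p y 1 \<omega> $ r * lag_vec k p y 1 \<omega> $ c))"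

definition active_set :: "real vec \<Rightarrow> nat set" where
  "active_set \<beta> = {j. j < dim_vec \<beta> \<and> \<beta> $ j \<noteq> 0}"

definition beta_min :: "real vec \<Rightarrow> real" where
  "beta_min \<beta> = Min ((\<lambda>j. \<bar>\<beta> $ j\<bar>) ` active_set \<beta>)"

text \<open>$\kappa_A^2(r)$. The two nested minima are one infimum over pairs $(R,\delta)$; for
  \<open>R = {}\<close> the cone condition leaves no $\delta \neq 0$. The infimum is attained, since the ratio is
  invariant under scaling of $\delta$ and the constraint bounds $\delta$ once $\|\delta_R\| = 1$.\<close>

definition restricted_eigenvalue_sq :: "real mat \<Rightarrow> nat \<Rightarrow> real" where
  "restricted_eigenvalue_sq A r = Inf
     {\<delta> \<bullet> (A *\<^sub>v \<delta>) / (L2_set (\<lambda>j. \<delta> $ j) R)\<^sup>2 | R \<delta>.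
        R \<subseteq> {..<dim_row A} \<and> card R \<le> r \<and>
        \<delta> \<in> carrier_vec (dim_row A) \<and> \<delta> \<noteq> 0\<^sub>v (dim_row A) \<and>
        (\<Sum>j\<in>{..<dim_row A} - R. \<bar>\<delta> $ j\<bar>) \<le> 3 * (\<Sum>j\<in>R. \<bar>\<delta> $ j\<bar>)}"

definition lasso_penalty :: "nat \<Rightarrow> nat \<Rightarrow> nat \<Rightarrow> real \<Rightarrow> real" where
  "lasso_penalty T k p \<sigma> =
     sqrt (8 * ln (1 + real T) ^ 5 * ln (1 + real k) ^ 4 * ln (1 + real p) ^ 2 *
           ln (real k ^ 2 * real p) * \<sigma> ^ 4 / real T)"

definition lasso_objective ::
  "nat \<Rightarrow> real mat \<Rightarrow> real vec \<Rightarrow> real \<Rightarrow> real vec \<Rightarrow> real" where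
  "lasso_objective T X v lam \<beta> = (l2_norm (v - X *\<^sub>v \<beta>))\<^sup>2 / real T + 2 * lam * l1_norm \<beta>"

definition is_lasso :: "nat \<Rightarrow> real mat \<Rightarrow> real vec \<Rightarrow> real \<Rightarrow> real vec \<Rightarrow> bool" where
  "is_lasso T X v lam b \<longleftrightarrow>
     b \<in> carrier_vec (dim_col X) \<and>
     (\<forall>\<beta>\<in>carrier_vec (dim_col X). lasso_objective T X v lam b \<le> lasso_objective T X v lam \<beta>)"

text \<open>The probability space may change along the sequence.\<close>

definition tendsto_0_in_prob :: "(nat \<Rightarrow> 'a measure) \<Rightarrow> (nat \<Rightarrow> 'a \<Rightarrow> real) \<Rightarrow> bool" where
  "tendsto_0_in_prob M Y \<longleftrightarrow>
     (\<forall>e>0. (\<lambda>T. measure (M T) {\<omega> \<in> space (M T). e < \<bar>Y T \<omega>\<bar>}) \<longlonglongrightarrow> 0)"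

end

theory Submission
  imports Defs "HOL-Real_Asymp.Real_Asymp"
begin

text \<open>The Lasso error \<open>\<delta>\<close> is controlled by a deterministic inequality as soon as two things hold: the
empirical correlation of every regressor with the noise is at most half the penalty, and the
empirical Gram matrix is so close to $\Gamma$, entry by entry, that it inherits the restricted
eigenvalue of $\Gamma$ (\<open>lasso_oracle_inequality\<close>, \<open>restricted_eigenvalue_perturbation\<close>). The
errors are then of order $s\lambda^2$ in prediction and $s\lambda$ in $\ell_1$ norm. Since the growth
conditions give $s\lambda \to 0$, everything reduces to showing that both things hold with
probability tending to one.

Both kinds of averages, of $\epsilon_{t,i} Z_{t,j}$ and of $Z_{t,j} Z_{t,l}$, are averages of products
of jointly Gaussian variables, and one tail bound serves for both
(\<open>gaussian_product_mean_tail\<close>). By polarization it is a bound for sums of squares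
$\sum_t w_t^2$. Writing $e^{\theta w^2}$ as an exponential moment of $\sqrt{2\theta}\,g\,w$ with $g$
standard normal shows that the exponential moments of $\sum_t w_t^2$ are those of a quadratic form
in independent standard normal variables whose matrix is the covariance matrix of \<open>w\<close>; these are
computed by integrating out one coordinate after the other (\<open>gaussian_chaos_exp_bound\<close>). The
result is a bound of order $e^{- T x^2 / (64 K^2)}$ for deviations \<open>x\<close> of the average, where $K$
bounds the covariance matrices of the two factors as quadratic forms.

Such a $K$ comes from the dependence hypothesis. The state equation $Z_{t+1} = F Z_t + E_t$, in
which $E_t$ is orthogonal to the past, gives $E(Z_{t+h} Z_t') = F^h \Gamma$. So the autocovariances of
a single regressor at distance \<open>h\<close> are at most $\|\Gamma\| \|F^h\|$, and the sum of these over \<open>h\<close>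
bounds the covariance matrix (\<open>regressor_path_variance_bound\<close>). Joint normality follows from
causality, because almost sure limits of centered normal variables are centered normal
(\<open>centered_normal_limit\<close>).

It remains to take unions over $kp$ correlations and $(kp)^2$ Gram entries. The penalty was chosen
such that $T\lambda^2$ exceeds every multiple of $\ln (kp)$ eventually, and $T / s^2$ exceeds every
multiple of $\ln (kp) = O(T^a)$ because $a + 2b < 1$.

One case is different. For $k = p = 1$ the factor $\ln (k^2 p)$ vanishes, so that there is no penalty
and the Lasso is ordinary least squares in one regressor. Consistency then holds with $T^{-1/4}$
in the role of half the penalty. For the last claim the threshold for the coefficients is $0$,
and the estimate is nonzero almost surely because the newest noise variable is independent of the
past and has no atoms (\<open>unpenalized_univariate_lasso_nonzero\<close>).\<close>

section \<open>Quadratic forms in independent standard normal variables\<close>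

text \<open>Completing the square turns the integrand into a multiple of the density of the normal law with
mean $c / (1 - 2b)$ and variance $1 / (1 - 2b)$.\<close>

lemma std_normal_exp_quadratic:
  fixes b c :: real
  assumes b: "b < 1/2"
  shows "(\<integral>\<^sup>+x. ennreal (exp (b * x\<^sup>2 + c * x)) \<partial>std_normal_distribution) =
    ennreal (1 / sqrt (1 - 2 * b) * exp (c\<^sup>2 / (2 * (1 - 2 * b))))"
proof -
  define d where "d = 1 - 2 * b"
  have d: "d > 0" using b by (simp add: d_def)
  have *: "std_normal_density x * exp (b * x\<^sup>2 + c * x) =
      1 / sqrt d * exp (c\<^sup>2 / (2 * d)) * normal_density (c / d) (1 / sqrt d) x" for x
  proof -
    have e: "- x\<^sup>2 / 2 + (b * x\<^sup>2 + c * x) = c\<^sup>2 / (2 * d) + - (x - c / d)\<^sup>2 / (2 * (1 / sqrt d)\<^sup>2)"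
    proof -
      have "(1 / sqrt d)\<^sup>2 = 1 / d" using d by (simp add: power_divide)
      moreover have "c\<^sup>2 / (2 * d) - (x - c / d)\<^sup>2 * d / 2 = c * x - d * x\<^sup>2 / 2"
        using d by (simp add: field_simps power2_eq_square)
      moreover have "- x\<^sup>2 / 2 + (b * x\<^sup>2 + c * x) = c * x - d * x\<^sup>2 / 2"
        by (simp add: d_def field_simps)
      ultimately show ?thesis by simp
    qed
    have "std_normal_density x * exp (b * x\<^sup>2 + c * x) =
        1 / sqrt (2 * pi) * exp (- x\<^sup>2 / 2 + (b * x\<^sup>2 + c * x))"
      by (simp add: std_normal_density_def flip: exp_add)
    also have "\<dots> = 1 / sqrt (2 * pi) * (exp (c\<^sup>2 / (2 * d)) * exp (- (x - c / d)\<^sup>2 / (2 * (1 / sqrt d)\<^sup>2)))"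
      unfolding e exp_add ..
    also have "\<dots> = 1 / sqrt d * exp (c\<^sup>2 / (2 * d)) * normal_density (c / d) (1 / sqrt d) x"
      using d by (simp add: normal_density_def real_sqrt_mult real_sqrt_divide power_divide field_simps)
    finally show ?thesis .
  qed
  have "(\<integral>\<^sup>+x. ennreal (exp (b * x\<^sup>2 + c * x)) \<partial>std_normal_distribution) =
      (\<integral>\<^sup>+x. ennreal (1 / sqrt d * exp (c\<^sup>2 / (2 * d))) * ennreal (normal_density (c / d) (1 / sqrt d) x) \<partial>lborel)"
    apply (subst nn_integral_density)
    apply simp
    apply simp
    apply (rule nn_integral_cong)
    using d
    apply (simp add: ennreal_mult[symmetric] * )
    done
  also have "\<dots> = ennreal (1 / sqrt d * exp (c\<^sup>2 / (2 * d))) * (\<integral>\<^sup>+x. ennreal (normal_density (c / d) (1 / sqrt d) x) \<partial>lborel)"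
    by (rule nn_integral_cmult) simp
  also have "(\<integral>\<^sup>+x. ennreal (normal_density (c / d) (1 / sqrt d) x) \<partial>lborel) = 1"
  proof -
    interpret prob_space "density lborel (\<lambda>x. ennreal (normal_density (c / d) (1 / sqrt d) x))"
      using d by (intro prob_space_normal_density) simp
    show ?thesis using emeasure_space_1 by (simp add: emeasure_density)
  qed
  finally show ?thesis by (simp add: d_def)
qed

text \<open>The determinant factor from integrating out one coordinate. Its linear part becomes a part of the
trace, so that only the quadratic remainder is a loss.\<close>

lemma inverse_sqrt_one_minus_le_exp:
  fixes b :: real
  assumes "\<bar>b\<bar> \<le> 1/4"
  shows "1 / sqrt (1 - 2 * b) \<le> exp (b + 4 * b\<^sup>2)"
proof -
  have "\<bar>ln (1 + (- 2 * b)) - (- 2 * b)\<bar> \<le> 2 * (- 2 * b)\<^sup>2"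
    by (rule abs_ln_one_plus_x_minus_x_bound) (use assms in auto)
  hence l: "- ln (1 - 2 * b) \<le> 2 * (b + 4 * b\<^sup>2)" by (auto simp: abs_le_iff power2_eq_square)
  have p: "1 - 2 * b > 0" using assms by (auto simp: abs_le_iff)
  have "1 / sqrt (1 - 2 * b) = exp (- ln (1 - 2 * b) / 2)"
  proof -
    have "exp (- ln (1 - 2 * b) / 2) = inverse (exp (ln (sqrt (1 - 2 * b))))"
      using p by (simp add: ln_sqrt exp_minus[symmetric])
    thus ?thesis using p by (simp add: inverse_eq_divide)
  qed
  also have "\<dots> \<le> exp (b + 4 * b\<^sup>2)" using l by simp
  finally show ?thesis .
qed

definition quad_form :: "nat \<Rightarrow> (nat \<Rightarrow> nat \<Rightarrow> real) \<Rightarrow> (nat \<Rightarrow> real) \<Rightarrow> real" where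
  "quad_form n B x = (\<Sum>i<n. \<Sum>j<n. B i j * x i * x j)"

lemma quad_form_Suc:
  assumes "\<And>i j. B i j = B j i"
  shows "quad_form (Suc n) B x = quad_form n B x + 2 * x n * (\<Sum>i<n. B n i * x i) + B n n * (x n)\<^sup>2"
proof -
  have "(\<Sum>i<n. B i n * x i * x n) = x n * (\<Sum>i<n. B n i * x i)"
    by (subst sum_distrib_left) (rule sum.cong, auto simp: assms[of n])
  moreover have "(\<Sum>i<n. B n i * x n * x i) = x n * (\<Sum>i<n. B n i * x i)"
    by (subst sum_distrib_left) (rule sum.cong, auto)
  ultimately show ?thesis
    by (simp add: quad_form_def sum.distrib power2_eq_square algebra_simps)
qed

lemma quad_form_rank_one_update:
  "quad_form n (\<lambda>i j. B i j + d * v i * v j) x = quad_form n B x + d * (\<Sum>i<n. v i * x i)\<^sup>2"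
proof -
  have "(\<Sum>i<n. v i * x i)\<^sup>2 = (\<Sum>i<n. \<Sum>j<n. (v i * x i) * (v j * x j))"
    by (simp add: power2_eq_square sum_product)
  thus ?thesis
    by (simp add: quad_form_def distrib_left distrib_right sum.distrib sum_distrib_left mult_ac)
qed

lemma quad_form_cong: "(\<And>i. i < n \<Longrightarrow> x i = z i) \<Longrightarrow> quad_form n B x = quad_form n B z"
  by (simp add: quad_form_def)

lemma quad_form_scale: "quad_form n (\<lambda>i j. c * B i j) x = c * quad_form n B x"
  by (simp add: quad_form_def sum_distrib_left mult_ac)

text \<open>By polarization. Let \<open>r\<close> be the norm of the row. The form takes at the row plus and minus \<open>r\<close> times
the last unit vector two values that differ by $4 r^3$, whereas the bound allows them to differ by
$4 \kappa r^2$ only.\<close>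

lemma quad_form_row_bound:
  assumes sym: "\<And>i j. B i j = B j i"
    and bound: "\<And>x. \<bar>quad_form (Suc n) B x\<bar> \<le> \<kappa> * (\<Sum>i<Suc n. (x i)\<^sup>2)"
    and \<kappa>0: "0 \<le> \<kappa>"
  shows "(\<Sum>i<Suc n. (B n i)\<^sup>2) \<le> \<kappa>\<^sup>2"
proof -
  define r where "r = sqrt (\<Sum>i<Suc n. (B n i)\<^sup>2)"
  have r0: "r \<ge> 0" by (simp add: r_def sum_nonneg)
  have r2: "r\<^sup>2 = (\<Sum>i<Suc n. (B n i)\<^sup>2)" by (simp add: r_def sum_nonneg)
  let ?x = "\<lambda>i. B n i" and ?e = "\<lambda>i. if i = n then r else 0"
  define P where "P = (\<lambda>i. ?x i + ?e i)"
  define N where "N = (\<lambda>i. ?x i - ?e i)"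
  have "quad_form (Suc n) B P - quad_form (Suc n) B N = 4 * (r * (\<Sum>i<Suc n. (B n i)\<^sup>2))"
  proof -
    have "(\<Sum>i<n. B n i * P i) = (\<Sum>i<n. (B n i)\<^sup>2)" "(\<Sum>i<n. B n i * N i) = (\<Sum>i<n. (B n i)\<^sup>2)"
      by (auto simp: P_def N_def power2_eq_square intro!: sum.cong)
    moreover have "quad_form n B P = quad_form n B N"
      by (rule quad_form_cong) (simp add: P_def N_def)
    ultimately show ?thesis unfolding quad_form_Suc[OF sym]
      by (simp add: P_def N_def power2_eq_square algebra_simps)
  qed
  moreover have "quad_form (Suc n) B P - quad_form (Suc n) B N \<le>
      \<kappa> * ((\<Sum>i<Suc n. (P i)\<^sup>2) + (\<Sum>i<Suc n. (N i)\<^sup>2))"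
    using bound[of P] bound[of N] unfolding distrib_left by linarith
  moreover have "(\<Sum>i<Suc n. (P i)\<^sup>2) + (\<Sum>i<Suc n. (N i)\<^sup>2) = 4 * r\<^sup>2"
  proof -
    have "(\<Sum>i<Suc n. (P i)\<^sup>2) + (\<Sum>i<Suc n. (N i)\<^sup>2) = (\<Sum>i<Suc n. 2 * (?x i)\<^sup>2 + 2 * (?e i)\<^sup>2)"
      by (simp only: sum.distrib[symmetric]) (rule sum.cong, auto simp: P_def N_def power2_eq_square algebra_simps)
    also have "\<dots> = 2 * r\<^sup>2 + 2 * r\<^sup>2"
    proof -
      have "(\<Sum>i<Suc n. (?e i)\<^sup>2) = r\<^sup>2" by simp
      thus ?thesis by (simp only: sum.distrib sum_distrib_left[symmetric] r2)
    qed
    finally show ?thesis by simp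
  qed
  ultimately have "r * r\<^sup>2 \<le> \<kappa> * r\<^sup>2" unfolding r2 by (simp only:)
  hence "r \<le> \<kappa>" if "r \<noteq> 0" using that by simp
  hence "r \<le> \<kappa>" using \<kappa>0 by fastforce
  hence "r\<^sup>2 \<le> \<kappa>\<^sup>2" using r0 by (simp add: power_mono)
  thus ?thesis by (simp add: r2)
qed

abbreviation std_normal_product :: "nat \<Rightarrow> (nat \<Rightarrow> real) measure" where
  "std_normal_product n \<equiv> PiM {..<n} (\<lambda>_. std_normal_distribution)"

lemma product_prob_space_std_normal:
  "product_prob_space (\<lambda>_::nat. std_normal_distribution)"
proof -
  interpret prob_space "std_normal_distribution" by (simp add: prob_space_normal_density)
  show ?thesis by unfold_locales
qed

lemma quad_form_measurable [measurable]:
  "quad_form n B \<in> borel_measurable (std_normal_product n)"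
  unfolding quad_form_def by (intro borel_measurable_sum borel_measurable_times borel_measurable_const) (auto intro!: measurable_component_singleton)

text \<open>The trace is the mean of the form, so the loss is only the second order term. The last coordinate
is integrated out; if \<open>b\<close> is the last row without its diagonal entry, this leaves the form with
matrix $B + d\,b b'$, where $d = 2 / (1 - 2 B_{nn})$. At \<open>x\<close> the new form is the supremum over
\<open>t\<close> of $B(x, t) - t^2 / 2$, which shows that it satisfies the same bound $\kappa$, since
$\kappa \le 1/2$. The trace has grown by $d |b|^2 \le 4 |b|^2$. Together with the remainder
$4 B_{nn}^2$ from the determinant factor this is at most four times the squared norm of the row,
hence at most $4 \kappa^2$ for each coordinate.\<close>

theorem gaussian_chaos_exp_bound:
  assumes sym: "\<And>i j. B i j = B j i"
    and bound: "\<And>x. \<bar>quad_form n B x\<bar> \<le> \<kappa> * (\<Sum>i<n. (x i)\<^sup>2)"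
    and \<kappa>0: "0 \<le> \<kappa>" and \<kappa>: "\<kappa> \<le> 1/4"
  shows "(\<integral>\<^sup>+x. ennreal (exp (quad_form n B x)) \<partial>std_normal_product n)
    \<le> ennreal (exp ((\<Sum>i<n. B i i) + 4 * \<kappa>\<^sup>2 * real n))"
  using sym bound
proof (induction n arbitrary: B)
  case 0
  interpret product_prob_space "\<lambda>_::nat. std_normal_distribution"
    by (rule product_prob_space_std_normal)
  show ?case by (simp add: quad_form_def PiM_empty)
next
  case (Suc n)
  interpret product_prob_space "\<lambda>_::nat. std_normal_distribution"
    by (rule product_prob_space_std_normal)
  let ?P = "\<lambda>n::nat. PiM {..<n} (\<lambda>_. std_normal_distribution)"
  note sym = Suc.prems(1)
  define d where "d = 2 / (1 - 2 * B n n)"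
  have row: "(\<Sum>i<n. (B n i)\<^sup>2) + (B n n)\<^sup>2 \<le> \<kappa>\<^sup>2"
    using quad_form_row_bound[OF Suc.prems \<kappa>0] by simp
  have "(B n n)\<^sup>2 \<le> \<kappa>\<^sup>2" using row sum_nonneg[of "{..<n}" "\<lambda>i. (B n i)\<^sup>2"] by fastforce
  hence "\<bar>B n n\<bar> \<le> \<kappa>" using \<kappa>0 by (simp add: abs_le_square_iff[symmetric])
  hence bnn: "\<bar>B n n\<bar> \<le> 1/4" using \<kappa> by linarith
  have d: "0 < d" "d \<le> 4" using bnn by (auto simp: d_def field_simps abs_le_iff)
  define B' where "B' = (\<lambda>i j. B i j + d * B n i * B n j)"
  have sym': "B' i j = B' j i" for i j by (simp add: B'_def sym[of i j])
  have qf': "quad_form n B' x = quad_form n B x + d * (\<Sum>i<n. B n i * x i)\<^sup>2" for x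
    unfolding B'_def by (rule quad_form_rank_one_update)
  have bound': "\<bar>quad_form n B' x\<bar> \<le> \<kappa> * (\<Sum>i<n. (x i)\<^sup>2)" for x
  proof -
    have "quad_form n B' x \<ge> quad_form n B x" unfolding qf' using d by simp
    moreover have "- (\<kappa> * (\<Sum>i<n. (x i)\<^sup>2)) \<le> quad_form n B x"
    proof -
      let ?z = "x(n := 0)"
      have "quad_form (Suc n) B ?z = quad_form n B ?z" by (simp add: quad_form_Suc[OF sym])
      also have "\<dots> = quad_form n B x" by (rule quad_form_cong) simp
      finally have "quad_form (Suc n) B ?z = quad_form n B x" .
      moreover have "(\<Sum>i<Suc n. (?z i)\<^sup>2) = (\<Sum>i<n. (x i)\<^sup>2)" by simp
      ultimately show ?thesis using Suc.prems(2)[of ?z] by (metis abs_le_iff minus_le_iff)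
    qed
    moreover have "quad_form n B' x \<le> \<kappa> * (\<Sum>i<n. (x i)\<^sup>2)"
    proof -
      \<comment> \<open>The maximizer of \<open>B(x, t) - t^2 / 2\<close>.\<close>
      define l where "l = (\<Sum>i<n. B n i * x i)"
      define t where "t = d * l"
      let ?z = "x(n := t)"
      have "quad_form (Suc n) B ?z = quad_form n B ?z + 2 * t * (\<Sum>i<n. B n i * ?z i) + B n n * t\<^sup>2"
        by (simp add: quad_form_Suc[OF sym])
      also have "quad_form n B ?z = quad_form n B x" by (rule quad_form_cong) simp
      also have "(\<Sum>i<n. B n i * ?z i) = l" by (simp add: l_def)
      also have "quad_form n B x + 2 * t * l + B n n * t\<^sup>2 = quad_form n B' x + t\<^sup>2 / 2"
      proof -
        have "B n n = 1/2 - 1 / d" using bnn by (auto simp: d_def field_simps abs_le_iff)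
        moreover have "2 * (d * l) * l + (1/2 - 1 / d) * (d * l)\<^sup>2 = d * l\<^sup>2 + (d * l)\<^sup>2 / 2"
          using d by (simp add: power2_eq_square field_simps)
        ultimately show ?thesis unfolding qf' l_def[symmetric] t_def by simp
      qed
      finally have "quad_form (Suc n) B ?z = quad_form n B' x + t\<^sup>2 / 2" .
      moreover have "quad_form (Suc n) B ?z \<le> \<kappa> * (\<Sum>i<n. (x i)\<^sup>2) + \<kappa> * t\<^sup>2"
      proof -
        have "(\<Sum>i<Suc n. (?z i)\<^sup>2) = (\<Sum>i<n. (x i)\<^sup>2) + t\<^sup>2" by simp
        thus ?thesis using Suc.prems(2)[of ?z] by (metis abs_le_iff distrib_left)
      qed
      moreover have "\<kappa> * t\<^sup>2 \<le> 1/4 * t\<^sup>2" using \<kappa> by (intro mult_right_mono) auto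
      moreover have "t\<^sup>2 \<ge> 0" by simp
      ultimately show ?thesis by linarith
    qed
    ultimately show ?thesis by linarith
  qed
  have "(\<integral>\<^sup>+x. ennreal (exp (quad_form (Suc n) B x)) \<partial>?P (Suc n)) =
      (\<integral>\<^sup>+x. (\<integral>\<^sup>+t. ennreal (exp (quad_form (Suc n) B (x(n := t)))) \<partial>std_normal_distribution) \<partial>?P n)"
    unfolding lessThan_Suc
    proof (rule product_nn_integral_insert)
    show "(\<lambda>x. ennreal (exp (quad_form (Suc n) B x))) \<in> borel_measurable (PiM (insert n {..<n}) (\<lambda>_. std_normal_distribution))"
      unfolding lessThan_Suc[symmetric] by (intro measurable_compose[OF quad_form_measurable]) simp
  qed simp_all
  also have "\<dots> = (\<integral>\<^sup>+x. ennreal (1 / sqrt (1 - 2 * B n n) * exp (quad_form n B' x)) \<partial>?P n)"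
  proof (rule nn_integral_cong)
    fix x
    define l where "l = (\<Sum>i<n. B n i * x i)"
    have e: "quad_form (Suc n) B (x(n := t)) = quad_form n B x + (B n n * t\<^sup>2 + 2 * l * t)" for t
    proof -
      have "quad_form n B (x(n := t)) = quad_form n B x" by (rule quad_form_cong) simp
      moreover have "(\<Sum>i<n. B n i * (x(n := t)) i) = l" by (simp add: l_def)
      ultimately show ?thesis by (simp add: quad_form_Suc[OF sym])
    qed
    have "(\<integral>\<^sup>+t. ennreal (exp (quad_form (Suc n) B (x(n := t)))) \<partial>std_normal_distribution)
      = (\<integral>\<^sup>+t. ennreal (exp (quad_form n B x)) * ennreal (exp (B n n * t\<^sup>2 + 2 * l * t)) \<partial>std_normal_distribution)"
      by (simp add: e exp_add ennreal_mult')
    also have "\<dots> = ennreal (exp (quad_form n B x)) *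
        (\<integral>\<^sup>+t. ennreal (exp (B n n * t\<^sup>2 + 2 * l * t)) \<partial>std_normal_distribution)"
      by (rule nn_integral_cmult) simp
    also have "\<dots> = ennreal (exp (quad_form n B x)) *
        ennreal (1 / sqrt (1 - 2 * B n n) * exp ((2 * l)\<^sup>2 / (2 * (1 - 2 * B n n))))"
      by (subst std_normal_exp_quadratic) (use bnn in auto)
    also have "\<dots> = ennreal (1 / sqrt (1 - 2 * B n n) * exp (quad_form n B' x))"
    proof -
      have "(2 * l)\<^sup>2 / (2 * (1 - 2 * B n n)) = d * l\<^sup>2"
      proof -
        have "(2 * l)\<^sup>2 = 2 * (2 * l\<^sup>2)" by (simp add: power_mult_distrib)
        thus ?thesis unfolding d_def by (simp only: mult_divide_mult_cancel_left_if) simp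
      qed
      hence "exp (quad_form n B x) * (1 / sqrt (1 - 2 * B n n) * exp ((2 * l)\<^sup>2 / (2 * (1 - 2 * B n n)))) =
          1 / sqrt (1 - 2 * B n n) * exp (quad_form n B' x)"
        unfolding qf' l_def[symmetric] exp_add by (simp only: mult_ac)
      thus ?thesis by (metis ennreal_mult' exp_ge_zero)
    qed
    finally show "(\<integral>\<^sup>+t. ennreal (exp (quad_form (Suc n) B (x(n := t)))) \<partial>std_normal_distribution)
      = ennreal (1 / sqrt (1 - 2 * B n n) * exp (quad_form n B' x))" .
  qed
  also have "\<dots> = ennreal (1 / sqrt (1 - 2 * B n n)) * (\<integral>\<^sup>+x. ennreal (exp (quad_form n B' x)) \<partial>?P n)"
  proof -
    have "ennreal (1 / sqrt (1 - 2 * B n n) * e) = ennreal (1 / sqrt (1 - 2 * B n n)) * ennreal e" for e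
      using bnn by (intro ennreal_mult') (auto simp: abs_le_iff)
    moreover have "(\<lambda>x. ennreal (exp (quad_form n B' x))) \<in> borel_measurable (?P n)"
      by (intro measurable_compose[OF quad_form_measurable]) simp
    ultimately show ?thesis by (simp only: nn_integral_cmult)
  qed
  also have "\<dots> \<le> ennreal (exp (B n n + 4 * (B n n)\<^sup>2)) *
      ennreal (exp ((\<Sum>i<n. B' i i) + 4 * \<kappa>\<^sup>2 * real n))"
    by (rule mult_mono[OF ennreal_leI[OF inverse_sqrt_one_minus_le_exp[OF bnn]] Suc.IH[OF sym' bound']]) simp_all
  also have "\<dots> = ennreal (exp (B n n + 4 * (B n n)\<^sup>2 + (\<Sum>i<n. B' i i) + 4 * \<kappa>\<^sup>2 * real n))"
  proof -
    have "ennreal (exp u) * ennreal (exp v) = ennreal (exp (u + v))" for u v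
      by (subst exp_add, subst ennreal_mult') simp_all
    thus ?thesis by (simp only: add.assoc)
  qed
  also have "\<dots> \<le> ennreal (exp ((\<Sum>i<Suc n. B i i) + 4 * \<kappa>\<^sup>2 * real (Suc n)))"
  proof (intro ennreal_leI, subst exp_le_cancel_iff)
    have "(\<Sum>i<n. B' i i) = (\<Sum>i<n. B i i) + d * (\<Sum>i<n. (B n i)\<^sup>2)"
      by (simp add: B'_def sum.distrib sum_distrib_left power2_eq_square mult_ac)
    moreover have "d * (\<Sum>i<n. (B n i)\<^sup>2) \<le> 4 * (\<Sum>i<n. (B n i)\<^sup>2)"
      using d by (intro mult_right_mono sum_nonneg) auto
    ultimately show "B n n + 4 * (B n n)\<^sup>2 + (\<Sum>i<n. B' i i) + 4 * \<kappa>\<^sup>2 * real n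
        \<le> (\<Sum>i<Suc n. B i i) + 4 * \<kappa>\<^sup>2 * real (Suc n)"
      using row by (simp add: algebra_simps)
  qed
  finally show ?case .
qed

text \<open>A symmetric form is bounded by its largest absolute row sum, because
$2 |u_s u_t| \le u_s^2 + u_t^2$. Each lag occurs at most twice in a row.\<close>

lemma quad_form_lag_bound:
  assumes a: "\<And>h. 0 \<le> a h"
    and B: "\<And>s t. s < n \<Longrightarrow> t < n \<Longrightarrow> s \<le> t \<Longrightarrow> \<bar>B s t\<bar> \<le> a (t - s) \<and> \<bar>B t s\<bar> \<le> a (t - s)"
  shows "quad_form n B u \<le> 2 * (\<Sum>h=0..n. a h) * (\<Sum>t<n. (u t)\<^sup>2)"
proof -
  define d :: "nat \<Rightarrow> nat \<Rightarrow> nat" where "d = (\<lambda>s t. if s \<le> t then t - s else s - t)"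
  have dsym: "d s t = d t s" for s t by (simp add: d_def)
  have row: "(\<Sum>t<n. a (d s t)) \<le> 2 * (\<Sum>h=0..n. a h)" if s: "s < n" for s
  proof -
    have "(\<Sum>t<n. a (d s t)) = (\<Sum>t\<in>{..s}. a (d s t)) + (\<Sum>t\<in>{s<..<n}. a (d s t))"
    proof -
      have "{..<n} = {..s} \<union> {s<..<n}" "{..s} \<inter> {s<..<n} = {}" using s by auto
      thus ?thesis by (simp add: sum.union_disjoint)
    qed
    also have "(\<Sum>t\<in>{..s}. a (d s t)) = sum a ((\<lambda>t. s - t) ` {..s})"
      by (subst sum.reindex) (auto simp: inj_on_def d_def intro!: sum.cong)
    also have "\<dots> \<le> (\<Sum>h=0..n. a h)" using s a by (intro sum_mono2) auto
    also have "(\<Sum>t\<in>{s<..<n}. a (d s t)) = sum a ((\<lambda>t. t - s) ` {s<..<n})"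
      by (subst sum.reindex) (auto simp: inj_on_def d_def intro!: sum.cong)
    also have "\<dots> \<le> (\<Sum>h=0..n. a h)" using s a by (intro sum_mono2) auto
    finally show ?thesis by simp
  qed
  have "quad_form n B u \<le> (\<Sum>s<n. \<Sum>t<n. a (d s t) * ((u s)\<^sup>2 + (u t)\<^sup>2) / 2)"
    unfolding quad_form_def
  proof (intro sum_mono)
    fix s t assume "s \<in> {..<n}" "t \<in> {..<n}"
    hence "\<bar>B s t\<bar> \<le> a (d s t)" using B[of s t] B[of t s] by (auto simp: d_def)
    hence "\<bar>B s t\<bar> * \<bar>u s * u t\<bar> \<le> a (d s t) * (((u s)\<^sup>2 + (u t)\<^sup>2) / 2)"
    proof (rule mult_mono)
      have "2 * (\<bar>u s\<bar> * \<bar>u t\<bar>) \<le> \<bar>u s\<bar>\<^sup>2 + \<bar>u t\<bar>\<^sup>2" using sum_squares_bound[of "\<bar>u s\<bar>" "\<bar>u t\<bar>"] by simp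
      thus "\<bar>u s * u t\<bar> \<le> ((u s)\<^sup>2 + (u t)\<^sup>2) / 2" by (simp add: abs_mult)
    qed (simp_all add: a)
    hence "\<bar>B s t * (u s * u t)\<bar> \<le> a (d s t) * (((u s)\<^sup>2 + (u t)\<^sup>2) / 2)" by (simp only: abs_mult)
    thus "B s t * u s * u t \<le> a (d s t) * ((u s)\<^sup>2 + (u t)\<^sup>2) / 2" by (simp add: mult.assoc abs_le_iff)
  qed
  also have "\<dots> = (\<Sum>s<n. \<Sum>t<n. a (d s t) * (u s)\<^sup>2 / 2) + (\<Sum>s<n. \<Sum>t<n. a (d s t) * (u t)\<^sup>2 / 2)"
    by (simp add: sum.distrib[symmetric] add_divide_distrib distrib_left)
  also have "(\<Sum>s<n. \<Sum>t<n. a (d s t) * (u t)\<^sup>2 / 2) = (\<Sum>s<n. \<Sum>t<n. a (d s t) * (u s)\<^sup>2 / 2)"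
    by (subst sum.swap) (simp add: dsym)
  also have "(\<Sum>s<n. \<Sum>t<n. a (d s t) * (u s)\<^sup>2 / 2) + (\<Sum>s<n. \<Sum>t<n. a (d s t) * (u s)\<^sup>2 / 2) =
      (\<Sum>s<n. (\<Sum>t<n. a (d s t)) * (u s)\<^sup>2)"
    by (simp add: sum_divide_distrib[symmetric] sum_distrib_right sum.distrib[symmetric])
  also have "\<dots> \<le> (\<Sum>s<n. 2 * (\<Sum>h=0..n. a h) * (u s)\<^sup>2)"
    using row by (intro sum_mono mult_right_mono) auto
  finally show ?thesis by (simp add: sum_distrib_left)
qed

section \<open>Centered normal random variables\<close>

text \<open>Treats the degenerate law together with the others.\<close>

lemma centered_normal_law_eq_distr:
  assumes "0 \<le> v"
  shows "centered_normal_law v = distr std_normal_distribution borel (\<lambda>x. sqrt v * x)"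
proof (cases "v = 0")
  case True
  interpret N: prob_space std_normal_distribution by (simp add: prob_space_normal_density)
  have "distr std_normal_distribution borel (\<lambda>x. 0) = return borel (0::real)"
    by (rule N.distr_const) simp
  thus ?thesis using True by (simp add: centered_normal_law_def)
next
  case False
  interpret N: prob_space std_normal_distribution by (simp add: prob_space_normal_density)
  have "distributed std_normal_distribution lborel (\<lambda>x. x) (normal_density 0 1)"
    unfolding distributed_def
  proof (intro conjI)
    show "distr std_normal_distribution lborel (\<lambda>x. x) = std_normal_distribution"
      by (subst distr_id2[of lborel std_normal_distribution]) simp_all
  qed simp_all
  from N.normal_density_affine[OF this, of "sqrt v" 0]
  have "distributed std_normal_distribution lborel (\<lambda>x. sqrt v * x) (normal_density 0 (sqrt v))"
    using False assms by simp
  hence "distr std_normal_distribution lborel (\<lambda>x. sqrt v * x) = density lborel (\<lambda>x. ennreal (normal_density 0 (sqrt v) x))"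
    by (simp add: distributed_def)
  moreover have "distr std_normal_distribution lborel (\<lambda>x. sqrt v * x) = distr std_normal_distribution borel (\<lambda>x. sqrt v * x)"
    by (rule distr_cong) simp_all
  ultimately show ?thesis using False by (simp add: centered_normal_law_def)
qed

lemma real_distribution_centered_normal_law:
  assumes "0 \<le> v"
  shows "real_distribution (centered_normal_law v)"
proof -
  interpret N: prob_space std_normal_distribution by (simp add: prob_space_normal_density)
  show ?thesis unfolding centered_normal_law_eq_distr[OF assms]
    by (rule N.real_distribution_distr) simp
qed

definition centered_normal :: "'a measure \<Rightarrow> ('a \<Rightarrow> real) \<Rightarrow> bool" where
  "centered_normal M X \<longleftrightarrow> X \<in> borel_measurable M \<and> (\<exists>v\<ge>0. distr M borel X = centered_normal_law v)"

lemma centered_normal_measurable: "centered_normal M X \<Longrightarrow> X \<in> borel_measurable M"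
  by (simp add: centered_normal_def)

lemma std_normal_moments:
  "integrable std_normal_distribution (\<lambda>x. x ^ 2)"
  "(LINT x|std_normal_distribution. x ^ 2) = 1"
  "integrable std_normal_distribution (\<lambda>x. x)"
  "(LINT x|std_normal_distribution. x) = 0"
  using integrable_std_normal_distribution_moment[of 2] std_normal_distribution_even_moments(1)[of 1]
    integrable_std_normal_distribution_moment[of 1] integral_std_normal_distribution_moment_odd[of 1]
  by (simp_all add: fact_numeral)

context prob_space
begin

abbreviation second_moment :: "('a \<Rightarrow> real) \<Rightarrow> real" where
  "second_moment X \<equiv> expectation (\<lambda>\<omega>. (X \<omega>)\<^sup>2)"

lemma centered_normalE:
  assumes "centered_normal M X"
  obtains v where "0 \<le> v"
    "distr M borel X = distr std_normal_distribution borel (\<lambda>x. sqrt v * x)"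
    "second_moment X = v"
proof -
  obtain v where v: "0 \<le> v" "distr M borel X = centered_normal_law v" and [measurable]: "X \<in> borel_measurable M"
    using assms by (auto simp: centered_normal_def)
  note d = v(2)[unfolded centered_normal_law_eq_distr[OF v(1)]]
  have "second_moment X = (LINT x|distr M borel X. x\<^sup>2)"
    by (subst integral_distr) simp_all
  also have "\<dots> = (LINT x|std_normal_distribution. v * x\<^sup>2)"
    unfolding d using v(1) by (subst integral_distr) (simp_all add: power_mult_distrib)
  also have "\<dots> = v" using std_normal_moments by simp
  finally show ?thesis using that v(1) d by blast
qed

lemma centered_normal_integrable_square:
  assumes "centered_normal M X"
  shows "integrable M (\<lambda>\<omega>. (X \<omega>)\<^sup>2)"
proof -
  note [measurable] = centered_normal_measurable[OF assms]
  obtain v where v: "distr M borel X = distr std_normal_distribution borel (\<lambda>x. sqrt v * x)" "0 \<le> v"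
    using centered_normalE[OF assms] by metis
  have "integrable (distr M borel X) (\<lambda>x. x\<^sup>2)"
  proof -
    have "integrable std_normal_distribution (\<lambda>x. v * x\<^sup>2)"
      by (intro integrable_mult_right std_normal_moments)
    moreover have "(\<lambda>x. v * x\<^sup>2) = (\<lambda>x. (sqrt v * x)\<^sup>2)"
      using v(2) by (simp add: power_mult_distrib)
    ultimately show ?thesis unfolding v(1) by (subst integrable_distr_eq) simp_all
  qed
  thus ?thesis by (subst (asm) integrable_distr_eq) simp_all
qed

lemma centered_normal_expectation_eq_0:
  assumes "centered_normal M X"
  shows "expectation X = 0"
proof -
  note [measurable] = centered_normal_measurable[OF assms]
  obtain v where v: "distr M borel X = distr std_normal_distribution borel (\<lambda>x. sqrt v * x)" "0 \<le> v"
    using centered_normalE[OF assms] by metis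
  have "expectation X = (LINT x|distr M borel X. x)"
    by (subst integral_distr) simp_all
  also have "\<dots> = (LINT x|std_normal_distribution. sqrt v * x)"
    unfolding v by (subst integral_distr) simp_all
  also have "\<dots> = 0" using std_normal_moments by simp
  finally show ?thesis .
qed

lemma centered_normal_integrable_mult:
  assumes "centered_normal M X" "centered_normal M Y"
  shows "integrable M (\<lambda>\<omega>. X \<omega> * Y \<omega>)"
proof (rule Bochner_Integration.integrable_bound)
  show "integrable M (\<lambda>\<omega>. (X \<omega>)\<^sup>2 + (Y \<omega>)\<^sup>2)"
    using assms by (intro Bochner_Integration.integrable_add centered_normal_integrable_square)
  show "(\<lambda>\<omega>. X \<omega> * Y \<omega>) \<in> borel_measurable M"
    using assms by (auto dest!: centered_normal_measurable)
  have "\<bar>x * z\<bar> \<le> x\<^sup>2 + z\<^sup>2" for x z :: real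
  proof -
    have "2 * (\<bar>x\<bar> * \<bar>z\<bar>) \<le> \<bar>x\<bar>\<^sup>2 + \<bar>z\<bar>\<^sup>2" using sum_squares_bound[of "\<bar>x\<bar>" "\<bar>z\<bar>"] by simp
    moreover have "0 \<le> \<bar>x\<bar> * \<bar>z\<bar>" by simp
    ultimately show ?thesis by (simp only: abs_mult power2_abs)
  qed
  thus "AE \<omega> in M. norm (X \<omega> * Y \<omega>) \<le> norm ((X \<omega>)\<^sup>2 + (Y \<omega>)\<^sup>2)"
    by (simp add: abs_of_nonneg)
qed

lemma centered_normal_exp:
  assumes "centered_normal M X"
  shows "(\<integral>\<^sup>+\<omega>. ennreal (exp (c * X \<omega>)) \<partial>M) = ennreal (exp (c\<^sup>2 * second_moment X / 2))"
proof -
  note [measurable] = centered_normal_measurable[OF assms]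
  obtain v where v: "distr M borel X = distr std_normal_distribution borel (\<lambda>x. sqrt v * x)" "0 \<le> v"
    "second_moment X = v"
    using centered_normalE[OF assms] by metis
  have "(\<integral>\<^sup>+\<omega>. ennreal (exp (c * X \<omega>)) \<partial>M) = (\<integral>\<^sup>+x. ennreal (exp (c * x)) \<partial>distr M borel X)"
    by (subst nn_integral_distr) simp_all
  also have "\<dots> = (\<integral>\<^sup>+x. ennreal (exp (0 * x\<^sup>2 + (c * sqrt v) * x)) \<partial>std_normal_distribution)"
    unfolding v by (subst nn_integral_distr) (simp_all add: mult.assoc)
  also have "\<dots> = ennreal (exp (c\<^sup>2 * v / 2))"
    using v(2) by (subst std_normal_exp_quadratic) (simp_all add: power_mult_distrib)
  finally show ?thesis by (simp add: v)
qed

lemma centered_normal_iexp: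
  assumes "centered_normal M X"
  shows "(CLINT \<omega>|M. iexp (c * X \<omega>)) = complex_of_real (exp (- (c\<^sup>2 * second_moment X / 2)))"
proof -
  note [measurable] = centered_normal_measurable[OF assms]
  obtain v where v: "distr M borel X = distr std_normal_distribution borel (\<lambda>x. sqrt v * x)" "0 \<le> v"
    "second_moment X = v"
    using centered_normalE[OF assms] by metis
  have "(CLINT \<omega>|M. iexp (c * X \<omega>)) = (CLINT x|distr M borel X. iexp (c * x))"
    by (subst integral_distr) simp_all
  also have "\<dots> = (CLINT x|std_normal_distribution. iexp ((c * sqrt v) * x))"
    unfolding v by (subst integral_distr) (simp_all add: mult.assoc)
  also have "\<dots> = char std_normal_distribution (c * sqrt v)" by (simp add: char_def)
  also have "\<dots> = complex_of_real (exp (- (c\<^sup>2 * v / 2)))"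
    using v(2) by (simp add: char_std_normal_distribution power_mult_distrib)
  finally show ?thesis by (simp add: v)
qed

lemma char_centered_normal_law:
  assumes "0 \<le> v"
  shows "char (centered_normal_law v) t = complex_of_real (exp (- (t\<^sup>2 * v / 2)))"
proof -
  have "char (centered_normal_law v) t = char std_normal_distribution (t * sqrt v)"
    unfolding char_def centered_normal_law_eq_distr[OF assms]
    by (subst integral_distr) (simp_all add: mult.assoc)
  thus ?thesis using assms by (simp add: char_std_normal_distribution power_mult_distrib)
qed

text \<open>Levy's uniqueness theorem for characteristic functions.\<close>

lemma centered_normalI_iexp:
  assumes [measurable]: "X \<in> borel_measurable M" and "0 \<le> v"
    and ch: "\<And>t. (CLINT \<omega>|M. iexp (t * X \<omega>)) = complex_of_real (exp (- (t\<^sup>2 * v / 2)))"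
  shows "centered_normal M X"
proof -
  have "distr M borel X = centered_normal_law v"
  proof (rule Levy_uniqueness)
    show "real_distribution (distr M borel X)" by (rule real_distribution_distr) simp
    show "real_distribution (centered_normal_law v)" by (rule real_distribution_centered_normal_law) fact
    show "char (distr M borel X) = char (centered_normal_law v)"
    proof
      fix t
      have "char (distr M borel X) t = (CLINT \<omega>|M. iexp (t * X \<omega>))"
        unfolding char_def by (subst integral_distr) simp_all
      thus "char (distr M borel X) t = char (centered_normal_law v) t"
        using assms by (simp add: char_centered_normal_law)
    qed
  qed
  thus ?thesis using assms by (auto simp: centered_normal_def)
qed

lemma centered_normal_sum_indep:
  assumes fin: "finite A" and ind: "indep_vars (\<lambda>_. borel) X A"
    and X: "\<And>i. i \<in> A \<Longrightarrow> centered_normal M (X i)"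
  shows "centered_normal M (\<lambda>\<omega>. \<Sum>i\<in>A. X i \<omega>)"
proof (rule centered_normalI_iexp)
  have [measurable]: "i \<in> A \<Longrightarrow> X i \<in> borel_measurable M" for i
    using X by (rule centered_normal_measurable)
  show m: "(\<lambda>\<omega>. \<Sum>i\<in>A. X i \<omega>) \<in> borel_measurable M" by measurable
  show "0 \<le> (\<Sum>i\<in>A. second_moment (X i))" by (intro sum_nonneg Bochner_Integration.integral_nonneg) simp
  fix t
  have "(CLINT \<omega>|M. iexp (t * (\<Sum>i\<in>A. X i \<omega>))) = char (distr M borel (\<lambda>\<omega>. \<Sum>i\<in>A. X i \<omega>)) t"
    unfolding char_def by (subst integral_distr[OF m]) simp_all
  also have "\<dots> = (\<Prod>i\<in>A. char (distr M borel (X i)) t)" by (rule char_distr_sum[OF ind])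
  also have "\<dots> = (\<Prod>i\<in>A. complex_of_real (exp (- (t\<^sup>2 * second_moment (X i) / 2))))"
  proof (rule prod.cong[OF refl])
    fix i assume i: "i \<in> A"
    have "char (distr M borel (X i)) t = (CLINT \<omega>|M. iexp (t * X i \<omega>))"
      unfolding char_def using i by (subst integral_distr) simp_all
    thus "char (distr M borel (X i)) t = complex_of_real (exp (- (t\<^sup>2 * second_moment (X i) / 2)))"
      using centered_normal_iexp[OF X[OF i]] by simp
  qed
  also have "\<dots> = complex_of_real (exp (\<Sum>i\<in>A. - (t\<^sup>2 * second_moment (X i) / 2)))"
    using fin by (simp add: exp_sum)
  also have "(\<Sum>i\<in>A. - (t\<^sup>2 * second_moment (X i) / 2)) = - (t\<^sup>2 * (\<Sum>i\<in>A. second_moment (X i)) / 2)"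
    by (simp add: sum_negf sum_distrib_left sum_divide_distrib)
  finally show "(CLINT \<omega>|M. iexp (t * (\<Sum>i\<in>A. X i \<omega>))) =
      complex_of_real (exp (- (t\<^sup>2 * (\<Sum>i\<in>A. second_moment (X i)) / 2)))" .
qed

text \<open>The characteristic functions $e^{- t^2 v_n / 2}$ converge pointwise to that of the limit. This is
continuous at $0$ with value $1$, hence positive at some $u \neq 0$, and its value at \<open>u\<close> forces the
variances $v_n$ to converge. The limit of the $v_n$ is the variance of the limit.\<close>

lemma centered_normal_limit:
  assumes S: "\<And>n. centered_normal M (S n)" and [measurable]: "X \<in> borel_measurable M"
    and lim: "AE \<omega> in M. (\<lambda>n. S n \<omega>) \<longlonglongrightarrow> X \<omega>"
  shows "centered_normal M X"
    and "(\<lambda>n. second_moment (S n)) \<longlonglongrightarrow> second_moment X"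
proof -
  note [measurable] = centered_normal_measurable[OF S]
  define V where "V = (\<lambda>n. second_moment (S n))"
  define \<phi> where "\<phi> = (\<lambda>t. CLINT \<omega>|M. iexp (t * X \<omega>))"
  have V0: "0 \<le> V n" for n by (simp add: V_def)
  have conv: "(\<lambda>n. complex_of_real (exp (- (t\<^sup>2 * V n / 2)))) \<longlonglongrightarrow> \<phi> t" for t
  proof -
    have "(\<lambda>n. CLINT \<omega>|M. iexp (t * S n \<omega>)) \<longlonglongrightarrow> \<phi> t"
      unfolding \<phi>_def
    proof (rule integral_dominated_convergence[where w="\<lambda>_. 1"])
      show "AE \<omega> in M. (\<lambda>n. iexp (t * S n \<omega>)) \<longlonglongrightarrow> iexp (t * X \<omega>)"
        using lim by eventually_elim (auto intro!: tendsto_intros)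
      show "(\<lambda>\<omega>. iexp (t * X \<omega>)) \<in> borel_measurable M" by measurable
      show "(\<lambda>\<omega>. iexp (t * S n \<omega>)) \<in> borel_measurable M" for n by measurable
      show "AE \<omega> in M. cmod (iexp (t * S n \<omega>)) \<le> 1" for n
        by (simp del: of_real_mult)
    qed (rule integrable_const)
    thus ?thesis by (simp only: centered_normal_iexp[OF S] V_def)
  qed
  have conv_re: "(\<lambda>n. exp (- (t\<^sup>2 * V n / 2))) \<longlonglongrightarrow> Re (\<phi> t)" for t
    using tendsto_Re[OF conv[of t]] by simp
  have \<phi>re: "\<phi> t = complex_of_real (Re (\<phi> t))" for t
    using LIMSEQ_unique[OF conv[of t] tendsto_of_real[OF conv_re[of t]]] .
  interpret D: real_distribution "distr M borel X" by (rule real_distribution_distr) simp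
  have \<phi>char: "\<phi> = char (distr M borel X)"
    unfolding \<phi>_def char_def by (rule ext, subst integral_distr) simp_all
  have "isCont (\<lambda>t. Re (\<phi> t)) 0"
    unfolding \<phi>char by (rule bounded_linear.isCont[OF bounded_linear_Re D.isCont_char])
  moreover have "Re (\<phi> 0) = 1" unfolding \<phi>char D.char_zero by simp
  ultimately have "((\<lambda>t. Re (\<phi> t)) \<longlongrightarrow> 1) (at 0)" by (simp add: isCont_def)
  hence "eventually (\<lambda>t. 0 < Re (\<phi> t)) (at (0::real))" by (rule order_tendstoD) simp
  then obtain e where e: "e > 0" "\<And>t. t \<noteq> 0 \<Longrightarrow> \<bar>t\<bar> < e \<Longrightarrow> 0 < Re (\<phi> t)"
    by (auto simp: eventually_at dist_real_def)
  define u where "u = e / 2"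
  have u: "u > 0" "0 < Re (\<phi> u)" using e(1) by (auto simp: u_def intro!: e(2))
  define v where "v = - 2 * ln (Re (\<phi> u)) / u\<^sup>2"
  have Vv: "V \<longlonglongrightarrow> v"
  proof -
    have "(\<lambda>n. - 2 * ln (exp (- (u\<^sup>2 * V n / 2))) / u\<^sup>2) \<longlonglongrightarrow> v"
      unfolding v_def using u by (intro tendsto_intros conv_re) auto
    thus ?thesis using u by simp
  qed
  have v0: "0 \<le> v" by (rule LIMSEQ_le_const[OF Vv]) (simp add: V0)
  have \<phi>v: "\<phi> t = complex_of_real (exp (- (t\<^sup>2 * v / 2)))" for t
    by (rule LIMSEQ_unique[OF conv]) (intro tendsto_intros Vv; simp)
  show cn: "centered_normal M X"
    by (rule centered_normalI_iexp[OF _ v0]) (use \<phi>v in \<open>auto simp: \<phi>_def\<close>)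
  have "second_moment X = v"
  proof -
    have "\<phi> 1 = complex_of_real (exp (- (second_moment X / 2)))"
      unfolding \<phi>_def using centered_normal_iexp[OF cn, of 1] by simp
    with \<phi>v[of 1] have "exp (- (second_moment X / 2)) = exp (- (v / 2))"
      by (simp only: of_real_eq_iff) simp
    thus ?thesis by simp
  qed
  thus "(\<lambda>n. second_moment (S n)) \<longlonglongrightarrow> second_moment X"
    using Vv unfolding V_def by (simp only:)
qed

end

section \<open>Concentration of sums of squares and products of Gaussian variables\<close>

lemma std_normal_product_exp:
  fixes w :: "nat \<Rightarrow> real"
  shows "(\<integral>\<^sup>+x. ennreal (exp (c * (\<Sum>t<n. x t * w t))) \<partial>std_normal_product n) =
    ennreal (exp (c\<^sup>2 * (\<Sum>t<n. (w t)\<^sup>2) / 2))"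
proof -
  interpret product_prob_space "\<lambda>_::nat. std_normal_distribution"
    by (rule product_prob_space_std_normal)
  have "(\<integral>\<^sup>+x. ennreal (exp (c * (\<Sum>t<n. x t * w t))) \<partial>std_normal_product n) =
      (\<integral>\<^sup>+x. (\<Prod>t<n. ennreal (exp (0 * (x t)\<^sup>2 + (c * w t) * x t))) \<partial>std_normal_product n)"
  proof (rule nn_integral_cong)
    fix x :: "nat \<Rightarrow> real"
    have "exp (c * (\<Sum>t<n. x t * w t)) = (\<Prod>t<n. exp (0 * (x t)\<^sup>2 + (c * w t) * x t))"
      by (simp add: exp_sum[symmetric] sum_distrib_left mult_ac)
    thus "ennreal (exp (c * (\<Sum>t<n. x t * w t))) = (\<Prod>t<n. ennreal (exp (0 * (x t)\<^sup>2 + (c * w t) * x t)))"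
      by (simp only: prod_ennreal exp_ge_zero)
  qed
  also have "\<dots> = (\<Prod>t<n. (\<integral>\<^sup>+z. ennreal (exp (0 * z\<^sup>2 + (c * w t) * z)) \<partial>std_normal_distribution))"
    by (rule product_nn_integral_prod) simp_all
  also have "\<dots> = (\<Prod>t<n. ennreal (exp ((c * w t)\<^sup>2 / 2)))"
    by (intro prod.cong refl, subst std_normal_exp_quadratic) simp_all
  also have "\<dots> = ennreal (\<Prod>t<n. exp ((c * w t)\<^sup>2 / 2))" by (simp only: prod_ennreal exp_ge_zero)
  also have "(\<Prod>t<n. exp ((c * w t)\<^sup>2 / 2)) = exp (c\<^sup>2 * (\<Sum>t<n. (w t)\<^sup>2) / 2)"
    by (simp add: exp_sum[symmetric] sum_distrib_left sum_divide_distrib power_mult_distrib)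
  finally show ?thesis .
qed

lemma std_normal_product_iexp:
  fixes w :: "nat \<Rightarrow> real"
  shows "(CLINT x|std_normal_product n. iexp (c * (\<Sum>t<n. x t * w t))) =
    complex_of_real (exp (- (c\<^sup>2 * (\<Sum>t<n. (w t)\<^sup>2) / 2)))"
proof -
  interpret N: prob_space std_normal_distribution by (simp add: prob_space_normal_density)
  interpret product_prob_space "\<lambda>_::nat. std_normal_distribution"
    by (rule product_prob_space_std_normal)
  have "(CLINT x|std_normal_product n. iexp (c * (\<Sum>t<n. x t * w t))) =
      (CLINT x|std_normal_product n. (\<Prod>t<n. iexp ((c * w t) * x t)))"
    by (simp add: exp_sum[symmetric] sum_distrib_left mult_ac)
  also have "\<dots> = (\<Prod>t<n. (CLINT z|std_normal_distribution. iexp ((c * w t) * z)))"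
    by (rule product_integral_prod) (simp_all add: N.integrable_iexp)
  also have "\<dots> = (\<Prod>t<n. complex_of_real (exp (- ((c * w t)\<^sup>2) / 2)))"
    by (rule prod.cong[OF refl]) (rule char_std_normal_distribution[unfolded char_def, THEN fun_cong])
  also have "\<dots> = complex_of_real (exp (- (c\<^sup>2 * (\<Sum>t<n. (w t)\<^sup>2) / 2)))"
    by (simp add: exp_sum[symmetric] sum_distrib_left sum_divide_distrib power_mult_distrib sum_negf flip: of_real_prod)
  finally show ?thesis .
qed

abbreviation deviation_bound :: "real \<Rightarrow> nat \<Rightarrow> real \<Rightarrow> real" where
  "deviation_bound K n x \<equiv> 4 * exp (- (real n * x\<^sup>2 / (64 * K\<^sup>2)))"

text \<open>Joint normality by linear combinations, which includes singular covariance matrices.\<close>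

definition gaussian_family :: "'a measure \<Rightarrow> nat \<Rightarrow> (nat \<Rightarrow> 'a \<Rightarrow> real) \<Rightarrow> bool" where
  "gaussian_family M n W \<longleftrightarrow> (\<forall>u. centered_normal M (\<lambda>\<omega>. \<Sum>t<n. u t * W t \<omega>))"

lemma gaussian_family_component:
  assumes "gaussian_family M n W" "t < n"
  shows "centered_normal M (W t)"
proof -
  have "(\<lambda>\<omega>. \<Sum>s<n. (if s = t then 1 else 0) * W s \<omega>) = W t"
    using assms(2) by (auto simp: fun_eq_iff if_distrib[of "\<lambda>x. x * _"] cong: if_cong)
  thus ?thesis using assms(1) unfolding gaussian_family_def by metis
qed

context prob_space
begin

definition cov_form :: "(nat \<Rightarrow> 'a \<Rightarrow> real) \<Rightarrow> nat \<Rightarrow> nat \<Rightarrow> real" where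
  "cov_form W s t = expectation (\<lambda>\<omega>. W s \<omega> * W t \<omega>)"

lemma expectation_lin_comb_square:
  assumes W: "gaussian_family M n W"
  shows "second_moment (\<lambda>\<omega>. \<Sum>t<n. u t * W t \<omega>) = quad_form n (cov_form W) u"
proof -
  have i: "integrable M (\<lambda>\<omega>. W s \<omega> * W t \<omega>)" if "s < n" "t < n" for s t
    using that by (intro centered_normal_integrable_mult gaussian_family_component[OF W])
  have *: "(\<Sum>t<n. u t * W t \<omega>)\<^sup>2 = (\<Sum>s<n. \<Sum>t<n. u s * u t * (W s \<omega> * W t \<omega>))" for \<omega>
    by (simp add: power2_eq_square sum_product mult_ac)
  have "second_moment (\<lambda>\<omega>. \<Sum>t<n. u t * W t \<omega>) =
      (\<Sum>s<n. \<Sum>t<n. u s * u t * cov_form W s t)"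
  proof -
    have "expectation (\<lambda>\<omega>. \<Sum>s<n. \<Sum>t<n. u s * u t * (W s \<omega> * W t \<omega>)) =
        (\<Sum>s<n. expectation (\<lambda>\<omega>. \<Sum>t<n. u s * u t * (W s \<omega> * W t \<omega>)))"
      using i by (intro Bochner_Integration.integral_sum Bochner_Integration.integrable_sum integrable_mult_right) auto
    also have "\<dots> = (\<Sum>s<n. \<Sum>t<n. expectation (\<lambda>\<omega>. u s * u t * (W s \<omega> * W t \<omega>)))"
      using i by (intro sum.cong refl Bochner_Integration.integral_sum integrable_mult_right) auto
    finally show ?thesis using * by (simp add: cov_form_def)
  qed
  thus ?thesis by (simp add: quad_form_def mult_ac)
qed

text \<open>The exponent is quadratic in $W$. It becomes linear by means of an independent standard normal
vector \<open>x\<close>, since $e^{\theta w^2}$ is the expectation of $e^{\sqrt{2\theta}\,x w}$. After the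
integrals have been exchanged, the inner one is an exponential moment of a linear combination of the
$W_t$, which depends on the covariances alone. For the negative exponent the characteristic
function takes the place of the exponential moment.\<close>

lemma
  assumes W: "gaussian_family M n W" and \<theta>: "0 \<le> \<theta>"
  shows gaussian_square_sum_exp:
    "(\<integral>\<^sup>+\<omega>. ennreal (exp (\<theta> * (\<Sum>t<n. (W t \<omega>)\<^sup>2))) \<partial>M) =
      (\<integral>\<^sup>+x. ennreal (exp (quad_form n (\<lambda>s t. \<theta> * cov_form W s t) x)) \<partial>std_normal_product n)"
    and gaussian_square_sum_exp_minus:
    "(\<integral>\<^sup>+\<omega>. ennreal (exp (- \<theta> * (\<Sum>t<n. (W t \<omega>)\<^sup>2))) \<partial>M) =
      (\<integral>\<^sup>+x. ennreal (exp (quad_form n (\<lambda>s t. - \<theta> * cov_form W s t) x)) \<partial>std_normal_product n)"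
proof -
  let ?P = "PiM {..<n} (\<lambda>_::nat. std_normal_distribution)"
  interpret PP: product_prob_space "\<lambda>_::nat. std_normal_distribution"
    by (rule product_prob_space_std_normal)
  interpret P: prob_space ?P by (rule prob_space_PiM) (simp add: prob_space_normal_density)
  interpret MP: pair_prob_space M ?P ..
  have Wm: "W t \<in> borel_measurable M" if "t < n" for t
    using gaussian_family_component[OF W that] by (rule centered_normal_measurable)
  define c where "c = sqrt (2 * \<theta>)"
  have c2: "c\<^sup>2 = 2 * \<theta>" using \<theta> by (simp add: c_def)
  let ?l = "\<lambda>\<omega> x. \<Sum>t<n. x t * W t \<omega>"
  have lm: "(\<lambda>z. ?l (fst z) (snd z)) \<in> borel_measurable (M \<Otimes>\<^sub>M ?P)"
  proof (intro borel_measurable_sum borel_measurable_times)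
    fix t assume "t \<in> {..<n}"
    hence t: "t < n" by simp
    have [measurable]: "(\<lambda>x. x t) \<in> borel_measurable ?P"
      using measurable_component_singleton[of t "{..<n}" "\<lambda>_. std_normal_distribution"] t by simp
    note [measurable] = Wm[OF t]
    show "(\<lambda>z. snd z t) \<in> borel_measurable (M \<Otimes>\<^sub>M ?P)" by measurable
    show "(\<lambda>z. W t (fst z)) \<in> borel_measurable (M \<Otimes>\<^sub>M ?P)" by measurable
  qed
  have cn: "centered_normal M (\<lambda>\<omega>. ?l \<omega> x)" for x
    using W by (simp add: gaussian_family_def)
  have q: "expectation (\<lambda>\<omega>. (?l \<omega> x)\<^sup>2) = quad_form n (cov_form W) x" for x
    by (rule expectation_lin_comb_square[OF W])
  have "(\<integral>\<^sup>+\<omega>. ennreal (exp (\<theta> * (\<Sum>t<n. (W t \<omega>)\<^sup>2))) \<partial>M) =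
      (\<integral>\<^sup>+\<omega>. (\<integral>\<^sup>+x. ennreal (exp (c * ?l \<omega> x)) \<partial>?P) \<partial>M)"
    by (simp only: std_normal_product_exp c2) simp
  also have "\<dots> = (\<integral>\<^sup>+x. (\<integral>\<^sup>+\<omega>. ennreal (exp (c * ?l \<omega> x)) \<partial>M) \<partial>?P)"
  proof (rule MP.Fubini'[symmetric])
    have "(\<lambda>z. ennreal (exp (c * ?l (fst z) (snd z)))) \<in> borel_measurable (M \<Otimes>\<^sub>M ?P)"
      using lm by measurable
    thus "(\<lambda>(\<omega>, x). ennreal (exp (c * ?l \<omega> x))) \<in> borel_measurable (M \<Otimes>\<^sub>M ?P)"
      by (simp add: case_prod_beta')
  qed
  also have "\<dots> = (\<integral>\<^sup>+x. ennreal (exp (quad_form n (\<lambda>s t. \<theta> * cov_form W s t) x)) \<partial>?P)"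
    by (simp only: centered_normal_exp[OF cn] c2 q quad_form_scale) simp
  finally show "(\<integral>\<^sup>+\<omega>. ennreal (exp (\<theta> * (\<Sum>t<n. (W t \<omega>)\<^sup>2))) \<partial>M) =
      (\<integral>\<^sup>+x. ennreal (exp (quad_form n (\<lambda>s t. \<theta> * cov_form W s t) x)) \<partial>?P)" .

  have int: "integrable (M \<Otimes>\<^sub>M ?P) (\<lambda>(\<omega>, x). iexp (c * ?l \<omega> x))"
  proof (rule MP.integrable_const_bound[where B=1])
    show "AE z in M \<Otimes>\<^sub>M ?P. norm (case z of (\<omega>, x) \<Rightarrow> iexp (c * ?l \<omega> x)) \<le> 1"
      by (simp add: case_prod_beta' del: of_real_mult of_real_sum)
    have "(\<lambda>z. iexp (c * ?l (fst z) (snd z))) \<in> borel_measurable (M \<Otimes>\<^sub>M ?P)"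
      using lm by measurable
    thus "(\<lambda>(\<omega>, x). iexp (c * ?l \<omega> x)) \<in> borel_measurable (M \<Otimes>\<^sub>M ?P)"
      by (simp add: case_prod_beta')
  qed
  have "(CLINT \<omega>|M. complex_of_real (exp (- \<theta> * (\<Sum>t<n. (W t \<omega>)\<^sup>2)))) =
      (CLINT \<omega>|M. (CLINT x|?P. iexp (c * ?l \<omega> x)))"
    by (simp only: std_normal_product_iexp c2) simp
  also have "\<dots> = (CLINT x|?P. (CLINT \<omega>|M. iexp (c * ?l \<omega> x)))"
    by (rule MP.Fubini_integral[OF int, symmetric])
  also have "\<dots> = (CLINT x|?P. complex_of_real (exp (quad_form n (\<lambda>s t. - \<theta> * cov_form W s t) x)))"
    by (simp only: centered_normal_iexp[OF cn] c2 q quad_form_scale) simp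
  finally have eq: "expectation (\<lambda>\<omega>. exp (- \<theta> * (\<Sum>t<n. (W t \<omega>)\<^sup>2))) =
      (LINT x|?P. exp (quad_form n (\<lambda>s t. - \<theta> * cov_form W s t) x))"
    by (simp only: integral_complex_of_real of_real_eq_iff)
  have "(\<integral>\<^sup>+\<omega>. ennreal (exp (- \<theta> * (\<Sum>t<n. (W t \<omega>)\<^sup>2))) \<partial>M) =
      ennreal (expectation (\<lambda>\<omega>. exp (- \<theta> * (\<Sum>t<n. (W t \<omega>)\<^sup>2))))"
  proof (rule nn_integral_eq_integral)
    show "integrable M (\<lambda>\<omega>. exp (- \<theta> * (\<Sum>t<n. (W t \<omega>)\<^sup>2)))"
    proof (rule integrable_const_bound[where B=1])
      have "0 \<le> \<theta> * (\<Sum>t<n. (W t \<omega>)\<^sup>2)" for \<omega> using \<theta> by (simp add: sum_nonneg)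
      thus "AE \<omega> in M. norm (exp (- \<theta> * (\<Sum>t<n. (W t \<omega>)\<^sup>2))) \<le> 1" by simp
      have "(\<lambda>\<omega>. \<Sum>t<n. (W t \<omega>)\<^sup>2) \<in> borel_measurable M"
        using Wm by (intro borel_measurable_sum borel_measurable_power) simp
      thus "(\<lambda>\<omega>. exp (- \<theta> * (\<Sum>t<n. (W t \<omega>)\<^sup>2))) \<in> borel_measurable M" by measurable
    qed
  qed simp
  moreover have "(\<integral>\<^sup>+x. ennreal (exp (quad_form n (\<lambda>s t. - \<theta> * cov_form W s t) x)) \<partial>?P) =
      ennreal (LINT x|?P. exp (quad_form n (\<lambda>s t. - \<theta> * cov_form W s t) x))"
  proof (rule nn_integral_eq_integral)
    show "integrable ?P (\<lambda>x. exp (quad_form n (\<lambda>s t. - \<theta> * cov_form W s t) x))"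
    proof (rule P.integrable_const_bound[where B=1])
      have "0 \<le> quad_form n (cov_form W) x" for x unfolding q[symmetric] by simp
      hence "quad_form n (\<lambda>s t. - \<theta> * cov_form W s t) x \<le> 0" for x
        unfolding quad_form_scale using \<theta> by (simp add: mult_nonneg_nonneg)
      thus "AE x in ?P. norm (exp (quad_form n (\<lambda>s t. - \<theta> * cov_form W s t) x)) \<le> 1" by simp
      show "(\<lambda>x. exp (quad_form n (\<lambda>s t. - \<theta> * cov_form W s t) x)) \<in> borel_measurable ?P"
        by (intro measurable_compose[OF quad_form_measurable]) simp
    qed
  qed simp
  ultimately show "(\<integral>\<^sup>+\<omega>. ennreal (exp (- \<theta> * (\<Sum>t<n. (W t \<omega>)\<^sup>2))) \<partial>M) =
      (\<integral>\<^sup>+x. ennreal (exp (quad_form n (\<lambda>s t. - \<theta> * cov_form W s t) x)) \<partial>?P)"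
    unfolding eq by simp
qed

end

context prob_space
begin

lemma exp_moment_tail:
  assumes [measurable]: "X \<in> borel_measurable M"
    and le: "(\<integral>\<^sup>+\<omega>. ennreal (exp (X \<omega>)) \<partial>M) \<le> ennreal (exp m)"
  shows "prob {\<omega> \<in> space M. m + z \<le> X \<omega>} \<le> exp (- z)"
proof -
  have eq: "{\<omega> \<in> space M. m + z \<le> X \<omega>} =
      {\<omega> \<in> space M. 1 \<le> ennreal (exp (- (m + z))) * ennreal (exp (X \<omega>))}"
  proof -
    have "1 \<le> ennreal (exp (- (m + z))) * ennreal (exp (X \<omega>)) \<longleftrightarrow> m + z \<le> X \<omega>" for \<omega>
    proof -
      have "ennreal (exp (- (m + z))) * ennreal (exp (X \<omega>)) = ennreal (exp (- (m + z) + X \<omega>))"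
        by (subst exp_add, subst ennreal_mult') simp_all
      thus ?thesis by simp linarith
    qed
    thus ?thesis by simp
  qed
  have "emeasure M {\<omega> \<in> space M. m + z \<le> X \<omega>} \<le>
      ennreal (exp (- (m + z))) * (\<integral>\<^sup>+\<omega>. ennreal (exp (X \<omega>)) * indicator (space M) \<omega> \<partial>M)"
    unfolding eq by (rule order_trans[OF nn_integral_Markov_inequality]) simp_all
  also have "(\<integral>\<^sup>+\<omega>. ennreal (exp (X \<omega>)) * indicator (space M) \<omega> \<partial>M) = (\<integral>\<^sup>+\<omega>. ennreal (exp (X \<omega>)) \<partial>M)"
    by (rule nn_integral_cong) simp
  also have "ennreal (exp (- (m + z))) * \<dots> \<le> ennreal (exp (- (m + z))) * ennreal (exp m)"
    using le by (rule mult_left_mono) simp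
  also have "\<dots> = ennreal (exp (- (m + z)) * exp m)" by (simp add: ennreal_mult')
  also have "exp (- (m + z)) * exp m = exp (- z)" unfolding exp_add[symmetric] by simp
  finally show ?thesis by (simp add: emeasure_eq_measure)
qed

text \<open>Markov's inequality for $e^{\pm\theta \sum_t W_t^2}$. The exponent
$- \theta y + 4 \theta^2 K^2 n$ is minimal at $\theta = y / (8 K^2 n)$, and $y \le 2 K n$ is what
makes this $\theta$ small enough for \<open>gaussian_chaos_exp_bound\<close>.\<close>

theorem gaussian_square_sum_tail:
  assumes W: "gaussian_family M n W" and n: "0 < n" and K: "0 < K"
    and bound: "\<And>u. second_moment (\<lambda>\<omega>. \<Sum>t<n. u t * W t \<omega>) \<le> K * (\<Sum>t<n. (u t)\<^sup>2)"
    and y: "0 \<le> y" "y \<le> 2 * K * real n"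
  shows "prob {\<omega> \<in> space M. y \<le> \<bar>(\<Sum>t<n. (W t \<omega>)\<^sup>2) - (\<Sum>t<n. second_moment (W t))\<bar>}
    \<le> 2 * exp (- (y\<^sup>2 / (16 * K\<^sup>2 * real n)))"
proof -
  let ?S = "\<lambda>\<omega>. \<Sum>t<n. (W t \<omega>)\<^sup>2"
  define m where "m = (\<Sum>t<n. cov_form W t t)"
  have m: "m = (\<Sum>t<n. second_moment (W t))" by (simp add: m_def cov_form_def power2_eq_square)
  have Wm: "W t \<in> borel_measurable M" if "t < n" for t
    using gaussian_family_component[OF W that] by (rule centered_normal_measurable)
  have [measurable]: "?S \<in> borel_measurable M"
    using Wm by (intro borel_measurable_sum borel_measurable_power) simp
  \<comment> \<open>The minimizer of \<open>- \<theta> y + 4 \<theta>^2 K^2 n\<close>; the minimum is \<open>- z\<close> below.\<close>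
  define \<theta> where "\<theta> = y / (8 * K\<^sup>2 * real n)"
  have \<theta>0: "0 \<le> \<theta>" using y by (simp add: \<theta>_def)
  have \<theta>K: "\<theta> * K \<le> 1/4" using y K n by (simp add: \<theta>_def field_simps power2_eq_square)
  have q: "0 \<le> quad_form n (cov_form W) u" "quad_form n (cov_form W) u \<le> K * (\<Sum>t<n. (u t)\<^sup>2)" for u
    using bound[of u] unfolding expectation_lin_comb_square[OF W, symmetric] by simp_all
  have sym: "cov_form W i j = cov_form W j i" for i j by (simp add: cov_form_def mult.commute)
  have chaos: "(\<integral>\<^sup>+x. ennreal (exp (quad_form n (\<lambda>s t. e * cov_form W s t) x)) \<partial>std_normal_product n)
      \<le> ennreal (exp (e * m + 4 * (\<theta> * K)\<^sup>2 * real n))" if "\<bar>e\<bar> = \<theta>" for e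
  proof -
    have "\<bar>quad_form n (\<lambda>s t. e * cov_form W s t) x\<bar> \<le> \<theta> * K * (\<Sum>i<n. (x i)\<^sup>2)" for x
      unfolding quad_form_scale abs_mult that mult.assoc using q[of x] \<theta>0
      by (intro mult_left_mono) auto
    from gaussian_chaos_exp_bound[OF _ this] show ?thesis
      using \<theta>0 K \<theta>K by (simp add: m_def sum_distrib_left sym)
  qed
  define z where "z = \<theta> * y - 4 * (\<theta> * K)\<^sup>2 * real n"
  have z: "z = y\<^sup>2 / (16 * K\<^sup>2 * real n)"
    using K n by (simp add: z_def \<theta>_def power2_eq_square field_simps)
  let ?up = "{\<omega> \<in> space M. (\<theta> * m + 4 * (\<theta> * K)\<^sup>2 * real n) + z \<le> \<theta> * ?S \<omega>}"
  let ?lo = "{\<omega> \<in> space M. (- \<theta> * m + 4 * (\<theta> * K)\<^sup>2 * real n) + z \<le> - \<theta> * ?S \<omega>}"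
  have up: "prob ?up \<le> exp (- z)"
    using chaos[of \<theta>] \<theta>0 by (intro exp_moment_tail) (simp_all add: gaussian_square_sum_exp[OF W])
  have lo: "prob ?lo \<le> exp (- z)"
  proof (rule exp_moment_tail)
    show "(\<integral>\<^sup>+\<omega>. ennreal (exp (- \<theta> * ?S \<omega>)) \<partial>M) \<le> ennreal (exp (- \<theta> * m + 4 * (\<theta> * K)\<^sup>2 * real n))"
      using chaos[of "- \<theta>"] \<theta>0 gaussian_square_sum_exp_minus[OF W \<theta>0] by simp
  qed measurable
  have "prob {\<omega> \<in> space M. y \<le> \<bar>?S \<omega> - m\<bar>} \<le>
      prob (?up \<union> ?lo)"
  proof (rule finite_measure_mono)
    show "{\<omega> \<in> space M. y \<le> \<bar>?S \<omega> - m\<bar>} \<subseteq> ?up \<union> ?lo"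
    proof
      fix \<omega> assume "\<omega> \<in> {\<omega> \<in> space M. y \<le> \<bar>?S \<omega> - m\<bar>}"
      hence "\<omega> \<in> space M" and "y \<le> ?S \<omega> - m \<or> y \<le> - (?S \<omega> - m)" by auto
      hence "\<theta> * y \<le> \<theta> * (?S \<omega> - m) \<or> \<theta> * y \<le> \<theta> * (- (?S \<omega> - m))"
        using \<theta>0 by (meson mult_left_mono)
      thus "\<omega> \<in> ?up \<union> ?lo"
        using \<open>\<omega> \<in> space M\<close> by (auto simp: z_def right_diff_distrib)
    qed
  qed measurable
  also have "\<dots> \<le> exp (- z) + exp (- z)"
    by (rule order_trans[OF measure_Un_le add_mono[OF up lo]]) measurable
  finally show ?thesis by (simp add: z m)
qed

text \<open>$4 U V = (U + V)^2 - (U - V)^2$, and the second moments of the linear combinations of $U \pm V$ are at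
most twice the sum of those of $U$ and $V$, so separate bounds for the two factors suffice.\<close>

theorem gaussian_product_mean_tail:
  assumes fam: "gaussian_family M n U" "gaussian_family M n V"
    "gaussian_family M n (\<lambda>t \<omega>. U t \<omega> + V t \<omega>)" "gaussian_family M n (\<lambda>t \<omega>. U t \<omega> - V t \<omega>)"
    and n: "0 < n" and K: "0 < K"
    and U: "\<And>u. second_moment (\<lambda>\<omega>. \<Sum>t<n. u t * U t \<omega>) \<le> K * (\<Sum>t<n. (u t)\<^sup>2)"
    and V: "\<And>u. second_moment (\<lambda>\<omega>. \<Sum>t<n. u t * V t \<omega>) \<le> K * (\<Sum>t<n. (u t)\<^sup>2)"
    and mean: "\<And>t. t < n \<Longrightarrow> expectation (\<lambda>\<omega>. U t \<omega> * V t \<omega>) = g"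
    and x: "0 \<le> x" "x \<le> 4 * K"
  shows "prob {\<omega> \<in> space M. x < \<bar>(\<Sum>t<n. U t \<omega> * V t \<omega>) / real n - g\<bar>}
    \<le> deviation_bound K n x"
proof -
  define P where "P = (\<lambda>t \<omega>. U t \<omega> + V t \<omega>)"
  define N where "N = (\<lambda>t \<omega>. U t \<omega> - V t \<omega>)"
  note famPN = fam(3,4)[folded P_def N_def]
  note Um = centered_normal_measurable[OF gaussian_family_component[OF fam(1)]]
  note Vm = centered_normal_measurable[OF gaussian_family_component[OF fam(2)]]
  note iU = centered_normal_integrable_square[OF gaussian_family_component[OF fam(1)]]
  note iV = centered_normal_integrable_square[OF gaussian_family_component[OF fam(2)]]
  have iUV: "integrable M (\<lambda>\<omega>. U t \<omega> * V t \<omega>)" if "t < n" for t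
    using that by (intro centered_normal_integrable_mult gaussian_family_component[OF fam(1)] gaussian_family_component[OF fam(2)])
  have i: "integrable M (\<lambda>\<omega>. (\<Sum>t<n. u t * W t \<omega>)\<^sup>2)" if "gaussian_family M n W" for u W
    using that by (intro centered_normal_integrable_square) (simp add: gaussian_family_def)
  have bound: "second_moment (\<lambda>\<omega>. \<Sum>t<n. u t * W t \<omega>) \<le> (4 * K) * (\<Sum>t<n. (u t)\<^sup>2)"
    if W: "W = P \<or> W = N" for u W
  proof -
    have "second_moment (\<lambda>\<omega>. \<Sum>t<n. u t * W t \<omega>) \<le>
        expectation (\<lambda>\<omega>. 2 * (\<Sum>t<n. u t * U t \<omega>)\<^sup>2 + 2 * (\<Sum>t<n. u t * V t \<omega>)\<^sup>2)"
    proof (rule integral_mono)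
      show "integrable M (\<lambda>\<omega>. (\<Sum>t<n. u t * W t \<omega>)\<^sup>2)" using W famPN i by blast
      show "integrable M (\<lambda>\<omega>. 2 * (\<Sum>t<n. u t * U t \<omega>)\<^sup>2 + 2 * (\<Sum>t<n. u t * V t \<omega>)\<^sup>2)"
        by (intro Bochner_Integration.integrable_add integrable_mult_right i fam)
      fix \<omega>
      define A B where "A = (\<Sum>t<n. u t * U t \<omega>)" and "B = (\<Sum>t<n. u t * V t \<omega>)"
      have "(\<Sum>t<n. u t * W t \<omega>) = A + B \<or> (\<Sum>t<n. u t * W t \<omega>) = A - B"
        using W by (auto simp: P_def N_def A_def B_def distrib_left right_diff_distrib sum.distrib sum_subtractf)
      moreover have "(A + B)\<^sup>2 \<le> 2 * A\<^sup>2 + 2 * B\<^sup>2" "(A - B)\<^sup>2 \<le> 2 * A\<^sup>2 + 2 * B\<^sup>2"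
        using sum_squares_bound[of A B] sum_squares_bound[of A "- B"] by (simp_all add: power2_sum power2_diff)
      ultimately show "(\<Sum>t<n. u t * W t \<omega>)\<^sup>2 \<le> 2 * (\<Sum>t<n. u t * U t \<omega>)\<^sup>2 + 2 * (\<Sum>t<n. u t * V t \<omega>)\<^sup>2"
        unfolding A_def[symmetric] B_def[symmetric] by fastforce
    qed
    also have "\<dots> = 2 * second_moment (\<lambda>\<omega>. \<Sum>t<n. u t * U t \<omega>) + 2 * second_moment (\<lambda>\<omega>. \<Sum>t<n. u t * V t \<omega>)"
      using i[OF fam(1)] i[OF fam(2)] by simp
    finally show ?thesis using U[of u] V[of u] by linarith
  qed
  \<comment> \<open>If the mean of the products is off by \<open>x\<close>, their sum is off by \<open>n x\<close>, the difference of the two sums of squares by \<open>4 n x\<close>, and one of them by half of this.\<close>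
  define y where "y = 2 * real n * x"
  have y: "0 \<le> y" "y \<le> 2 * (4 * K) * real n" using x n by (simp_all add: y_def)
  let ?D = "\<lambda>W \<omega>. (\<Sum>t<n. (W t \<omega>)\<^sup>2) - (\<Sum>t<n. second_moment (W t))"
  have tail: "prob {\<omega> \<in> space M. y \<le> \<bar>?D W \<omega>\<bar>} \<le> 2 * exp (- (y\<^sup>2 / (16 * (4 * K)\<^sup>2 * real n)))"
    if "W = P \<or> W = N" for W
    using that famPN K bound[OF that] by (intro gaussian_square_sum_tail n y) auto
  have D: "?D P \<omega> - ?D N \<omega> = 4 * ((\<Sum>t<n. U t \<omega> * V t \<omega>) - real n * g)" for \<omega>
  proof -
    have "(\<Sum>t<n. second_moment (P t)) - (\<Sum>t<n. second_moment (N t)) = (\<Sum>t<n. 4 * g)"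
      unfolding sum_subtractf[symmetric]
    proof (rule sum.cong[OF refl])
      fix t assume "t \<in> {..<n}"
      hence t: "t < n" by simp
      have "second_moment (P t) - second_moment (N t) =
          expectation (\<lambda>\<omega>. (P t \<omega>)\<^sup>2 - (N t \<omega>)\<^sup>2)"
        using t by (intro Bochner_Integration.integral_diff[symmetric] centered_normal_integrable_square
          gaussian_family_component[OF famPN(1)] gaussian_family_component[OF famPN(2)])
      also have "(\<lambda>\<omega>. (P t \<omega>)\<^sup>2 - (N t \<omega>)\<^sup>2) = (\<lambda>\<omega>. 4 * (U t \<omega> * V t \<omega>))"
        by (simp add: P_def N_def power2_sum power2_diff)
      finally show "second_moment (P t) - second_moment (N t) = 4 * g"
        using mean[OF t] by simp
    qed
    moreover have "(\<Sum>t<n. (P t \<omega>)\<^sup>2) - (\<Sum>t<n. (N t \<omega>)\<^sup>2) = 4 * (\<Sum>t<n. U t \<omega> * V t \<omega>)"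
      unfolding sum_subtractf[symmetric] sum_distrib_left
      by (rule sum.cong) (simp_all add: P_def N_def power2_sum power2_diff)
    ultimately show ?thesis by simp
  qed
  have Dm: "?D W \<in> borel_measurable M" if "W = P \<or> W = N" for W
    using that Um Vm by (auto simp: P_def N_def intro!: borel_measurable_diff borel_measurable_sum borel_measurable_power borel_measurable_add borel_measurable_const)
  have [measurable]: "?D P \<in> borel_measurable M" "?D N \<in> borel_measurable M" by (rule Dm, simp)+
  have "prob {\<omega> \<in> space M. x < \<bar>(\<Sum>t<n. U t \<omega> * V t \<omega>) / real n - g\<bar>} \<le>
      prob ({\<omega> \<in> space M. y \<le> \<bar>?D P \<omega>\<bar>} \<union> {\<omega> \<in> space M. y \<le> \<bar>?D N \<omega>\<bar>})"
  proof (rule finite_measure_mono)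
    show "{\<omega> \<in> space M. x < \<bar>(\<Sum>t<n. U t \<omega> * V t \<omega>) / real n - g\<bar>} \<subseteq>
        {\<omega> \<in> space M. y \<le> \<bar>?D P \<omega>\<bar>} \<union> {\<omega> \<in> space M. y \<le> \<bar>?D N \<omega>\<bar>}"
    proof
      fix \<omega> assume "\<omega> \<in> {\<omega> \<in> space M. x < \<bar>(\<Sum>t<n. U t \<omega> * V t \<omega>) / real n - g\<bar>}"
      hence \<omega>: "\<omega> \<in> space M" and *: "x < \<bar>(\<Sum>t<n. U t \<omega> * V t \<omega>) / real n - g\<bar>" by auto
      define E where "E = (\<Sum>t<n. U t \<omega> * V t \<omega>) - real n * g"
      have "(\<Sum>t<n. U t \<omega> * V t \<omega>) / real n - g = E / real n" using n by (simp add: E_def field_simps)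
      hence "real n * x < \<bar>E\<bar>" using * n by (simp add: field_simps)
      moreover have "?D P \<omega> - ?D N \<omega> = 4 * E" unfolding D E_def ..
      ultimately have "y \<le> \<bar>?D P \<omega>\<bar> \<or> y \<le> \<bar>?D N \<omega>\<bar>" unfolding y_def by linarith
      thus "\<omega> \<in> {\<omega> \<in> space M. y \<le> \<bar>?D P \<omega>\<bar>} \<union> {\<omega> \<in> space M. y \<le> \<bar>?D N \<omega>\<bar>}"
        using \<omega> by blast
    qed
  qed measurable
  also have "\<dots> \<le> 2 * exp (- (y\<^sup>2 / (16 * (4 * K)\<^sup>2 * real n))) + 2 * exp (- (y\<^sup>2 / (16 * (4 * K)\<^sup>2 * real n)))"
    by (rule order_trans[OF measure_Un_le add_mono[OF tail tail]]) auto
  also have "y\<^sup>2 / (16 * (4 * K)\<^sup>2 * real n) = real n * x\<^sup>2 / (64 * K\<^sup>2)"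
    using n by (simp add: y_def power2_eq_square field_simps)
  finally show ?thesis by simp
qed

end

section \<open>The oracle inequality for the Lasso\<close>

lemma abs_sum_cone_bound:
  fixes \<delta> :: "nat \<Rightarrow> real"
  assumes J: "J \<subseteq> {..<d}"
    and cone: "(\<Sum>j\<in>{..<d} - J. \<bar>\<delta> j\<bar>) \<le> 3 * (\<Sum>j\<in>J. \<bar>\<delta> j\<bar>)"
  shows "(\<Sum>j<d. \<bar>\<delta> j\<bar>) \<le> 4 * (\<Sum>j\<in>J. \<bar>\<delta> j\<bar>)"
    and "(\<Sum>j\<in>J. \<bar>\<delta> j\<bar>)\<^sup>2 \<le> real (card J) * (\<Sum>j\<in>J. (\<delta> j)\<^sup>2)"
proof -
  have "(\<Sum>j<d. \<bar>\<delta> j\<bar>) = (\<Sum>j\<in>J. \<bar>\<delta> j\<bar>) + (\<Sum>j\<in>{..<d} - J. \<bar>\<delta> j\<bar>)"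
    using J by (simp add: sum.subset_diff)
  thus "(\<Sum>j<d. \<bar>\<delta> j\<bar>) \<le> 4 * (\<Sum>j\<in>J. \<bar>\<delta> j\<bar>)" using cone by simp
  show "(\<Sum>j\<in>J. \<bar>\<delta> j\<bar>)\<^sup>2 \<le> real (card J) * (\<Sum>j\<in>J. (\<delta> j)\<^sup>2)"
    using Cauchy_Schwarz_ineq_sum[of "\<lambda>_. 1" "\<lambda>j. \<bar>\<delta> j\<bar>" J] by simp
qed

text \<open>On the cone $\|\delta\|_{\ell_1}^2 \le 16 |J| \|\delta_J\|^2$, so an error $\eta$ in every entry of the
matrix changes the form by at most $16 |J| \eta \|\delta_J\|^2$.\<close>

lemma restricted_eigenvalue_perturbation:
  fixes \<Gamma> \<Psi> :: "nat \<Rightarrow> nat \<Rightarrow> real"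
  assumes J: "J \<subseteq> {..<d}" and cone: "(\<Sum>j\<in>{..<d} - J. \<bar>\<delta> j\<bar>) \<le> 3 * (\<Sum>j\<in>J. \<bar>\<delta> j\<bar>)"
    and close: "\<And>j l. j < d \<Longrightarrow> l < d \<Longrightarrow> \<bar>\<Psi> j l - \<Gamma> j l\<bar> \<le> \<eta>" and \<eta>: "0 \<le> \<eta>"
    and re: "c * (\<Sum>j\<in>J. (\<delta> j)\<^sup>2) \<le> (\<Sum>j<d. \<Sum>l<d. \<delta> j * \<Gamma> j l * \<delta> l)"
  shows "(c - 16 * real (card J) * \<eta>) * (\<Sum>j\<in>J. (\<delta> j)\<^sup>2) \<le> (\<Sum>j<d. \<Sum>l<d. \<delta> j * \<Psi> j l * \<delta> l)"
proof -
  note b = abs_sum_cone_bound[OF J cone]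
  have "(\<Sum>j<d. \<Sum>l<d. \<delta> j * \<Gamma> j l * \<delta> l) - (\<Sum>j<d. \<Sum>l<d. \<delta> j * \<Psi> j l * \<delta> l) =
      (\<Sum>j<d. \<Sum>l<d. \<delta> j * (\<Gamma> j l - \<Psi> j l) * \<delta> l)"
    by (simp add: sum_subtractf[symmetric] algebra_simps)
  also have "\<dots> \<le> (\<Sum>j<d. \<Sum>l<d. \<eta> * (\<bar>\<delta> j\<bar> * \<bar>\<delta> l\<bar>))"
  proof (intro sum_mono)
    fix j l assume jl: "j \<in> {..<d}" "l \<in> {..<d}"
    have "\<delta> j * (\<Gamma> j l - \<Psi> j l) * \<delta> l \<le> \<bar>\<delta> j * (\<Gamma> j l - \<Psi> j l) * \<delta> l\<bar>" by simp
    also have "\<dots> = \<bar>\<Psi> j l - \<Gamma> j l\<bar> * (\<bar>\<delta> j\<bar> * \<bar>\<delta> l\<bar>)" by (simp add: abs_mult abs_minus_commute)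
    also have "\<dots> \<le> \<eta> * (\<bar>\<delta> j\<bar> * \<bar>\<delta> l\<bar>)" using close jl by (intro mult_right_mono) auto
    finally show "\<delta> j * (\<Gamma> j l - \<Psi> j l) * \<delta> l \<le> \<eta> * (\<bar>\<delta> j\<bar> * \<bar>\<delta> l\<bar>)" .
  qed
  also have "\<dots> = \<eta> * (\<Sum>j<d. \<bar>\<delta> j\<bar>)\<^sup>2"
    unfolding power2_eq_square sum_product by (simp add: sum_distrib_left)
  also have "\<dots> \<le> \<eta> * (4 * (\<Sum>j\<in>J. \<bar>\<delta> j\<bar>))\<^sup>2"
    using b(1) \<eta> by (intro mult_left_mono power_mono) (auto intro: sum_nonneg)
  also have "\<dots> \<le> \<eta> * (16 * (real (card J) * (\<Sum>j\<in>J. (\<delta> j)\<^sup>2)))"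
    using b(2) \<eta> by (intro mult_left_mono) (simp_all add: power_mult_distrib)
  finally show ?thesis using re by (simp add: algebra_simps)
qed

text \<open>Here \<open>e\<close> is the noise and \<open>Z\<close> the design. Optimality of \<open>b\<close> bounds \<open>A\<close> by the correlation of the noise
with $Z\delta$ plus the change of the penalty. The contribution of the correlation is at most
$2\mu \|\delta\|_{\ell_1} = \lambda \|\delta\|_{\ell_1}$ and is compensated by the penalty outside $J$;
this puts \<open>\<delta>\<close> into the cone and leaves $A \le 8 \mu \|\delta_J\|_{\ell_1}$. The restricted
eigenvalue bounds $\|\delta_J\|_{\ell_1}^2$ by $|J| A / g$, and the two inequalities are solved for
both quantities. Without penalty the cone condition has to hold for another reason; the alternative
in the hypothesis on the penalty makes it trivial.\<close>

theorem lasso_oracle_inequality: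
  fixes Z :: "nat \<Rightarrow> nat \<Rightarrow> real" and e \<beta> b :: "nat \<Rightarrow> real"
    and T d :: nat
  defines "\<delta> \<equiv> \<lambda>j. b j - \<beta> j"
  defines "A \<equiv> (\<Sum>r<T. (\<Sum>j<d. Z r j * \<delta> j)\<^sup>2) / real T"
  assumes opt: "(\<Sum>r<T. (e r - (\<Sum>j<d. Z r j * \<delta> j))\<^sup>2) / real T + 2 * lam * (\<Sum>j<d. \<bar>b j\<bar>)
      \<le> (\<Sum>r<T. (e r)\<^sup>2) / real T + 2 * lam * (\<Sum>j<d. \<bar>\<beta> j\<bar>)"
    and noise: "\<And>j. j < d \<Longrightarrow> \<bar>(\<Sum>r<T. e r * Z r j) / real T\<bar> \<le> \<mu>"
    and \<mu>: "0 \<le> \<mu>"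
    and J: "J = {j. j < d \<and> \<beta> j \<noteq> 0}"
    and pen: "(0 < lam \<and> lam = 2 * \<mu>) \<or> (lam = 0 \<and> J = {..<d})"
    and g: "0 < g"
    and re: "(\<Sum>j\<in>{..<d} - J. \<bar>\<delta> j\<bar>) \<le> 3 * (\<Sum>j\<in>J. \<bar>\<delta> j\<bar>) \<Longrightarrow> g * (\<Sum>j\<in>J. (\<delta> j)\<^sup>2) \<le> A"
  shows "A \<le> 64 * real (card J) * \<mu>\<^sup>2 / g"
    and "(\<Sum>j<d. \<bar>\<delta> j\<bar>) \<le> 32 * real (card J) * \<mu> / g"
proof -
  let ?D = "\<Sum>j<d. \<bar>\<delta> j\<bar>" and ?DJ = "\<Sum>j\<in>J. \<bar>\<delta> j\<bar>" and ?DC = "\<Sum>j\<in>{..<d} - J. \<bar>\<delta> j\<bar>"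
  have JS: "J \<subseteq> {..<d}" using J by auto
  have D: "?D = ?DJ + ?DC" using JS by (simp add: sum.subset_diff)
  have DC0: "0 \<le> ?DC" and DJ0: "0 \<le> ?DJ" by (simp_all add: sum_nonneg)
  have A0: "0 \<le> A" by (simp add: A_def sum_nonneg)
  have cross: "(\<Sum>r<T. e r * (\<Sum>j<d. Z r j * \<delta> j)) / real T \<le> \<mu> * ?D"
  proof -
    have "(\<Sum>r<T. e r * (\<Sum>j<d. Z r j * \<delta> j)) = (\<Sum>r<T. \<Sum>j<d. (e r * Z r j) * \<delta> j)"
      by (simp add: sum_distrib_left mult.assoc)
    also have "\<dots> = (\<Sum>j<d. (\<Sum>r<T. e r * Z r j) * \<delta> j)"
      by (subst sum.swap) (simp add: sum_distrib_right)
    finally have "(\<Sum>r<T. e r * (\<Sum>j<d. Z r j * \<delta> j)) / real T = (\<Sum>j<d. (\<Sum>r<T. e r * Z r j) / real T * \<delta> j)"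
      by (simp only: sum_divide_distrib[where A="{..<d}"] times_divide_eq_left)
    also have "\<dots> \<le> (\<Sum>j<d. \<mu> * \<bar>\<delta> j\<bar>)"
    proof (rule sum_mono)
      fix j assume "j \<in> {..<d}"
      hence "\<bar>(\<Sum>r<T. e r * Z r j) / real T\<bar> * \<bar>\<delta> j\<bar> \<le> \<mu> * \<bar>\<delta> j\<bar>" using noise by (intro mult_right_mono) auto
      thus "(\<Sum>r<T. e r * Z r j) / real T * \<delta> j \<le> \<mu> * \<bar>\<delta> j\<bar>"
        unfolding abs_mult[symmetric] by (rule order_trans[OF abs_ge_self])
    qed
    finally show ?thesis by (simp add: sum_distrib_left)
  qed
  have "(\<Sum>r<T. (e r - (\<Sum>j<d. Z r j * \<delta> j))\<^sup>2) / real T =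
      (\<Sum>r<T. (e r)\<^sup>2) / real T - 2 * ((\<Sum>r<T. e r * (\<Sum>j<d. Z r j * \<delta> j)) / real T) + A"
    by (simp add: A_def power2_diff sum.distrib sum_subtractf sum_distrib_left add_divide_distrib diff_divide_distrib mult.assoc)
  hence basic: "A + 2 * lam * (\<Sum>j<d. \<bar>b j\<bar>) \<le> 2 * (\<mu> * ?D) + 2 * lam * (\<Sum>j<d. \<bar>\<beta> j\<bar>)"
    using opt cross by linarith
  have main: "A \<le> 8 * \<mu> * ?DJ" and cone: "?DC \<le> 3 * ?DJ"
  proof -
    have "A \<le> 8 * \<mu> * ?DJ \<and> ?DC \<le> 3 * ?DJ"
    proof (cases "lam = 0")
      case True
      hence "J = {..<d}" using pen by auto
      hence "?DC = 0" by simp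
      moreover from this D have "?D = ?DJ" by simp
      moreover have "0 \<le> \<mu> * ?DJ" using \<mu> DJ0 by simp
      ultimately show ?thesis using basic True DJ0 by simp
    next
      case False
      hence l: "0 < lam" "2 * \<mu> = lam" using pen by auto
      have "(\<Sum>j<d. \<bar>\<beta> j\<bar>) - (\<Sum>j<d. \<bar>b j\<bar>) + ?D = (\<Sum>j<d. \<bar>\<beta> j\<bar> - \<bar>b j\<bar> + \<bar>\<delta> j\<bar>)"
        by (simp add: sum.distrib sum_subtractf)
      also have "\<dots> = (\<Sum>j\<in>J. \<bar>\<beta> j\<bar> - \<bar>b j\<bar> + \<bar>\<delta> j\<bar>) + (\<Sum>j\<in>{..<d} - J. \<bar>\<beta> j\<bar> - \<bar>b j\<bar> + \<bar>\<delta> j\<bar>)"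
        using JS by (subst sum.subset_diff[of J]) simp_all
      also have "(\<Sum>j\<in>{..<d} - J. \<bar>\<beta> j\<bar> - \<bar>b j\<bar> + \<bar>\<delta> j\<bar>) = 0"
        by (rule sum.neutral) (auto simp: J \<delta>_def)
      also have "(\<Sum>j\<in>J. \<bar>\<beta> j\<bar> - \<bar>b j\<bar> + \<bar>\<delta> j\<bar>) \<le> (\<Sum>j\<in>J. 2 * \<bar>\<delta> j\<bar>)"
        by (rule sum_mono) (auto simp: \<delta>_def)
      finally have "(\<Sum>j<d. \<bar>\<beta> j\<bar>) - (\<Sum>j<d. \<bar>b j\<bar>) + ?D \<le> 2 * ?DJ"
        by (simp add: sum_distrib_left)
      hence "2 * lam * ((\<Sum>j<d. \<bar>\<beta> j\<bar>) - (\<Sum>j<d. \<bar>b j\<bar>) + ?D) \<le> 2 * lam * (2 * ?DJ)"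
        using l by (intro mult_left_mono) auto
      moreover have "2 * (\<mu> * ?D) = lam * ?D" unfolding l(2)[symmetric] by simp
      moreover have "2 * lam * ((\<Sum>j<d. \<bar>\<beta> j\<bar>) - (\<Sum>j<d. \<bar>b j\<bar>) + ?D) =
          2 * lam * (\<Sum>j<d. \<bar>\<beta> j\<bar>) - 2 * lam * (\<Sum>j<d. \<bar>b j\<bar>) + 2 * (lam * ?D)"
        by (simp add: algebra_simps)
      ultimately have *: "A + lam * ?D \<le> 4 * lam * ?DJ" using basic by linarith
      moreover have "0 \<le> lam * ?D" using l by (simp add: sum_nonneg)
      ultimately have "A \<le> 4 * lam * ?DJ" by linarith
      moreover have "lam * ?D \<le> lam * (4 * ?DJ)" using * A0 by (simp add: algebra_simps)
      hence "?D \<le> 4 * ?DJ" using l by simp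
      moreover have "4 * lam * ?DJ = 8 * \<mu> * ?DJ" unfolding l(2)[symmetric] by simp
      ultimately show ?thesis using D by linarith
    qed
    thus "A \<le> 8 * \<mu> * ?DJ" "?DC \<le> 3 * ?DJ" by auto
  qed
  note b = abs_sum_cone_bound[OF JS cone]
  have "g * ?DJ\<^sup>2 \<le> g * (real (card J) * (\<Sum>j\<in>J. (\<delta> j)\<^sup>2))" using b(2) g by simp
  also have "\<dots> = real (card J) * (g * (\<Sum>j\<in>J. (\<delta> j)\<^sup>2))" by simp
  also have "\<dots> \<le> real (card J) * A" using re[OF cone] by (intro mult_left_mono) auto
  also have "\<dots> \<le> real (card J) * (8 * \<mu> * ?DJ)" using main by (intro mult_left_mono) auto
  finally have sq: "g * ?DJ\<^sup>2 \<le> (8 * real (card J) * \<mu>) * ?DJ" by (simp add: algebra_simps)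
  have dj: "g * ?DJ \<le> 8 * real (card J) * \<mu>"
  proof (cases "?DJ = 0")
    case True thus ?thesis using \<mu> by simp
  next
    case False
    hence "0 < ?DJ" using DJ0 by linarith
    thus ?thesis using sq by (simp add: power2_eq_square mult.assoc[symmetric])
  qed
  hence dj': "?DJ \<le> 8 * real (card J) * \<mu> / g" using g by (simp add: field_simps)
  show "A \<le> 64 * real (card J) * \<mu>\<^sup>2 / g"
  proof -
    have "8 * \<mu> * ?DJ \<le> 8 * \<mu> * (8 * real (card J) * \<mu> / g)" using dj' \<mu> by (intro mult_left_mono) auto
    thus ?thesis using main by (simp add: power2_eq_square mult_ac)
  qed
  show "?D \<le> 32 * real (card J) * \<mu> / g" using b(1) dj' by simp
qed

section \<open>Euclidean and spectral norms\<close>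

lemma l2_norm_square: "(l2_norm v)\<^sup>2 = (\<Sum>j<dim_vec v. (v $ j)\<^sup>2)"
  by (simp add: l2_norm_def L2_set_def sum_nonneg)

lemma l2_norm_nonneg: "0 \<le> l2_norm v"
  by (simp add: l2_norm_def L2_set_nonneg)

lemma abs_component_le_l2_norm:
  assumes "j < dim_vec v" shows "\<bar>v $ j\<bar> \<le> l2_norm v"
proof -
  have "(v $ j)\<^sup>2 \<le> (\<Sum>i<dim_vec v. (v $ i)\<^sup>2)"
    by (rule member_le_sum) (use assms in auto)
  hence "sqrt ((v $ j)\<^sup>2) \<le> sqrt (\<Sum>i<dim_vec v. (v $ i)\<^sup>2)" by (rule real_sqrt_le_mono)
  thus ?thesis by (simp add: l2_norm_def L2_set_def)
qed

lemma l2_norm_smult: "l2_norm (c \<cdot>\<^sub>v v) = \<bar>c\<bar> * l2_norm v"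
  by (simp add: l2_norm_def L2_set_def power_mult_distrib sum_distrib_left[symmetric] real_sqrt_mult)

text \<open>The supremum in the definition of the spectral norm is over a bounded set, because each coordinate of
the product is at most an absolute row sum.\<close>

lemma l2_norm_mult_mat_vec_le:
  assumes v: "v \<in> carrier_vec (dim_col A)"
  shows "l2_norm (A *\<^sub>v v) \<le> spectral_norm A * l2_norm v"
proof -
  let ?B = "{v \<in> carrier_vec (dim_col A). l2_norm v \<le> 1}"
  have bdd: "bdd_above ((\<lambda>v. l2_norm (A *\<^sub>v v)) ` ?B)"
  proof (rule bdd_aboveI2)
    fix u assume u: "u \<in> ?B"
    have comp: "\<bar>(A *\<^sub>v u) $ i\<bar> \<le> (\<Sum>j<dim_col A. \<bar>A $$ (i, j)\<bar>)" if "i < dim_row A" for i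
    proof -
      have "(A *\<^sub>v u) $ i = (\<Sum>j<dim_col A. A $$ (i, j) * u $ j)"
        using that u by (auto simp: scalar_prod_def atLeast0LessThan)
      also have "\<bar>\<dots>\<bar> \<le> (\<Sum>j<dim_col A. \<bar>A $$ (i, j) * u $ j\<bar>)" by (rule sum_abs)
      also have "\<dots> \<le> (\<Sum>j<dim_col A. \<bar>A $$ (i, j)\<bar>)"
      proof (rule sum_mono)
        fix j assume "j \<in> {..<dim_col A}"
        hence "\<bar>u $ j\<bar> \<le> 1" using abs_component_le_l2_norm[of j u] u by auto
        thus "\<bar>A $$ (i, j) * u $ j\<bar> \<le> \<bar>A $$ (i, j)\<bar>"
          by (simp add: abs_mult mult_left_le)
      qed
      finally show ?thesis .
    qed
    have "l2_norm (A *\<^sub>v u) \<le> (\<Sum>i<dim_row A. \<bar>(A *\<^sub>v u) $ i\<bar>)"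
      unfolding l2_norm_def using L2_set_le_sum_abs[of "\<lambda>j. (A *\<^sub>v u) $ j" "{..<dim_row A}"] by simp
    also have "\<dots> \<le> (\<Sum>i<dim_row A. \<Sum>j<dim_col A. \<bar>A $$ (i, j)\<bar>)"
      using comp by (intro sum_mono) auto
    finally show "l2_norm (A *\<^sub>v u) \<le> (\<Sum>i<dim_row A. \<Sum>j<dim_col A. \<bar>A $$ (i, j)\<bar>)" .
  qed
  show ?thesis
  proof (cases "l2_norm v = 0")
    case True
    hence "v $ j = 0" if "j < dim_vec v" for j using abs_component_le_l2_norm[OF that] by simp
    hence "v = 0\<^sub>v (dim_col A)" using v by (intro eq_vecI) auto
    thus ?thesis using True by (simp add: l2_norm_def L2_set_def scalar_prod_def mult_mat_vec_def)
  next
    case False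
    hence pos: "0 < l2_norm v" using l2_norm_nonneg[of v] by linarith
    let ?u = "(1 / l2_norm v) \<cdot>\<^sub>v v"
    have "?u \<in> ?B" using v pos by (simp add: l2_norm_smult)
    hence "l2_norm (A *\<^sub>v ?u) \<le> spectral_norm A"
      unfolding spectral_norm_def by (rule cSUP_upper[OF _ bdd])
    moreover have "A *\<^sub>v ?u = (1 / l2_norm v) \<cdot>\<^sub>v (A *\<^sub>v v)"
      using v by (intro mult_mat_vec[of A "dim_row A" "dim_col A"]) auto
    ultimately show ?thesis using pos by (simp add: l2_norm_smult field_simps)
  qed
qed

lemma spectral_norm_nonneg: "0 \<le> spectral_norm A"
proof (cases "dim_col A = 0")
  case False
  define e :: "real vec" where "e = vec (dim_col A) (\<lambda>j. if j = 0 then 1 else 0)"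
  have e: "e \<in> carrier_vec (dim_col A)" by (simp add: e_def)
  have "1 \<le> l2_norm e"
    using abs_component_le_l2_norm[of 0 e] False by (simp add: e_def)
  moreover have "0 \<le> spectral_norm A * l2_norm e"
    using l2_norm_mult_mat_vec_le[OF e] l2_norm_nonneg[of "A *\<^sub>v e"] by linarith
  ultimately show ?thesis by (simp add: zero_le_mult_iff)
next
  case True
  have "{v \<in> carrier_vec (dim_col A). l2_norm v \<le> 1} = {0\<^sub>v 0}"
    using True by (auto simp: l2_norm_def L2_set_def)
  thus ?thesis by (simp add: spectral_norm_def l2_norm_nonneg)
qed

section \<open>Joint normality of noise and observations\<close>

context stationary_gaussian_var
begin

lemma noise_time_comb_centered_normal:
  "centered_normal M (\<lambda>\<omega>. \<Sum>j<k. c j * \<epsilon> t j \<omega>)"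
proof -
  define a where "a = vec k c"
  have a: "a \<in> carrier_vec k" by (simp add: a_def)
  note g = noise_gaussian[of t, unfolded centered_gaussian_vector_def]
  have eq: "(\<lambda>\<omega>. \<Sum>j<k. a $ j * \<epsilon> t j \<omega>) = (\<lambda>\<omega>. \<Sum>j<k. c j * \<epsilon> t j \<omega>)"
    by (simp add: a_def fun_eq_iff)
  have "distr M borel (\<lambda>\<omega>. \<Sum>j<k. a $ j * \<epsilon> t j \<omega>) = centered_normal_law (a \<bullet> (\<Sigma> *\<^sub>v a))"
    "0 \<le> a \<bullet> (\<Sigma> *\<^sub>v a)" using g a by auto
  moreover have "(\<lambda>\<omega>. \<Sum>j<k. c j * \<epsilon> t j \<omega>) \<in> borel_measurable M"
    using g by (intro borel_measurable_sum borel_measurable_times borel_measurable_const) auto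
  ultimately show ?thesis unfolding centered_normal_def eq by blast
qed

lemma noise_measurable: "j < k \<Longrightarrow> \<epsilon> t j \<in> borel_measurable M"
  using noise_gaussian[of t] by (simp add: centered_gaussian_vector_def)

lemma noise_centered_normal: "j < k \<Longrightarrow> centered_normal M (\<epsilon> t j)"
  using noise_time_comb_centered_normal[of "\<lambda>l. if l = j then 1 else 0" t]
  by (simp add: if_distrib[of "\<lambda>x. x * _"] cong: if_cong)

lemma noise_second_moment_time_invariant:
  assumes "j < k"
  shows "second_moment (\<epsilon> t j) = second_moment (\<epsilon> s j)"
proof -
  define a :: "real vec" where "a = vec k (\<lambda>l. if l = j then 1 else 0)"
  have "(\<lambda>\<omega>. \<Sum>l<k. a $ l * \<epsilon> u l \<omega>) = \<epsilon> u j" for u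
    using assms by (simp add: a_def fun_eq_iff if_distrib[of "\<lambda>x. x * _"] cong: if_cong)
  hence "distr M borel (\<epsilon> u j) = centered_normal_law (a \<bullet> (\<Sigma> *\<^sub>v a))" for u
    using noise_gaussian[of u] unfolding centered_gaussian_vector_def by (metis a_def vec_carrier)
  hence "distr M borel (\<epsilon> t j) = distr M borel (\<epsilon> s j)" by simp
  moreover have "second_moment (\<epsilon> u j) = (LINT x|distr M borel (\<epsilon> u j). x\<^sup>2)" for u
    using noise_measurable[OF assms] by (subst integral_distr) simp_all
  ultimately show ?thesis by simp
qed

definition noise_span :: "int set \<Rightarrow> ('a \<Rightarrow> real) set" where
  "noise_span I = {X. \<exists>A c. finite A \<and> A \<subseteq> I \<and> X = (\<lambda>\<omega>. \<Sum>\<tau>\<in>A. \<Sum>j<k. c \<tau> j * \<epsilon> \<tau> j \<omega>)}"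

lemma noise_span_zero: "(\<lambda>\<omega>. 0) \<in> noise_span I"
  unfolding noise_span_def by (auto intro!: exI[of _ "{}"])

lemma noise_span_noise: "\<tau> \<in> I \<Longrightarrow> j < k \<Longrightarrow> \<epsilon> \<tau> j \<in> noise_span I"
  unfolding noise_span_def mem_Collect_eq
  by (rule exI[of _ "{\<tau>}"], rule exI[of _ "\<lambda>_ l. if l = j then 1 else 0"])
    (auto simp: fun_eq_iff if_distrib[of "\<lambda>x. x * _"] cong: if_cong)

lemma noise_span_scale: assumes "X \<in> noise_span I" shows "(\<lambda>\<omega>. a * X \<omega>) \<in> noise_span I"
proof -
  obtain A c where "finite A" "A \<subseteq> I" "X = (\<lambda>\<omega>. \<Sum>\<tau>\<in>A. \<Sum>j<k. c \<tau> j * \<epsilon> \<tau> j \<omega>)"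
    using assms by (auto simp: noise_span_def)
  thus ?thesis unfolding noise_span_def mem_Collect_eq
    by (intro exI[of _ A] exI[of _ "\<lambda>\<tau> j. a * c \<tau> j"]) (simp add: sum_distrib_left mult.assoc)
qed

lemma noise_span_add:
  assumes "X \<in> noise_span I" "Y \<in> noise_span I" shows "(\<lambda>\<omega>. X \<omega> + Y \<omega>) \<in> noise_span I"
proof -
  obtain A c where A: "finite A" "A \<subseteq> I" "X = (\<lambda>\<omega>. \<Sum>\<tau>\<in>A. \<Sum>j<k. c \<tau> j * \<epsilon> \<tau> j \<omega>)"
    using assms by (auto simp: noise_span_def)
  obtain B d where B: "finite B" "B \<subseteq> I" "Y = (\<lambda>\<omega>. \<Sum>\<tau>\<in>B. \<Sum>j<k. d \<tau> j * \<epsilon> \<tau> j \<omega>)"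
    using assms by (auto simp: noise_span_def)
  define e where "e = (\<lambda>\<tau> j. (if \<tau> \<in> A then c \<tau> j else 0) + (if \<tau> \<in> B then d \<tau> j else 0))"
  have "X \<omega> + Y \<omega> = (\<Sum>\<tau>\<in>A \<union> B. \<Sum>j<k. e \<tau> j * \<epsilon> \<tau> j \<omega>)" for \<omega>
  proof -
    have "X \<omega> = (\<Sum>\<tau>\<in>A \<union> B. \<Sum>j<k. (if \<tau> \<in> A then c \<tau> j else 0) * \<epsilon> \<tau> j \<omega>)"
      unfolding A(3) using A(1) B(1) by (intro sum.mono_neutral_cong_left) auto
    moreover have "Y \<omega> = (\<Sum>\<tau>\<in>A \<union> B. \<Sum>j<k. (if \<tau> \<in> B then d \<tau> j else 0) * \<epsilon> \<tau> j \<omega>)"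
      unfolding B(3) using A(1) B(1) by (intro sum.mono_neutral_cong_left) auto
    ultimately show ?thesis by (simp only: e_def distrib_right sum.distrib)
  qed
  thus ?thesis unfolding noise_span_def mem_Collect_eq using A B
    by (intro exI[of _ "A \<union> B"] exI[of _ e]) auto
qed

lemma noise_span_sum:
  assumes "\<And>s. s \<in> S \<Longrightarrow> X s \<in> noise_span I"
  shows "(\<lambda>\<omega>. \<Sum>s\<in>S. X s \<omega>) \<in> noise_span I"
  using assms by (induction S rule: infinite_finite_induct) (auto intro: noise_span_zero noise_span_add)

lemma noise_span_mono: "I \<subseteq> J \<Longrightarrow> noise_span I \<subseteq> noise_span J"
  unfolding noise_span_def by blast

lemma noise_span_centered_normal:
  assumes "X \<in> noise_span I" shows "centered_normal M X"
proof -
  obtain A c where A: "finite A" "X = (\<lambda>\<omega>. \<Sum>\<tau>\<in>A. \<Sum>j<k. c \<tau> j * \<epsilon> \<tau> j \<omega>)"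
    using assms by (auto simp: noise_span_def)
  have "indep_vars (\<lambda>_. borel) (\<lambda>\<tau> \<omega>. \<Sum>j<k. c \<tau> j * (\<lambda>j\<in>{..<k}. \<epsilon> \<tau> j \<omega>) j) A"
    by (rule indep_vars_compose2[OF indep_vars_subset[OF noise_indep subset_UNIV]])
      (intro borel_measurable_sum borel_measurable_times borel_measurable_const measurable_component_singleton, auto)
  hence "indep_vars (\<lambda>_. borel) (\<lambda>\<tau> \<omega>. \<Sum>j<k. c \<tau> j * \<epsilon> \<tau> j \<omega>) A" by simp
  thus ?thesis unfolding A(2)
    by (intro centered_normal_sum_indep A(1) noise_time_comb_centered_normal)
qed

text \<open>The noise and, by causality, the observations belong to this space, which is closed under linear
combinations and consists of centered normal variables: this is the joint normality of the whole
process. The set \<open>I\<close> contains the times of the noise that is used, so the past of time \<open>t\<close> is the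
case \<open>I = {..<t}\<close>.\<close>

definition joint_span :: "int set \<Rightarrow> ('a \<Rightarrow> real) set" where
  "joint_span I = {X. X \<in> borel_measurable M \<and>
     (\<exists>S. (\<forall>n. S n \<in> noise_span I) \<and> (AE \<omega> in M. (\<lambda>n. S n \<omega>) \<longlonglongrightarrow> X \<omega>))}"

lemma joint_span_measurable: "X \<in> joint_span I \<Longrightarrow> X \<in> borel_measurable M"
  by (simp add: joint_span_def)

lemma joint_span_noise: "\<tau> \<in> I \<Longrightarrow> j < k \<Longrightarrow> \<epsilon> \<tau> j \<in> joint_span I"
  unfolding joint_span_def mem_Collect_eq
  by (intro conjI noise_measurable exI[of _ "\<lambda>_. \<epsilon> \<tau> j"] allI noise_span_noise) simp_all

lemma joint_span_observed:
  assumes "{..t} \<subseteq> I" "j < k" shows "y t j \<in> joint_span I"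
proof -
  obtain \<Psi> :: "nat \<Rightarrow> real mat" where
    s: "AE \<omega> in M. (\<lambda>n. \<Sum>l<k. \<Psi> n $$ (j, l) * \<epsilon> (t - int n) l \<omega>) sums y t j \<omega>"
    using causal assms(2) by blast
  define S where "S = (\<lambda>N \<omega>. \<Sum>n<N. \<Sum>l<k. \<Psi> n $$ (j, l) * \<epsilon> (t - int n) l \<omega>)"
  have "S N \<in> noise_span I" for N unfolding S_def
    using assms(1) by (intro noise_span_sum noise_span_scale noise_span_noise) auto
  moreover have "AE \<omega> in M. (\<lambda>n. S n \<omega>) \<longlonglongrightarrow> y t j \<omega>"
    using s by (simp add: S_def sums_def)
  ultimately show ?thesis using y_measurable[OF assms(2)] by (auto simp: joint_span_def)
qed

lemma joint_span_scale: assumes "X \<in> joint_span I" shows "(\<lambda>\<omega>. a * X \<omega>) \<in> joint_span I"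
proof -
  obtain S where S: "X \<in> borel_measurable M" "\<And>n. S n \<in> noise_span I" "AE \<omega> in M. (\<lambda>n. S n \<omega>) \<longlonglongrightarrow> X \<omega>"
    using assms by (auto simp: joint_span_def)
  have "AE \<omega> in M. (\<lambda>n. a * S n \<omega>) \<longlonglongrightarrow> a * X \<omega>" using S(3) by eventually_elim (rule tendsto_mult_left)
  thus ?thesis unfolding joint_span_def mem_Collect_eq using S
    by (intro conjI exI[of _ "\<lambda>n \<omega>. a * S n \<omega>"] allI noise_span_scale) auto
qed

lemma joint_span_add:
  assumes "X \<in> joint_span I" "Y \<in> joint_span I" shows "(\<lambda>\<omega>. X \<omega> + Y \<omega>) \<in> joint_span I"
proof -
  obtain S where S: "X \<in> borel_measurable M" "\<And>n. S n \<in> noise_span I" "AE \<omega> in M. (\<lambda>n. S n \<omega>) \<longlonglongrightarrow> X \<omega>"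
    using assms by (auto simp: joint_span_def)
  obtain R where R: "Y \<in> borel_measurable M" "\<And>n. R n \<in> noise_span I" "AE \<omega> in M. (\<lambda>n. R n \<omega>) \<longlonglongrightarrow> Y \<omega>"
    using assms by (auto simp: joint_span_def)
  have "AE \<omega> in M. (\<lambda>n. S n \<omega> + R n \<omega>) \<longlonglongrightarrow> X \<omega> + Y \<omega>"
    using S(3) R(3) by eventually_elim (rule tendsto_add)
  thus ?thesis unfolding joint_span_def mem_Collect_eq using S R
    by (intro conjI exI[of _ "\<lambda>n \<omega>. S n \<omega> + R n \<omega>"] allI noise_span_add) auto
qed

lemma joint_span_zero: "(\<lambda>\<omega>. 0) \<in> joint_span I"
  unfolding joint_span_def mem_Collect_eq
  by (intro conjI exI[of _ "\<lambda>_ _. 0"] allI noise_span_zero) simp_all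

lemma joint_span_sum:
  assumes "\<And>s. s \<in> S \<Longrightarrow> X s \<in> joint_span I"
  shows "(\<lambda>\<omega>. \<Sum>s\<in>S. X s \<omega>) \<in> joint_span I"
  using assms by (induction S rule: infinite_finite_induct) (auto intro: joint_span_zero joint_span_add)

lemma joint_span_mono: "I \<subseteq> J \<Longrightarrow> joint_span I \<subseteq> joint_span J"
  using noise_span_mono unfolding joint_span_def by blast

lemma joint_span_centered_normal:
  assumes "X \<in> joint_span I" shows "centered_normal M X"
proof -
  obtain S where S: "X \<in> borel_measurable M" "\<And>n. S n \<in> noise_span I" "AE \<omega> in M. (\<lambda>n. S n \<omega>) \<longlonglongrightarrow> X \<omega>"
    using assms by (auto simp: joint_span_def)
  show ?thesis by (rule centered_normal_limit(1)[OF noise_span_centered_normal[OF S(2)] S(1,3)])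
qed

lemma joint_span_gaussian_family:
  assumes "\<And>t. t < n \<Longrightarrow> W t \<in> joint_span I"
  shows "gaussian_family M n W"
  unfolding gaussian_family_def using assms
  by (intro allI joint_span_centered_normal[of _ I] joint_span_sum joint_span_scale) auto

lemma joint_span_integrable_mult:
  "X \<in> joint_span I \<Longrightarrow> Y \<in> joint_span J \<Longrightarrow> integrable M (\<lambda>\<omega>. X \<omega> * Y \<omega>)"
  by (intro centered_normal_integrable_mult joint_span_centered_normal)

lemma noise_uncorrelated:
  assumes "t \<noteq> \<tau>" "j < k" "l < k"
  shows "expectation (\<lambda>\<omega>. \<epsilon> t j \<omega> * \<epsilon> \<tau> l \<omega>) = 0"
proof -
  have "indep_vars (\<lambda>_. borel) (\<lambda>s \<omega>. (\<lambda>f. if s = t then f j else f l) (\<lambda>j\<in>{..<k}. \<epsilon> s j \<omega>)) {t, \<tau>}"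
    by (rule indep_vars_compose2[OF indep_vars_subset[OF noise_indep subset_UNIV]])
      (use assms in \<open>auto intro!: measurable_component_singleton\<close>)
  hence i: "indep_vars (\<lambda>_. borel) (\<lambda>s \<omega>. if s = t then \<epsilon> s j \<omega> else \<epsilon> s l \<omega>) {t, \<tau>}"
    using assms by (simp cong: if_cong)
  have I: "integrable M (\<epsilon> s u)" if "u < k" for s u
    using centered_normal_integrable_mult[of "\<epsilon> s u" "\<epsilon> s u"] noise_centered_normal[OF that, of s]
    by (intro square_integrable_imp_integrable[of "\<epsilon> s u"])
      (auto simp: power2_eq_square dest: centered_normal_measurable)
  have "expectation (\<lambda>\<omega>. \<Prod>s\<in>{t, \<tau>}. if s = t then \<epsilon> s j \<omega> else \<epsilon> s l \<omega>) =
      (\<Prod>s\<in>{t, \<tau>}. expectation (\<lambda>\<omega>. if s = t then \<epsilon> s j \<omega> else \<epsilon> s l \<omega>))"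
    by (rule indep_vars_lebesgue_integral[OF _ i]) (use I assms in auto)
  thus ?thesis using assms centered_normal_expectation_eq_0[OF noise_centered_normal] by simp
qed

text \<open>Orthogonality to a combination of earlier noise is independence. It survives the almost sure limit
because the expectation of a product is determined by the second moments of $\epsilon + S$ and $S$,
which converge by \<open>centered_normal_limit\<close>.\<close>

lemma noise_orthogonal_past:
  assumes X: "X \<in> joint_span {..<t}" and j: "j < k"
  shows "expectation (\<lambda>\<omega>. \<epsilon> t j \<omega> * X \<omega>) = 0"
proof -
  obtain S where S: "X \<in> borel_measurable M" "\<And>n. S n \<in> noise_span {..<t}" "AE \<omega> in M. (\<lambda>n. S n \<omega>) \<longlonglongrightarrow> X \<omega>"
    using X by (auto simp: joint_span_def)
  have zero: "expectation (\<lambda>\<omega>. \<epsilon> t j \<omega> * S n \<omega>) = 0" for n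
  proof -
    obtain A c where A: "finite A" "A \<subseteq> {..<t}" "S n = (\<lambda>\<omega>. \<Sum>\<tau>\<in>A. \<Sum>l<k. c \<tau> l * \<epsilon> \<tau> l \<omega>)"
      using S(2)[of n] by (auto simp: noise_span_def)
    have i: "integrable M (\<lambda>\<omega>. c \<tau> l * (\<epsilon> t j \<omega> * \<epsilon> \<tau> l \<omega>))" if "l < k" for \<tau> l
      by (intro integrable_mult_right centered_normal_integrable_mult noise_centered_normal j that)
    have "expectation (\<lambda>\<omega>. \<epsilon> t j \<omega> * S n \<omega>) = expectation (\<lambda>\<omega>. \<Sum>\<tau>\<in>A. \<Sum>l<k. c \<tau> l * (\<epsilon> t j \<omega> * \<epsilon> \<tau> l \<omega>))"
      by (simp add: A(3) sum_distrib_left mult_ac)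
    also have "\<dots> = (\<Sum>\<tau>\<in>A. expectation (\<lambda>\<omega>. \<Sum>l<k. c \<tau> l * (\<epsilon> t j \<omega> * \<epsilon> \<tau> l \<omega>)))"
      using i by (intro Bochner_Integration.integral_sum Bochner_Integration.integrable_sum) auto
    also have "\<dots> = (\<Sum>\<tau>\<in>A. \<Sum>l<k. expectation (\<lambda>\<omega>. c \<tau> l * (\<epsilon> t j \<omega> * \<epsilon> \<tau> l \<omega>)))"
      using i by (intro sum.cong refl Bochner_Integration.integral_sum) auto
    also have "\<dots> = 0"
    proof (intro sum.neutral ballI)
      fix \<tau> l assume "\<tau> \<in> A" "l \<in> {..<k}"
      hence "expectation (\<lambda>\<omega>. \<epsilon> t j \<omega> * \<epsilon> \<tau> l \<omega>) = 0" using A(2) j by (intro noise_uncorrelated) auto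
      thus "expectation (\<lambda>\<omega>. c \<tau> l * (\<epsilon> t j \<omega> * \<epsilon> \<tau> l \<omega>)) = 0" by simp
    qed
    finally show ?thesis .
  qed
  have expand: "expectation (\<lambda>\<omega>. (\<epsilon> t j \<omega> + Y \<omega>)\<^sup>2) = second_moment (\<epsilon> t j) +
      2 * expectation (\<lambda>\<omega>. \<epsilon> t j \<omega> * Y \<omega>) + second_moment Y" if Y: "centered_normal M Y" for Y
  proof -
    note i = centered_normal_integrable_square[OF noise_centered_normal[OF j, of t]]
      centered_normal_integrable_square[OF Y] centered_normal_integrable_mult[OF noise_centered_normal[OF j, of t] Y]
    have "(\<epsilon> t j \<omega> + Y \<omega>)\<^sup>2 = (\<epsilon> t j \<omega>)\<^sup>2 + 2 * (\<epsilon> t j \<omega> * Y \<omega>) + (Y \<omega>)\<^sup>2" for \<omega>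
      by (simp add: power2_sum)
    thus ?thesis using i by simp
  qed
  have sn: "(\<lambda>\<omega>. \<epsilon> t j \<omega> + S n \<omega>) \<in> noise_span UNIV" for n
    using S(2)[of n] noise_span_mono[of "{..<t}" UNIV] noise_span_noise[of t UNIV j] j
    by (intro noise_span_add) auto
  have lim: "AE \<omega> in M. (\<lambda>n. \<epsilon> t j \<omega> + S n \<omega>) \<longlonglongrightarrow> \<epsilon> t j \<omega> + X \<omega>"
    using S(3) by eventually_elim (intro tendsto_intros)
  have "(\<lambda>n. expectation (\<lambda>\<omega>. (\<epsilon> t j \<omega> + S n \<omega>)\<^sup>2)) \<longlonglongrightarrow> expectation (\<lambda>\<omega>. (\<epsilon> t j \<omega> + X \<omega>)\<^sup>2)"
    by (rule centered_normal_limit(2)[OF noise_span_centered_normal[OF sn] _ lim])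
      (use S(1) noise_measurable[OF j] in simp)
  moreover have "(\<lambda>n. expectation (\<lambda>\<omega>. (\<epsilon> t j \<omega> + S n \<omega>)\<^sup>2)) \<longlonglongrightarrow>
      second_moment (\<epsilon> t j) + second_moment X"
  proof -
    have "(\<lambda>n. second_moment (S n)) \<longlonglongrightarrow> second_moment X"
      by (rule centered_normal_limit(2)[OF noise_span_centered_normal[OF S(2)] S(1,3)])
    thus ?thesis
      by (simp only: expand[OF noise_span_centered_normal[OF S(2)]] zero) (auto intro!: tendsto_intros)
  qed
  ultimately have "expectation (\<lambda>\<omega>. (\<epsilon> t j \<omega> + X \<omega>)\<^sup>2) =
      second_moment (\<epsilon> t j) + second_moment X"
    by (rule LIMSEQ_unique)
  thus ?thesis using expand[OF joint_span_centered_normal[OF X]] by simp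
qed

end

section \<open>Autocovariances of the regressors\<close>

context stationary_gaussian_var
begin

abbreviation regressor :: "int \<Rightarrow> nat \<Rightarrow> 'a \<Rightarrow> real" where
  "regressor t j \<equiv> (\<lambda>\<omega>. lag_vec k p y t \<omega> $ j)"

abbreviation "F \<equiv> companion_mat k p \<Phi>"
abbreviation "\<Gamma> \<equiv> lag_cov_mat M k p y"

lemma regressor_eq: "j < k * p \<Longrightarrow> regressor t j = y (t - int (j div k + 1)) (j mod k)"
  by (simp add: lag_vec_def)

lemma regressor_apply: "j < k * p \<Longrightarrow> lag_vec k p y t \<omega> $ j = y (t - int (j div k + 1)) (j mod k) \<omega>"
  by (simp add: lag_vec_def)

lemma regressor_joint_span:
  assumes "j < k * p" shows "regressor t j \<in> joint_span {..<t}"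
  unfolding regressor_eq[OF assms] using k_pos by (intro joint_span_observed) auto

text \<open>Lag and variable combined into a single index, as in \<^const>\<open>lag_vec\<close>.\<close>

lemma sum_lags_variables:
  "(\<Sum>l=1..p. \<Sum>j<k. f l j) = (\<Sum>c<k * p. f (c div k + 1) (c mod k))"
proof -
  have "(\<Sum>c<k * p. f (c div k + 1) (c mod k)) = (\<Sum>m<p. \<Sum>c\<in>{m * k..<m * k + k}. f (c div k + 1) (c mod k))"
    by (subst sum.nat_group) (simp add: mult.commute)
  also have "\<dots> = (\<Sum>m<p. \<Sum>j<k. f (m + 1) j)"
  proof (rule sum.cong[OF refl])
    fix m
    have "(\<Sum>c\<in>{m * k..<m * k + k}. f (c div k + 1) (c mod k)) = (\<Sum>j\<in>{0..<k}. f ((j + m * k) div k + 1) ((j + m * k) mod k))"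
      using sum.shift_bounds_nat_ivl[of "\<lambda>c. f (c div k + 1) (c mod k)" 0 "m * k" k] by (simp add: add.commute)
    also have "\<dots> = (\<Sum>j<k. f (m + 1) j)"
      using k_pos by (intro sum.cong) auto
    finally show "(\<Sum>c\<in>{m * k..<m * k + k}. f (c div k + 1) (c mod k)) = (\<Sum>j<k. f (m + 1) j)" .
  qed
  also have "\<dots> = (\<Sum>l=1..p. \<Sum>j<k. f l j)"
    by (rule sum.reindex_bij_witness[of _ "\<lambda>l. l - 1" "\<lambda>m. m + 1"]) auto
  finally show ?thesis by simp
qed

lemma observation_equation:
  assumes "i < k"
  shows "AE \<omega> in M. y t i \<omega> = (\<Sum>c<k * p. true_param k p \<Phi> i $ c * regressor t c \<omega>) + \<epsilon> t i \<omega>"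
  using var_equation[OF assms, of t]
proof eventually_elim
  case (elim \<omega>)
  thus ?case unfolding sum_lags_variables by (simp add: true_param_def lag_vec_def)
qed

text \<open>$Z_{t+1} = F Z_t + E_t$: the first \<open>k\<close> coordinates are the model equation, the others shift the lags.\<close>

lemma state_equation:
  assumes r: "r < k * p"
  shows "AE \<omega> in M. regressor (t + 1) r \<omega> =
    (\<Sum>c<k * p. F $$ (r, c) * regressor t c \<omega>) + (if r < k then \<epsilon> t r \<omega> else 0)"
proof (cases "r < k")
  case True
  have "regressor (t + 1) r \<omega> = y t r \<omega>" for \<omega> using regressor_apply[OF r] True by simp
  thus ?thesis using observation_equation[OF True, of t] True r
    by (simp add: companion_mat_def true_param_def)
next
  case False
  have "regressor (t + 1) r \<omega> = (\<Sum>c<k * p. F $$ (r, c) * regressor t c \<omega>)" for \<omega>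
  proof -
    have rk: "r - k < k * p" using r by simp
    have "(\<Sum>c<k * p. F $$ (r, c) * regressor t c \<omega>) = (\<Sum>c<k * p. (if c = r - k then regressor t c \<omega> else 0))"
      using False r by (intro sum.cong) (auto simp: companion_mat_def)
    also have "\<dots> = regressor t (r - k) \<omega>" using rk by simp
    also have "\<dots> = regressor (t + 1) r \<omega>"
    proof -
      have d: "r div k = (r - k) div k + 1" using False k_pos by (simp add: le_div_geq)
      have "r mod k = (r - k) mod k" using False by (simp add: le_mod_geq)
      have "t + 1 - int (r div k + 1) = t - int ((r - k) div k + 1)" unfolding d by simp
      with \<open>r mod k = (r - k) mod k\<close> show ?thesis unfolding regressor_apply[OF r] regressor_apply[OF rk] by metis
    qed
    finally show ?thesis by simp
  qed
  thus ?thesis using False by simp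
qed

definition cross_moment :: "int \<Rightarrow> ('a \<Rightarrow> real) \<Rightarrow> real vec" where
  "cross_moment t V = vec (k * p) (\<lambda>r. expectation (\<lambda>\<omega>. regressor t r \<omega> * V \<omega>))"

lemma cross_moment_step:
  assumes V: "V \<in> joint_span {..<t}"
  shows "cross_moment (t + 1) V = F *\<^sub>v cross_moment t V"
proof (rule eq_vecI)
  show "dim_vec (cross_moment (t + 1) V) = dim_vec (F *\<^sub>v cross_moment t V)"
    by (simp add: cross_moment_def companion_mat_def)
  fix r assume "r < dim_vec (F *\<^sub>v cross_moment t V)"
  hence r: "r < k * p" by (simp add: companion_mat_def)
  have i: "integrable M (\<lambda>\<omega>. F $$ (r, c) * (regressor t c \<omega> * V \<omega>))" if "c < k * p" for c
    by (intro integrable_mult_right joint_span_integrable_mult[OF regressor_joint_span V] that)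
  have i': "integrable M (\<lambda>\<omega>. (if r < k then \<epsilon> t r \<omega> else 0) * V \<omega>)"
    using joint_span_integrable_mult[OF joint_span_noise[of t UNIV r] V] by (cases "r < k") simp_all
  have "expectation (\<lambda>\<omega>. regressor (t + 1) r \<omega> * V \<omega>) =
      expectation (\<lambda>\<omega>. (\<Sum>c<k * p. F $$ (r, c) * (regressor t c \<omega> * V \<omega>)) + (if r < k then \<epsilon> t r \<omega> else 0) * V \<omega>)"
  proof (rule integral_cong_AE)
    show "(\<lambda>\<omega>. regressor (t + 1) r \<omega> * V \<omega>) \<in> borel_measurable M"
      by (intro borel_measurable_integrable joint_span_integrable_mult[OF regressor_joint_span V] r)
    show "(\<lambda>\<omega>. (\<Sum>c<k * p. F $$ (r, c) * (regressor t c \<omega> * V \<omega>)) + (if r < k then \<epsilon> t r \<omega> else 0) * V \<omega>) \<in> borel_measurable M"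
      using i i' by (intro borel_measurable_integrable Bochner_Integration.integrable_add Bochner_Integration.integrable_sum) auto
    show "AE \<omega> in M. regressor (t + 1) r \<omega> * V \<omega> =
        (\<Sum>c<k * p. F $$ (r, c) * (regressor t c \<omega> * V \<omega>)) + (if r < k then \<epsilon> t r \<omega> else 0) * V \<omega>"
      using state_equation[OF r, of t]
    proof eventually_elim
      case (elim \<omega>)
      show ?case unfolding elim by (simp add: distrib_right sum_distrib_right mult.assoc)
    qed
  qed
  also have "\<dots> = (\<Sum>c<k * p. F $$ (r, c) * expectation (\<lambda>\<omega>. regressor t c \<omega> * V \<omega>)) +
      expectation (\<lambda>\<omega>. (if r < k then \<epsilon> t r \<omega> else 0) * V \<omega>)"
  proof -
    have "expectation (\<lambda>\<omega>. \<Sum>c<k * p. F $$ (r, c) * (regressor t c \<omega> * V \<omega>)) =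
        (\<Sum>c<k * p. expectation (\<lambda>\<omega>. F $$ (r, c) * (regressor t c \<omega> * V \<omega>)))"
      using i by (intro Bochner_Integration.integral_sum) auto
    thus ?thesis using i i' by (subst Bochner_Integration.integral_add) (auto intro!: Bochner_Integration.integrable_sum)
  qed
  also have "expectation (\<lambda>\<omega>. (if r < k then \<epsilon> t r \<omega> else 0) * V \<omega>) = 0"
    using noise_orthogonal_past[OF V, of r] by (cases "r < k") simp_all
  finally show "cross_moment (t + 1) V $ r = (F *\<^sub>v cross_moment t V) $ r"
    using r by (simp add: cross_moment_def companion_mat_def scalar_prod_def atLeast0LessThan)
qed

lemma companion_carrier: "F \<in> carrier_mat (k * p) (k * p)"
  by (simp add: companion_mat_def)

text \<open>The noise that enters after time \<open>t\<close> is orthogonal to \<open>V\<close>, so each time step multiplies by \<open>F\<close>.\<close>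

lemma cross_moment_power:
  assumes "V \<in> joint_span {..<t}"
  shows "cross_moment (t + int h) V = F ^\<^sub>m h *\<^sub>v cross_moment t V"
  using assms
proof (induction h arbitrary: t)
  case 0
  have "cross_moment t V \<in> carrier_vec (k * p)" by (simp add: cross_moment_def)
  thus ?case using companion_carrier by simp
next
  case (Suc h)
  have "V \<in> joint_span {..<t + 1}" using Suc.prems joint_span_mono[of "{..<t}" "{..<t + 1}"] by auto
  from Suc.IH[OF this] have "cross_moment (t + int (Suc h)) V = F ^\<^sub>m h *\<^sub>v cross_moment (t + 1) V"
    by (simp add: add.assoc)
  also have "\<dots> = F ^\<^sub>m h *\<^sub>v (F *\<^sub>v cross_moment t V)" by (simp only: cross_moment_step[OF Suc.prems])
  also have "\<dots> = (F ^\<^sub>m h * F) *\<^sub>v cross_moment t V"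
    using companion_carrier pow_carrier_mat[OF companion_carrier, of h]
    by (intro assoc_mult_mat_vec[symmetric]) (auto simp: cross_moment_def)
  finally show ?case by simp
qed

lemma second_moment_stationary:
  assumes "i < k" "j < k"
  shows "expectation (\<lambda>\<omega>. y (s + h) i \<omega> * y (t + h) j \<omega>) = expectation (\<lambda>\<omega>. y s i \<omega> * y t j \<omega>)"
proof -
  define I where "I = {(s, i), (t, j)}"
  have I: "finite I" "I \<subseteq> UNIV \<times> {..<k}" using assms by (auto simp: I_def)
  have m: "(\<lambda>\<omega>. \<lambda>(t, i)\<in>I. y (t + h) i \<omega>) \<in> measurable M (PiM I (\<lambda>_. borel))" for h
    using y_measurable assms by (intro measurable_restrict) (auto simp: I_def)
  have f: "(\<lambda>f. f (s, i) * f (t, j)) \<in> borel_measurable (PiM I (\<lambda>_. borel :: real measure))"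
    by (intro borel_measurable_times measurable_component_singleton) (auto simp: I_def)
  have "expectation (\<lambda>\<omega>. y (s + h) i \<omega> * y (t + h) j \<omega>) =
      (LINT f|distr M (PiM I (\<lambda>_. borel)) (\<lambda>\<omega>. \<lambda>(t, i)\<in>I. y (t + h) i \<omega>). f (s, i) * f (t, j))" for h
    by (subst integral_distr[OF m f]) (simp add: I_def)
  from this[of h] this[of 0] stationary[OF I, of h] show ?thesis by simp
qed

lemma regressor_second_moment:
  assumes "r < k * p" "c < k * p"
  shows "expectation (\<lambda>\<omega>. regressor t r \<omega> * regressor t c \<omega>) = \<Gamma> $$ (r, c)"
proof -
  have "r mod k < k" "c mod k < k" using k_pos by auto
  from second_moment_stationary[OF this, of "1 - int (r div k + 1)" "t - 1" "1 - int (c div k + 1)"]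
  show ?thesis using assms by (simp add: lag_cov_mat_def regressor_apply diff_diff_eq[symmetric])
qed

text \<open>The covariances of $Z_{t+h}$ with $Z_{t,j}$ form the vector $F^h \Gamma e_j$.\<close>

lemma regressor_autocovariance_bound:
  assumes j: "j < k * p"
  shows "\<bar>expectation (\<lambda>\<omega>. regressor (t + int h) j \<omega> * regressor t j \<omega>)\<bar> \<le> spectral_norm \<Gamma> * spectral_norm (F ^\<^sub>m h)"
proof -
  define e :: "real vec" where "e = vec (k * p) (\<lambda>l. if l = j then 1 else 0)"
  have e: "e \<in> carrier_vec (dim_col \<Gamma>)" by (simp add: e_def lag_cov_mat_def)
  have ne: "l2_norm e = 1"
    using j by (simp add: l2_norm_def L2_set_def e_def if_distrib[of "\<lambda>x. x\<^sup>2"] cong: if_cong)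
  have "cross_moment t (regressor t j) = \<Gamma> *\<^sub>v e"
  proof (rule eq_vecI)
    show "dim_vec (cross_moment t (regressor t j)) = dim_vec (\<Gamma> *\<^sub>v e)"
      by (simp add: cross_moment_def lag_cov_mat_def)
    fix r assume "r < dim_vec (\<Gamma> *\<^sub>v e)"
    hence r: "r < k * p" by (simp add: lag_cov_mat_def)
    have "(\<Gamma> *\<^sub>v e) $ r = (\<Sum>c<k * p. \<Gamma> $$ (r, c) * (if c = j then 1 else 0))"
      using r by (simp add: e_def lag_cov_mat_def scalar_prod_def atLeast0LessThan)
    also have "\<dots> = \<Gamma> $$ (r, j)" using j by (simp add: if_distrib[of "\<lambda>x. _ * x"] cong: if_cong)
    finally show "cross_moment t (regressor t j) $ r = (\<Gamma> *\<^sub>v e) $ r"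
      using r j by (simp add: cross_moment_def regressor_second_moment)
  qed
  hence m0: "l2_norm (cross_moment t (regressor t j)) \<le> spectral_norm \<Gamma>"
    using l2_norm_mult_mat_vec_le[OF e] ne by simp
  have m: "cross_moment (t + int h) (regressor t j) = F ^\<^sub>m h *\<^sub>v cross_moment t (regressor t j)"
    by (rule cross_moment_power[OF regressor_joint_span[OF j]])
  have "\<bar>expectation (\<lambda>\<omega>. regressor (t + int h) j \<omega> * regressor t j \<omega>)\<bar> = \<bar>cross_moment (t + int h) (regressor t j) $ j\<bar>"
    using j by (simp add: cross_moment_def)
  also have "\<dots> \<le> l2_norm (cross_moment (t + int h) (regressor t j))"
    using j by (intro abs_component_le_l2_norm) (simp add: cross_moment_def)
  also have "\<dots> \<le> spectral_norm (F ^\<^sub>m h) * l2_norm (cross_moment t (regressor t j))"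
    unfolding m using pow_carrier_mat[OF companion_carrier, of h]
    by (intro l2_norm_mult_mat_vec_le) (auto simp: cross_moment_def)
  also have "\<dots> \<le> spectral_norm (F ^\<^sub>m h) * spectral_norm \<Gamma>"
    using m0 by (intro mult_left_mono spectral_norm_nonneg)
  finally show ?thesis by (simp add: mult.commute)
qed

text \<open>Where the dependence hypothesis enters: the sum of $\|\Gamma\| \|F^h\|$ over the lags bounds the row sums
of the covariance matrix of the path of one regressor.\<close>

lemma regressor_path_variance_bound:
  assumes j: "j < k * p"
    and K: "2 * (spectral_norm \<Gamma> * (\<Sum>h=0..T. spectral_norm (F ^\<^sub>m h))) \<le> K"
  shows "second_moment (\<lambda>\<omega>. \<Sum>r<T. u r * regressor (int T - int r) j \<omega>) \<le> K * (\<Sum>r<T. (u r)\<^sup>2)"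
proof -
  let ?W = "\<lambda>r. regressor (int T - int r) j"
  have fam: "gaussian_family M T ?W"
    using regressor_joint_span[OF j] joint_span_mono[of _ UNIV]
    by (intro joint_span_gaussian_family[of _ _ UNIV]) auto
  have "quad_form T (cov_form ?W) u \<le> 2 * (\<Sum>h=0..T. spectral_norm \<Gamma> * spectral_norm (F ^\<^sub>m h)) * (\<Sum>t<T. (u t)\<^sup>2)"
  proof (rule quad_form_lag_bound)
    show "0 \<le> spectral_norm \<Gamma> * spectral_norm (F ^\<^sub>m h)" for h by (simp add: spectral_norm_nonneg)
    fix s t :: nat assume st: "s < T" "t < T" "s \<le> t"
    have "cov_form ?W s t = expectation (\<lambda>\<omega>. regressor ((int T - int t) + int (t - s)) j \<omega> * regressor (int T - int t) j \<omega>)"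
      using st by (simp add: cov_form_def)
    moreover have "cov_form ?W t s = cov_form ?W s t" by (simp add: cov_form_def mult.commute)
    ultimately show "\<bar>cov_form ?W s t\<bar> \<le> spectral_norm \<Gamma> * spectral_norm (F ^\<^sub>m (t - s)) \<and>
        \<bar>cov_form ?W t s\<bar> \<le> spectral_norm \<Gamma> * spectral_norm (F ^\<^sub>m (t - s))"
      using regressor_autocovariance_bound[OF j] by simp
  qed
  also have "\<dots> \<le> K * (\<Sum>t<T. (u t)\<^sup>2)"
    using K by (intro mult_right_mono sum_nonneg) (simp_all add: sum_distrib_left)
  finally show ?thesis unfolding expectation_lin_comb_square[OF fam] .
qed

lemma noise_path_variance_bound:
  assumes i: "i < k" and K: "second_moment (\<epsilon> 1 i) \<le> K"
  shows "second_moment (\<lambda>\<omega>. \<Sum>r<T. u r * \<epsilon> (int T - int r) i \<omega>) \<le> K * (\<Sum>r<T. (u r)\<^sup>2)"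
proof -
  let ?W = "\<lambda>r. \<epsilon> (int T - int r) i"
  have fam: "gaussian_family M T ?W"
    using i by (intro joint_span_gaussian_family[of _ _ UNIV] joint_span_noise) auto
  have c: "cov_form ?W s t = (if s = t then second_moment (\<epsilon> 1 i) else 0)" for s t
    using noise_uncorrelated[OF _ i i, of "int T - int s" "int T - int t"]
      noise_second_moment_time_invariant[OF i, of "int T - int s" 1]
    by (auto simp: cov_form_def power2_eq_square)
  have "quad_form T (cov_form ?W) u = (\<Sum>s<T. second_moment (\<epsilon> 1 i) * (u s)\<^sup>2)"
    unfolding quad_form_def c
    by (intro sum.cong refl) (simp add: if_distrib[of "\<lambda>x. x * _"] power2_eq_square mult.assoc cong: if_cong)
  also have "\<dots> \<le> (\<Sum>s<T. K * (u s)\<^sup>2)" using K by (intro sum_mono mult_right_mono) auto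
  finally show ?thesis unfolding expectation_lin_comb_square[OF fam] by (simp add: sum_distrib_left)
qed

end

section \<open>The restricted eigenvalue and the standard deviations\<close>

context stationary_gaussian_var
begin

lemma lag_cov_quad_form:
  "quad_form (k * p) (\<lambda>j l. \<Gamma> $$ (j, l)) \<delta> = expectation (\<lambda>\<omega>. (\<Sum>j<k * p. \<delta> j * regressor 1 j \<omega>)\<^sup>2)"
proof -
  have fam: "gaussian_family M (k * p) (regressor 1)"
    using regressor_joint_span by (intro joint_span_gaussian_family)
  show ?thesis unfolding expectation_lin_comb_square[OF fam] quad_form_def
    by (intro sum.cong refl) (simp add: cov_form_def regressor_second_moment)
qed

text \<open>A lower bound for the infimum applies to each quotient only if the quotients are bounded below; they
are, because $\Gamma$ is positive semidefinite.\<close>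

lemma restricted_eigenvalue_lag_cov:
  assumes re: "c \<le> restricted_eigenvalue_sq \<Gamma> r"
    and R: "R \<subseteq> {..<k * p}" "card R \<le> r"
    and cone: "(\<Sum>j\<in>{..<k * p} - R. \<bar>\<delta> j\<bar>) \<le> 3 * (\<Sum>j\<in>R. \<bar>\<delta> j\<bar>)"
  shows "c * (\<Sum>j\<in>R. (\<delta> j)\<^sup>2) \<le> quad_form (k * p) (\<lambda>j l. \<Gamma> $$ (j, l)) \<delta>"
proof -
  have psd: "0 \<le> quad_form (k * p) (\<lambda>j l. \<Gamma> $$ (j, l)) \<delta>" for \<delta>
    unfolding lag_cov_quad_form by simp
  have dim: "dim_row \<Gamma> = k * p" "dim_col \<Gamma> = k * p" by (simp_all add: lag_cov_mat_def)
  have q: "v \<bullet> (\<Gamma> *\<^sub>v v) = quad_form (k * p) (\<lambda>j l. \<Gamma> $$ (j, l)) (\<lambda>j. v $ j)" if "v \<in> carrier_vec (k * p)" for v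
    using that dim by (auto simp: quad_form_def scalar_prod_def atLeast0LessThan sum_distrib_left mult_ac intro!: sum.cong)
  have L2: "(L2_set f A)\<^sup>2 = (\<Sum>j\<in>A. (f j)\<^sup>2)" for f :: "nat \<Rightarrow> real" and A
    by (simp add: L2_set_def sum_nonneg)
  show ?thesis
  proof (cases "(\<Sum>j\<in>R. (\<delta> j)\<^sup>2) = 0")
    case True
    thus ?thesis using psd by simp
  next
    case False
    hence pos: "0 < (\<Sum>j\<in>R. (\<delta> j)\<^sup>2)" by (simp add: sum_nonneg less_le)
    define v where "v = vec (k * p) \<delta>"
    have v: "v \<in> carrier_vec (k * p)" "\<And>j. j < k * p \<Longrightarrow> v $ j = \<delta> j" by (simp_all add: v_def)
    have vR: "v $ j = \<delta> j" if "j \<in> R" for j using v that R by auto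
    have v0: "v \<noteq> 0\<^sub>v (k * p)"
    proof
      assume "v = 0\<^sub>v (k * p)"
      hence "\<delta> j = 0" if "j \<in> R" for j using vR[OF that] that R by auto
      thus False using False by simp
    qed
    define S where "S = {\<delta> \<bullet> (\<Gamma> *\<^sub>v \<delta>) / (L2_set (\<lambda>j. \<delta> $ j) R)\<^sup>2 | R \<delta>.
        R \<subseteq> {..<dim_row \<Gamma>} \<and> card R \<le> r \<and>
        \<delta> \<in> carrier_vec (dim_row \<Gamma>) \<and> \<delta> \<noteq> 0\<^sub>v (dim_row \<Gamma>) \<and>
        (\<Sum>j\<in>{..<dim_row \<Gamma>} - R. \<bar>\<delta> $ j\<bar>) \<le> 3 * (\<Sum>j\<in>R. \<bar>\<delta> $ j\<bar>)}"
    have "v \<bullet> (\<Gamma> *\<^sub>v v) / (L2_set (\<lambda>j. v $ j) R)\<^sup>2 \<in> S"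
      unfolding S_def mem_Collect_eq dim
    proof (intro exI[of _ R] exI[of _ v] conjI refl R v v0)
      have "(\<Sum>j\<in>{..<k * p} - R. \<bar>v $ j\<bar>) = (\<Sum>j\<in>{..<k * p} - R. \<bar>\<delta> j\<bar>)" by (intro sum.cong) (auto simp: v)
      moreover have "(\<Sum>j\<in>R. \<bar>v $ j\<bar>) = (\<Sum>j\<in>R. \<bar>\<delta> j\<bar>)" by (intro sum.cong) (auto simp: vR)
      ultimately show "(\<Sum>j\<in>{..<k * p} - R. \<bar>v $ j\<bar>) \<le> 3 * (\<Sum>j\<in>R. \<bar>v $ j\<bar>)" using cone by simp
    qed
    moreover have "bdd_below S"
      unfolding S_def dim by (rule bdd_belowI[of _ 0]) (auto simp: q psd)
    ultimately have "Inf S \<le> v \<bullet> (\<Gamma> *\<^sub>v v) / (L2_set (\<lambda>j. v $ j) R)\<^sup>2" by (rule cInf_lower)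
    moreover have "c \<le> Inf S" using re unfolding restricted_eigenvalue_sq_def S_def .
    moreover have "v \<bullet> (\<Gamma> *\<^sub>v v) = quad_form (k * p) (\<lambda>j l. \<Gamma> $$ (j, l)) \<delta>"
      unfolding q[OF v(1)] by (rule quad_form_cong) (rule v(2))
    moreover have "(L2_set (\<lambda>j. v $ j) R)\<^sup>2 = (\<Sum>j\<in>R. (\<delta> j)\<^sup>2)"
      unfolding L2 by (intro sum.cong) (auto simp: vR)
    ultimately have "c \<le> quad_form (k * p) (\<lambda>j l. \<Gamma> $$ (j, l)) \<delta> / (\<Sum>j\<in>R. (\<delta> j)\<^sup>2)" by simp
    thus ?thesis using pos by (simp add: field_simps)
  qed
qed

lemma second_moment_le_max_sd:
  assumes "i < k"
  shows "second_moment (y 1 i) \<le> (max_sd M k y \<epsilon>)\<^sup>2"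
    and "second_moment (\<epsilon> 1 i) \<le> (max_sd M k y \<epsilon>)\<^sup>2"
proof -
  have cn: "centered_normal M (y 1 i)" "centered_normal M (\<epsilon> 1 i)"
    using assms joint_span_observed[of 1 UNIV i] by (auto intro: joint_span_centered_normal noise_centered_normal)
  have "max (sqrt (variance (y 1 i))) (sqrt (variance (\<epsilon> 1 i))) \<le> max_sd M k y \<epsilon>"
    unfolding max_sd_def using assms by (intro Max_ge) auto
  hence "sqrt (second_moment (y 1 i)) \<le> max_sd M k y \<epsilon>"
    "sqrt (second_moment (\<epsilon> 1 i)) \<le> max_sd M k y \<epsilon>"
    using cn[THEN centered_normal_expectation_eq_0] by simp_all
  thus "second_moment (y 1 i) \<le> (max_sd M k y \<epsilon>)\<^sup>2"
    "second_moment (\<epsilon> 1 i) \<le> (max_sd M k y \<epsilon>)\<^sup>2"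
    by (auto intro: sqrt_le_D)
qed

text \<open>The unit vector of the first coordinate lies in the cone. So the restricted eigenvalue bounds the
standard deviations from below, which the penalty needs in order to dominate the noise.\<close>

lemma restricted_eigenvalue_le_variance:
  assumes "c \<le> restricted_eigenvalue_sq \<Gamma> r" "1 \<le> r"
  shows "c \<le> \<Gamma> $$ (0, 0)" "\<Gamma> $$ (0, 0) \<le> (max_sd M k y \<epsilon>)\<^sup>2"
proof -
  have kp: "0 < k * p" using k_pos p_pos by simp
  define \<delta> :: "nat \<Rightarrow> real" where "\<delta> = (\<lambda>j. if j = 0 then 1 else 0)"
  have "c * (\<Sum>j\<in>{0}. (\<delta> j)\<^sup>2) \<le> quad_form (k * p) (\<lambda>j l. \<Gamma> $$ (j, l)) \<delta>"
    using assms kp by (intro restricted_eigenvalue_lag_cov) (auto simp: \<delta>_def)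
  also have "\<dots> = (\<Sum>i<k * p. if i = 0 then \<Gamma> $$ (0, 0) else 0)"
    unfolding quad_form_def \<delta>_def using kp
    by (intro sum.cong refl) (auto simp: if_distrib[of "\<lambda>x. _ * x"] cong: if_cong)
  also have "\<dots> = \<Gamma> $$ (0, 0)" using kp by simp
  finally show "c \<le> \<Gamma> $$ (0, 0)" by (simp add: \<delta>_def)
  have k0: "0 < k" using k_pos by simp
  have "\<Gamma> $$ (0, 0) = expectation (\<lambda>\<omega>. y 0 0 \<omega> * y 0 0 \<omega>)" using kp by (simp add: lag_cov_mat_def lag_vec_def)
  also have "\<dots> = second_moment (y 1 0)"
    using second_moment_stationary[OF k0 k0, of 0 1 0] by (simp add: power2_eq_square)
  finally show "\<Gamma> $$ (0, 0) \<le> (max_sd M k y \<epsilon>)\<^sup>2" using second_moment_le_max_sd(1)[OF k0] by simp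
qed

lemma max_sd_nonneg: "0 \<le> max_sd M k y \<epsilon>"
proof -
  have "0 \<le> max (sqrt (variance (y 1 0))) (sqrt (variance (\<epsilon> 1 0)))" by (simp add: le_max_iff_disj)
  also have "\<dots> \<le> max_sd M k y \<epsilon>" unfolding max_sd_def using k_pos by (intro Max_ge) auto
  finally show ?thesis .
qed

end

section \<open>The event on which the Lasso is accurate\<close>

context stationary_gaussian_var
begin

definition noise_correlation :: "nat \<Rightarrow> nat \<Rightarrow> nat \<Rightarrow> 'a \<Rightarrow> real" where
  "noise_correlation T i j \<omega> = (\<Sum>r<T. \<epsilon> (int T - int r) i \<omega> * regressor (int T - int r) j \<omega>) / real T"

definition gram :: "nat \<Rightarrow> nat \<Rightarrow> nat \<Rightarrow> 'a \<Rightarrow> real" where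
  "gram T j l \<omega> = (\<Sum>r<T. regressor (int T - int r) j \<omega> * regressor (int T - int r) l \<omega>) / real T"

text \<open>The two conditions under which the Lasso is accurate: $\mu$ limits the correlations of the regressors
with the noise, and $\eta$ the errors in the Gram matrix.\<close>

definition good_event :: "nat \<Rightarrow> nat \<Rightarrow> real \<Rightarrow> real \<Rightarrow> 'a set" where
  "good_event T i \<mu> \<eta> = {\<omega> \<in> space M. (\<forall>j\<in>{..<k * p}. \<bar>noise_correlation T i j \<omega>\<bar> \<le> \<mu>) \<and>
     (\<forall>j\<in>{..<k * p}. \<forall>l\<in>{..<k * p}. \<bar>gram T j l \<omega> - \<Gamma> $$ (j, l)\<bar> \<le> \<eta>)}"

lemma joint_span_gaussian_families:
  assumes "\<And>r. U r \<in> joint_span UNIV" "\<And>r. V r \<in> joint_span UNIV"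
  shows "gaussian_family M n U" "gaussian_family M n V"
    "gaussian_family M n (\<lambda>r \<omega>. U r \<omega> + V r \<omega>)" "gaussian_family M n (\<lambda>r \<omega>. U r \<omega> - V r \<omega>)"
proof -
  have "(\<lambda>\<omega>. U r \<omega> - V r \<omega>) \<in> joint_span UNIV" for r
    using joint_span_add[OF assms(1)[of r] joint_span_scale[OF assms(2)[of r], of "-1"]] by simp
  thus "gaussian_family M n U" "gaussian_family M n V"
    "gaussian_family M n (\<lambda>r \<omega>. U r \<omega> + V r \<omega>)" "gaussian_family M n (\<lambda>r \<omega>. U r \<omega> - V r \<omega>)"
    using assms by (auto intro!: joint_span_gaussian_family[of _ _ UNIV] joint_span_add)
qed

lemma regressor_span: "j < k * p \<Longrightarrow> regressor t j \<in> joint_span UNIV"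
  using regressor_joint_span[of j t] joint_span_mono[of "{..<t}" UNIV] by auto

context
  fixes T :: nat and K x :: real
  assumes T: "0 < T" and K: "0 < K"
    and dependence: "2 * (spectral_norm \<Gamma> * (\<Sum>h=0..T. spectral_norm (F ^\<^sub>m h))) \<le> K"
    and x: "0 \<le> x" "x \<le> 4 * K"
begin

lemma noise_correlation_tail:
  assumes i: "i < k" and j: "j < k * p" and noise: "second_moment (\<epsilon> 1 i) \<le> K"
  shows "prob {\<omega> \<in> space M. x < \<bar>noise_correlation T i j \<omega>\<bar>} \<le> deviation_bound K T x"
proof -
  let ?U = "\<lambda>r. \<epsilon> (int T - int r) i" and ?V = "\<lambda>r. regressor (int T - int r) j"
  have spans: "?U r \<in> joint_span UNIV" "?V r \<in> joint_span UNIV" for r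
    using joint_span_noise[of _ UNIV, OF _ i] regressor_span[OF j] by simp_all
  have "prob {\<omega> \<in> space M. x < \<bar>(\<Sum>r<T. ?U r \<omega> * ?V r \<omega>) / real T - 0\<bar>} \<le> deviation_bound K T x"
  proof (rule gaussian_product_mean_tail[OF joint_span_gaussian_families[of ?U ?V, OF spans] T K _ _ _ x])
    show "second_moment (\<lambda>\<omega>. \<Sum>r<T. u r * ?U r \<omega>) \<le> K * (\<Sum>r<T. (u r)\<^sup>2)" for u
      by (rule noise_path_variance_bound[OF i noise])
    show "second_moment (\<lambda>\<omega>. \<Sum>r<T. u r * ?V r \<omega>) \<le> K * (\<Sum>r<T. (u r)\<^sup>2)" for u
      by (rule regressor_path_variance_bound[OF j dependence])
    show "expectation (\<lambda>\<omega>. ?U r \<omega> * ?V r \<omega>) = 0" for r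
      by (rule noise_orthogonal_past[OF regressor_joint_span[OF j] i])
  qed
  thus ?thesis by (simp add: noise_correlation_def)
qed

lemma gram_tail:
  assumes j: "j < k * p" and l: "l < k * p"
  shows "prob {\<omega> \<in> space M. x < \<bar>gram T j l \<omega> - \<Gamma> $$ (j, l)\<bar>} \<le> deviation_bound K T x"
proof -
  let ?U = "\<lambda>r. regressor (int T - int r) j" and ?V = "\<lambda>r. regressor (int T - int r) l"
  have "prob {\<omega> \<in> space M. x < \<bar>(\<Sum>r<T. ?U r \<omega> * ?V r \<omega>) / real T - \<Gamma> $$ (j, l)\<bar>} \<le> deviation_bound K T x"
  proof (rule gaussian_product_mean_tail[OF joint_span_gaussian_families[of ?U ?V, OF regressor_span[OF j] regressor_span[OF l]]
        T K _ _ _ x])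
    show "second_moment (\<lambda>\<omega>. \<Sum>r<T. u r * ?U r \<omega>) \<le> K * (\<Sum>r<T. (u r)\<^sup>2)" for u
      by (rule regressor_path_variance_bound[OF j dependence])
    show "second_moment (\<lambda>\<omega>. \<Sum>r<T. u r * ?V r \<omega>) \<le> K * (\<Sum>r<T. (u r)\<^sup>2)" for u
      by (rule regressor_path_variance_bound[OF l dependence])
    show "expectation (\<lambda>\<omega>. ?U r \<omega> * ?V r \<omega>) = \<Gamma> $$ (j, l)" for r
      by (rule regressor_second_moment[OF j l])
  qed
  thus ?thesis by (simp add: gram_def)
qed

end

lemma regressor_measurable: "j < k * p \<Longrightarrow> regressor t j \<in> borel_measurable M"
  using regressor_span joint_span_measurable by blast

lemma noise_correlation_measurable:
  "i < k \<Longrightarrow> j < k * p \<Longrightarrow> noise_correlation T i j \<in> borel_measurable M"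
  unfolding noise_correlation_def using regressor_measurable noise_measurable
  by (intro borel_measurable_divide borel_measurable_sum borel_measurable_times borel_measurable_const) auto

lemma gram_measurable:
  "j < k * p \<Longrightarrow> l < k * p \<Longrightarrow> gram T j l \<in> borel_measurable M"
  unfolding gram_def using regressor_measurable
  by (intro borel_measurable_divide borel_measurable_sum borel_measurable_times borel_measurable_const) auto

lemma good_event_probability:
  assumes T: "0 < T" and K: "0 < K"
    and dependence: "2 * (spectral_norm \<Gamma> * (\<Sum>h=0..T. spectral_norm (F ^\<^sub>m h))) \<le> K"
    and i: "i < k" and noise: "second_moment (\<epsilon> 1 i) \<le> K"
    and \<mu>: "0 \<le> \<mu>" "\<mu> \<le> 4 * K" and \<eta>: "0 \<le> \<eta>" "\<eta> \<le> 4 * K"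
  shows "good_event T i \<mu> \<eta> \<in> sets M"
    and "prob (space M - good_event T i \<mu> \<eta>) \<le> real (k * p) * deviation_bound K T \<mu> +
      (real (k * p))\<^sup>2 * deviation_bound K T \<eta>"
proof -
  let ?N = "\<lambda>j. {\<omega> \<in> space M. \<mu> < \<bar>noise_correlation T i j \<omega>\<bar>}"
  let ?G = "\<lambda>z. {\<omega> \<in> space M. \<eta> < \<bar>gram T (fst z) (snd z) \<omega> - \<Gamma> $$ z\<bar>}"
  let ?I = "{..<k * p}"
  have N: "?N j \<in> sets M" if "j \<in> ?I" for j
  proof -
    have [measurable]: "noise_correlation T i j \<in> borel_measurable M" using noise_correlation_measurable i that by simp
    show ?thesis by measurable
  qed
  have G: "?G z \<in> sets M" if "z \<in> ?I \<times> ?I" for z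
  proof -
    have [measurable]: "gram T (fst z) (snd z) \<in> borel_measurable M" using gram_measurable that by auto
    show ?thesis by measurable
  qed
  have U: "(\<Union>j\<in>?I. ?N j) \<in> sets M" "(\<Union>z\<in>?I \<times> ?I. ?G z) \<in> sets M"
    using N G by (auto intro!: sets.finite_UN)
  have eq: "space M - good_event T i \<mu> \<eta> = (\<Union>j\<in>?I. ?N j) \<union> (\<Union>z\<in>?I \<times> ?I. ?G z)"
    unfolding good_event_def by (auto simp: not_le[symmetric] simp del: not_le lessThan_iff) (meson lessThan_iff not_le)
  have sub: "good_event T i \<mu> \<eta> \<subseteq> space M" by (auto simp: good_event_def)
  show "good_event T i \<mu> \<eta> \<in> sets M"
  proof -
    have "space M - (space M - good_event T i \<mu> \<eta>) \<in> sets M"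
      unfolding eq using U by (intro sets.Diff sets.top sets.Un)
    thus ?thesis using sub by (simp add: double_diff)
  qed
  have "prob (space M - good_event T i \<mu> \<eta>) \<le> prob (\<Union>j\<in>?I. ?N j) + prob (\<Union>z\<in>?I \<times> ?I. ?G z)"
    unfolding eq by (rule measure_Un_le) (use U in auto)
  also have "prob (\<Union>j\<in>?I. ?N j) \<le> (\<Sum>j\<in>?I. prob (?N j))"
    by (rule measure_UNION_le) (use N in auto)
  also have "\<dots> \<le> (\<Sum>j\<in>?I. deviation_bound K T \<mu>)"
    by (intro sum_mono noise_correlation_tail T K dependence \<mu> i noise) simp
  also have "prob (\<Union>z\<in>?I \<times> ?I. ?G z) \<le> (\<Sum>z\<in>?I \<times> ?I. prob (?G z))"
    by (rule measure_UNION_le) (use G in auto)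
  also have "\<dots> \<le> (\<Sum>z\<in>?I \<times> ?I. deviation_bound K T \<eta>)"
  proof (rule sum_mono)
    fix z assume "z \<in> ?I \<times> ?I"
    thus "prob (?G z) \<le> deviation_bound K T \<eta>"
      using gram_tail[OF T K dependence \<eta>, of "fst z" "snd z"] by auto
  qed
  finally show "prob (space M - good_event T i \<mu> \<eta>) \<le> real (k * p) * deviation_bound K T \<mu> +
      (real (k * p))\<^sup>2 * deviation_bound K T \<eta>"
    by (simp add: card_cartesian_product power2_eq_square)
qed

lemma design_mult_vec:
  assumes "v \<in> carrier_vec (k * p)" "r < T"
  shows "(design_mat T k p y \<omega> *\<^sub>v v) $ r = (\<Sum>j<k * p. regressor (int T - int r) j \<omega> * v $ j)"
  using assms by (simp add: design_mat_def scalar_prod_def atLeast0LessThan)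

lemma lasso_objective_eq:
  assumes "v \<in> carrier_vec (k * p)"
  shows "lasso_objective T (design_mat T k p y \<omega>) (response_vec T y i \<omega>) lam v =
    (\<Sum>r<T. (y (int T - int r) i \<omega> - (\<Sum>j<k * p. regressor (int T - int r) j \<omega> * v $ j))\<^sup>2) / real T +
    2 * lam * (\<Sum>j<k * p. \<bar>v $ j\<bar>)"
proof -
  have "(l2_norm (response_vec T y i \<omega> - design_mat T k p y \<omega> *\<^sub>v v))\<^sup>2 =
      (\<Sum>r<T. (y (int T - int r) i \<omega> - (\<Sum>j<k * p. regressor (int T - int r) j \<omega> * v $ j))\<^sup>2)"
    unfolding l2_norm_square
    by (rule sum.cong) (use assms in \<open>auto simp: design_mult_vec[symmetric] response_vec_def design_mat_def\<close>)
  thus ?thesis using assms by (simp add: lasso_objective_def l1_norm_def)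
qed

text \<open>The oracle inequality in terms of the vectors and matrices of the model.\<close>

lemma lasso_error_on_good_event:
  fixes b :: "real vec" and T i :: nat and \<omega> :: 'a
  defines "\<beta> \<equiv> true_param k p \<Phi> i"
  defines "s \<equiv> card (active_set \<beta>)"
  assumes eq: "\<And>r. r < T \<Longrightarrow> y (int T - int r) i \<omega> =
      (\<Sum>c<k * p. \<beta> $ c * regressor (int T - int r) c \<omega>) + \<epsilon> (int T - int r) i \<omega>"
    and lasso: "is_lasso T (design_mat T k p y \<omega>) (response_vec T y i \<omega>) lam b"
    and good: "\<omega> \<in> good_event T i \<mu> \<eta>"
    and pen: "(0 < lam \<and> lam = 2 * \<mu>) \<or> (lam = 0 \<and> active_set \<beta> = {..<k * p})"
    and \<mu>: "0 \<le> \<mu>" and \<eta>: "0 \<le> \<eta>" and g: "0 < g" "g \<le> c - 16 * real s * \<eta>"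
    and re: "c \<le> restricted_eigenvalue_sq \<Gamma> s"
  shows "(l2_norm (design_mat T k p y \<omega> *\<^sub>v b - design_mat T k p y \<omega> *\<^sub>v \<beta>))\<^sup>2 / real T \<le> 64 * real s * \<mu>\<^sup>2 / g"
    and "l1_norm (b - \<beta>) \<le> 32 * real s * \<mu> / g"
proof -
  let ?X = "design_mat T k p y \<omega>" and ?d = "k * p"
  define e where "e = (\<lambda>r. \<epsilon> (int T - int r) i \<omega>)"
  define Z where "Z = (\<lambda>r j. regressor (int T - int r) j \<omega>)"
  define \<delta> where "\<delta> = (\<lambda>j. b $ j - \<beta> $ j)"
  have \<beta>: "\<beta> \<in> carrier_vec ?d" by (simp add: \<beta>_def true_param_def)
  have b: "b \<in> carrier_vec ?d"
    and opt: "lasso_objective T ?X (response_vec T y i \<omega>) lam b \<le> lasso_objective T ?X (response_vec T y i \<omega>) lam \<beta>"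
    using lasso \<beta> by (auto simp: is_lasso_def design_mat_def)
  have J: "active_set \<beta> = {j. j < ?d \<and> \<beta> $ j \<noteq> 0}" using \<beta> by (simp add: active_set_def)
  hence JS: "active_set \<beta> \<subseteq> {..<?d}" by auto
  have res: "y (int T - int r) i \<omega> - (\<Sum>j<?d. regressor (int T - int r) j \<omega> * b $ j) = e r - (\<Sum>j<?d. Z r j * \<delta> j)"
    "y (int T - int r) i \<omega> - (\<Sum>j<?d. regressor (int T - int r) j \<omega> * \<beta> $ j) = e r" if "r < T" for r
    unfolding eq[OF that] by (simp_all add: e_def Z_def \<delta>_def sum_subtractf algebra_simps)
  have opt': "(\<Sum>r<T. (e r - (\<Sum>j<?d. Z r j * \<delta> j))\<^sup>2) / real T + 2 * lam * (\<Sum>j<?d. \<bar>b $ j\<bar>)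
      \<le> (\<Sum>r<T. (e r)\<^sup>2) / real T + 2 * lam * (\<Sum>j<?d. \<bar>\<beta> $ j\<bar>)"
  proof -
    have "(\<Sum>r<T. (y (int T - int r) i \<omega> - (\<Sum>j<?d. regressor (int T - int r) j \<omega> * b $ j))\<^sup>2) =
        (\<Sum>r<T. (e r - (\<Sum>j<?d. Z r j * \<delta> j))\<^sup>2)" by (intro sum.cong) (auto simp: res)
    moreover have "(\<Sum>r<T. (y (int T - int r) i \<omega> - (\<Sum>j<?d. regressor (int T - int r) j \<omega> * \<beta> $ j))\<^sup>2) =
        (\<Sum>r<T. (e r)\<^sup>2)" by (intro sum.cong) (auto simp: res)
    ultimately show ?thesis using opt unfolding lasso_objective_eq[OF b] lasso_objective_eq[OF \<beta>] by simp
  qed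
  have noise: "\<bar>(\<Sum>r<T. e r * Z r j) / real T\<bar> \<le> \<mu>" if "j < ?d" for j
    using good that by (auto simp: good_event_def noise_correlation_def e_def Z_def)
  have quad: "(\<Sum>r<T. (\<Sum>j<?d. Z r j * \<delta> j)\<^sup>2) / real T = (\<Sum>j<?d. \<Sum>l<?d. \<delta> j * gram T j l \<omega> * \<delta> l)"
  proof -
    have "(\<Sum>r<T. (\<Sum>j<?d. Z r j * \<delta> j)\<^sup>2) = (\<Sum>r<T. \<Sum>j<?d. \<Sum>l<?d. \<delta> j * (Z r j * Z r l) * \<delta> l)"
      unfolding power2_eq_square sum_product by (intro sum.cong refl) (simp add: mult_ac)
    also have "\<dots> = (\<Sum>j<?d. \<Sum>l<?d. \<Sum>r<T. \<delta> j * (Z r j * Z r l) * \<delta> l)"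
      by (subst sum.swap) (intro sum.cong refl sum.swap)
    also have "\<dots> = (\<Sum>j<?d. \<Sum>l<?d. \<delta> j * (\<Sum>r<T. Z r j * Z r l) * \<delta> l)"
      by (simp add: sum_distrib_left sum_distrib_right)
    finally show ?thesis by (simp only: gram_def Z_def sum_divide_distrib[where A="{..<?d}"] times_divide_eq_right times_divide_eq_left)
  qed
  have re': "g * (\<Sum>j\<in>active_set \<beta>. (\<delta> j)\<^sup>2) \<le> (\<Sum>r<T. (\<Sum>j<?d. Z r j * \<delta> j)\<^sup>2) / real T"
    if cone: "(\<Sum>j\<in>{..<?d} - active_set \<beta>. \<bar>\<delta> j\<bar>) \<le> 3 * (\<Sum>j\<in>active_set \<beta>. \<bar>\<delta> j\<bar>)"
  proof -
    have "c * (\<Sum>j\<in>active_set \<beta>. (\<delta> j)\<^sup>2) \<le> (\<Sum>j<?d. \<Sum>l<?d. \<delta> j * \<Gamma> $$ (j, l) * \<delta> l)"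
      using restricted_eigenvalue_lag_cov[OF re JS _ cone] by (simp add: s_def quad_form_def mult_ac)
    moreover have "\<bar>gram T j l \<omega> - \<Gamma> $$ (j, l)\<bar> \<le> \<eta>" if "j < ?d" "l < ?d" for j l
      using good that by (auto simp: good_event_def)
    ultimately have "(c - 16 * real s * \<eta>) * (\<Sum>j\<in>active_set \<beta>. (\<delta> j)\<^sup>2) \<le> (\<Sum>j<?d. \<Sum>l<?d. \<delta> j * gram T j l \<omega> * \<delta> l)"
      unfolding s_def using restricted_eigenvalue_perturbation[OF JS cone, of "\<lambda>j l. gram T j l \<omega>" "\<lambda>j l. \<Gamma> $$ (j, l)" \<eta> c] \<eta> by blast
    moreover have "g * (\<Sum>j\<in>active_set \<beta>. (\<delta> j)\<^sup>2) \<le> (c - 16 * real s * \<eta>) * (\<Sum>j\<in>active_set \<beta>. (\<delta> j)\<^sup>2)"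
      using g by (intro mult_right_mono sum_nonneg) auto
    ultimately show ?thesis unfolding quad by linarith
  qed
  note bounds = lasso_oracle_inequality[where Z=Z and e=e and b="\<lambda>j. b $ j" and \<beta>="\<lambda>j. \<beta> $ j" and T=T and d="?d",
      OF opt'[unfolded \<delta>_def] noise \<mu> J pen g(1) re'[unfolded \<delta>_def], folded s_def]
  have "(l2_norm (?X *\<^sub>v b - ?X *\<^sub>v \<beta>))\<^sup>2 = (\<Sum>r<T. (\<Sum>j<?d. Z r j * \<delta> j)\<^sup>2)"
    unfolding l2_norm_square
  proof (rule sum.cong)
    show "{..<dim_vec (?X *\<^sub>v b - ?X *\<^sub>v \<beta>)} = {..<T}" by (simp add: design_mat_def)
    fix r assume "r \<in> {..<T}"
    hence r: "r < T" by simp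
    have "(?X *\<^sub>v b - ?X *\<^sub>v \<beta>) $ r = (?X *\<^sub>v b) $ r - (?X *\<^sub>v \<beta>) $ r"
      using r by (simp add: design_mat_def)
    also have "\<dots> = (\<Sum>j<?d. Z r j * \<delta> j)"
      unfolding design_mult_vec[OF b r] design_mult_vec[OF \<beta> r]
      by (simp add: Z_def \<delta>_def right_diff_distrib sum_subtractf)
    finally show "((?X *\<^sub>v b - ?X *\<^sub>v \<beta>) $ r)\<^sup>2 = (\<Sum>j<?d. Z r j * \<delta> j)\<^sup>2" by simp
  qed
  thus "(l2_norm (?X *\<^sub>v b - ?X *\<^sub>v \<beta>))\<^sup>2 / real T \<le> 64 * real s * \<mu>\<^sup>2 / g" using bounds(1) by (simp add: \<delta>_def)
  have "l1_norm (b - \<beta>) = (\<Sum>j<?d. \<bar>\<delta> j\<bar>)" using b \<beta> by (simp add: l1_norm_def \<delta>_def)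
  thus "l1_norm (b - \<beta>) \<le> 32 * real s * \<mu> / g" using bounds(2) by (simp add: \<delta>_def)
qed

lemma regression_equations:
  assumes "i < k"
  shows "AE \<omega> in M. \<forall>r\<in>{..<T}. y (int T - int r) i \<omega> =
      (\<Sum>c<k * p. true_param k p \<Phi> i $ c * regressor (int T - int r) c \<omega>) + \<epsilon> (int T - int r) i \<omega>"
  by (rule AE_finite_allI) (use observation_equation[OF assms] in auto)

end

context stationary_gaussian_var
begin

text \<open>With $\eta = (1 - q) c / (16 s)$ the empirical Gram matrix keeps the part $qc$ of the restricted
eigenvalue. The exceptional set is only known to contain the bad outcomes up to null sets, because the
model equation holds almost surely.\<close>

lemma lasso_error_bounds:
  fixes b :: "'a \<Rightarrow> real vec" and T i :: nat
  defines "\<beta> \<equiv> true_param k p \<Phi> i"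
  defines "s \<equiv> card (active_set \<beta>)"
  assumes T: "0 < T" and i: "i < k" and s: "1 \<le> s"
    and re: "c \<le> restricted_eigenvalue_sq \<Gamma> s" and c: "0 < c" and q: "0 < q" "q < 1"
    and dependence: "2 * (spectral_norm \<Gamma> * (\<Sum>h=0..T. spectral_norm (F ^\<^sub>m h))) \<le> K"
    and noise: "(max_sd M k y \<epsilon>)\<^sup>2 \<le> K" and cK: "c \<le> K"
    and \<mu>: "0 \<le> \<mu>" "\<mu> \<le> 4 * K"
    and pen: "(0 < lam \<and> lam = 2 * \<mu>) \<or> (lam = 0 \<and> active_set \<beta> = {..<k * p})"
    and lasso: "\<And>\<omega>. \<omega> \<in> space M \<Longrightarrow> is_lasso T (design_mat T k p y \<omega>) (response_vec T y i \<omega>) lam (b \<omega>)"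
  shows "\<exists>B\<in>sets M. prob B \<le> real (k * p) * deviation_bound K T \<mu> +
      (real (k * p))\<^sup>2 * deviation_bound K T ((1 - q) * c / (16 * real s)) \<and>
    (AE \<omega> in M. \<omega> \<notin> B \<longrightarrow>
      (l2_norm (design_mat T k p y \<omega> *\<^sub>v b \<omega> - design_mat T k p y \<omega> *\<^sub>v \<beta>))\<^sup>2 / real T \<le> 64 * real s * \<mu>\<^sup>2 / (q * c) \<and>
      l1_norm (b \<omega> - \<beta>) \<le> 32 * real s * \<mu> / (q * c))" (is "\<exists>B\<in>sets M. prob B \<le> ?bound \<and> (AE \<omega> in M. \<omega> \<notin> B \<longrightarrow> ?accurate \<omega>)")
proof -
  define \<eta> where "\<eta> = (1 - q) * c / (16 * real s)"
  have K: "0 < K" using c cK by simp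
  have \<eta>0: "0 \<le> \<eta>" using c q by (simp add: \<eta>_def)
  have "\<eta> \<le> c"
  proof -
    have "(1 - q) * c \<le> 1 * c" using c q by (intro mult_right_mono) auto
    also have "\<dots> \<le> c * (16 * real s)" using c s by simp
    finally show ?thesis using s by (simp add: \<eta>_def divide_le_eq)
  qed
  hence \<eta>K: "\<eta> \<le> 4 * K" using cK K by linarith
  have g: "q * c \<le> c - 16 * real s * \<eta>" using s by (simp add: \<eta>_def field_simps)
  have nv: "second_moment (\<epsilon> 1 i) \<le> K" using second_moment_le_max_sd(2)[OF i] noise by linarith
  note good = good_event_probability[OF T K dependence i nv \<mu> \<eta>0 \<eta>K]
  show ?thesis
  proof (intro bexI[of _ "space M - good_event T i \<mu> \<eta>"] conjI)
    show "space M - good_event T i \<mu> \<eta> \<in> sets M" using good(1) by simp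
    show "prob (space M - good_event T i \<mu> \<eta>) \<le> ?bound" using good(2) unfolding \<eta>_def .
    show "AE \<omega> in M. \<omega> \<notin> space M - good_event T i \<mu> \<eta> \<longrightarrow>
      ?accurate \<omega>"
      using regression_equations[OF i, of T] AE_space
    proof eventually_elim
      case (elim \<omega>)
      show ?case
      proof
        assume "\<omega> \<notin> space M - good_event T i \<mu> \<eta>"
        hence "\<omega> \<in> good_event T i \<mu> \<eta>" using elim(2) by simp
        thus "?accurate \<omega>"
          using lasso_error_on_good_event[of T i \<omega> lam "b \<omega>" \<mu> \<eta> "q * c" c] elim(1) lasso[OF elim(2)] pen \<mu> \<eta>0 g re q c
          unfolding \<beta>_def s_def by simp
      qed
    qed
  qed
qed

end

section \<open>The model with a single regressor\<close>

context prob_space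
begin

text \<open>By Fubini: for almost every value of \<open>U\<close> the expression vanishes at one value of \<open>e (V \<omega>)\<close> only, and
\<open>e (V \<omega>)\<close> has no atoms.\<close>

lemma indep_affine_nonzero:
  assumes ind: "indep_var N U L V"
    and a[measurable]: "a \<in> borel_measurable N" and b[measurable]: "b \<in> borel_measurable N"
    and e[measurable]: "e \<in> borel_measurable L"
    and a0: "AE \<omega> in M. a (U \<omega>) \<noteq> 0"
    and e0: "\<And>x. AE \<omega> in M. e (V \<omega>) \<noteq> (x::real)"
  shows "AE \<omega> in M. e (V \<omega>) * a (U \<omega>) + b (U \<omega>) \<noteq> 0"
proof -
  have U[measurable]: "U \<in> measurable M N" and V[measurable]: "V \<in> measurable M L"
    using ind by (auto dest: indep_var_rv1 indep_var_rv2)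
  interpret DU: prob_space "distr M N U" by (rule prob_space_distr) simp
  interpret DV: prob_space "distr M L V" by (rule prob_space_distr) simp
  interpret P: pair_prob_space "distr M N U" "distr M L V" ..
  have "AE u in distr M N U. a u \<noteq> 0"
    using a0 by (subst AE_distr_iff) simp_all
  hence "AE u in distr M N U. AE v in distr M L V. e v * a u + b u \<noteq> 0"
  proof eventually_elim
    case (elim u)
    have "AE \<omega> in M. e (V \<omega>) * a u + b u \<noteq> 0"
      using e0[of "- b u / a u"] by eventually_elim (use elim in \<open>auto simp: field_simps\<close>)
    thus ?case by (subst AE_distr_iff) simp_all
  qed
  moreover have "{z \<in> space (distr M N U \<Otimes>\<^sub>M distr M L V). e (snd z) * a (fst z) + b (fst z) \<noteq> 0}
      \<in> sets (distr M N U \<Otimes>\<^sub>M distr M L V)"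
  proof -
    have "{z \<in> space (N \<Otimes>\<^sub>M L). e (snd z) * a (fst z) + b (fst z) \<noteq> 0} \<in> sets (N \<Otimes>\<^sub>M L)" by measurable
    moreover have "sets (distr M N U \<Otimes>\<^sub>M distr M L V) = sets (N \<Otimes>\<^sub>M L)"
      by (intro sets_pair_measure_cong) simp_all
    ultimately show ?thesis by (simp add: space_pair_measure)
  qed
  ultimately have "AE z in distr M N U \<Otimes>\<^sub>M distr M L V. e (snd z) * a (fst z) + b (fst z) \<noteq> 0"
    by (intro P.AE_pair_measure) simp_all
  also have "distr M N U \<Otimes>\<^sub>M distr M L V = distr M (N \<Otimes>\<^sub>M L) (\<lambda>\<omega>. (U \<omega>, V \<omega>))"
    using ind by (simp add: indep_var_distribution_eq)
  finally show ?thesis by (subst (asm) AE_distr_iff) simp_all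
qed

lemma centered_normal_AE_neq:
  assumes X: "centered_normal M X" and pos: "second_moment X \<noteq> 0"
  shows "AE \<omega> in M. X \<omega> \<noteq> x"
proof -
  note [measurable] = centered_normal_measurable[OF X]
  obtain v where v: "0 \<le> v" "distr M borel X = distr std_normal_distribution borel (\<lambda>x. sqrt v * x)"
    "second_moment X = v"
    using centered_normalE[OF X] by metis
  have v0: "0 < sqrt v" using v pos by simp
  have "AE z in lborel. z \<noteq> x / sqrt v" by (rule AE_lborel_singleton)
  hence "AE z in std_normal_distribution. sqrt v * z \<noteq> x"
  proof (subst AE_density, simp, eventually_elim)
    case (elim z)
    have "z = x / sqrt v" if "sqrt v * z = x" using v0 that by (auto simp: field_simps)
    thus ?case using elim by blast
  qed
  hence "AE z in distr M borel X. z \<noteq> x"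
    unfolding v(2) by (subst AE_distr_iff) simp_all
  thus ?thesis by (subst (asm) AE_distr_iff) simp_all
qed

end

context stationary_gaussian_var
begin

text \<open>The noise before time \<open>t\<close> as one random element, which is independent of the noise at time \<open>t\<close>.\<close>

definition past_noise :: "int \<Rightarrow> 'a \<Rightarrow> int \<Rightarrow> nat \<Rightarrow> real" where
  "past_noise t \<omega> = (\<lambda>s\<in>{..<t}. \<lambda>j\<in>{..<k}. \<epsilon> s j \<omega>)"

abbreviation "past_space t \<equiv> PiM {..<t::int} (\<lambda>_. PiM {..<k} (\<lambda>_. borel :: real measure))"

text \<open>The causal series is a measurable function of the noise, and it uses only noise up to time \<open>s\<close>.\<close>

lemma observed_past_function:
  assumes "s < t" "j < k"
  shows "\<exists>g\<in>borel_measurable (past_space t). AE \<omega> in M. y s j \<omega> = g (past_noise t \<omega>)"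
proof -
  obtain \<Psi> :: "nat \<Rightarrow> real mat" where
    \<Psi>: "AE \<omega> in M. (\<lambda>n. \<Sum>l<k. \<Psi> n $$ (j, l) * \<epsilon> (s - int n) l \<omega>) sums y s j \<omega>"
    using causal assms(2) by blast
  define g where "g = (\<lambda>f. \<Sum>n. \<Sum>l<k. \<Psi> n $$ (j, l) * f (s - int n) l)"
  have "g \<in> borel_measurable (past_space t)"
    unfolding g_def
  proof (intro borel_measurable_suminf borel_measurable_sum borel_measurable_times borel_measurable_const)
    fix n l assume l: "l \<in> {..<k}"
    have "s - int n \<in> {..<t}" using assms(1) by simp
    thus "(\<lambda>f. f (s - int n) l) \<in> borel_measurable (past_space t)"
      using l by (intro measurable_compose[where N="PiM {..<k} (\<lambda>_. borel)", OF _ measurable_component_singleton]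
        measurable_component_singleton) auto
  qed
  moreover have "AE \<omega> in M. y s j \<omega> = g (past_noise t \<omega>)"
    using \<Psi>
  proof eventually_elim
    case (elim \<omega>)
    have "(\<Sum>l<k. \<Psi> n $$ (j, l) * past_noise t \<omega> (s - int n) l) = (\<Sum>l<k. \<Psi> n $$ (j, l) * \<epsilon> (s - int n) l \<omega>)" for n
      using assms(1) by (simp add: past_noise_def)
    thus ?case using elim by (simp add: g_def sums_iff)
  qed
  ultimately show ?thesis by blast
qed

text \<open>In the newest summand the noise at time \<open>T\<close> is multiplied by a regressor, and everything else is a
function of the past. So the sum is an affine function of this noise variable with coefficients from
the past, and \<open>indep_affine_nonzero\<close> applies.\<close>

lemma response_regressor_correlation_nonzero:
  assumes i: "i < k" and j: "j < k * p" and T: "0 < T"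
    and reg: "expectation (\<lambda>\<omega>. (regressor (int T) j \<omega>)\<^sup>2) \<noteq> 0"
    and noise: "second_moment (\<epsilon> (int T) i) \<noteq> 0"
  shows "AE \<omega> in M. (\<Sum>r<T. y (int T - int r) i \<omega> * regressor (int T - int r) j \<omega>) \<noteq> 0"
proof -
  let ?t = "int T"
  define g where "g = (\<lambda>s l. SOME g. g \<in> borel_measurable (past_space ?t) \<and> (AE \<omega> in M. y s l \<omega> = g (past_noise ?t \<omega>)))"
  have g: "g s l \<in> borel_measurable (past_space ?t)" "AE \<omega> in M. y s l \<omega> = g s l (past_noise ?t \<omega>)"
    if "s < ?t" "l < k" for s l
    using someI_ex[OF observed_past_function[OF that, unfolded Bex_def]] unfolding g_def by blast+
  define R where "R = (\<lambda>t c. g (t - int (c div k + 1)) (c mod k))"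
  have ck: "c mod k < k" for c using k_pos by simp
  have R: "R s c \<in> borel_measurable (past_space ?t)" "AE \<omega> in M. regressor s c \<omega> = R s c (past_noise ?t \<omega>)"
    if "s \<le> ?t" "c < k * p" for s c
    using that g[of "s - int (c div k + 1)" "c mod k"] ck by (simp_all add: R_def regressor_apply)
  define b where "b = (\<lambda>f. (\<Sum>c<k * p. true_param k p \<Phi> i $ c * R ?t c f) * R ?t j f +
      (\<Sum>r\<in>{1..<T}. g (?t - int r) i f * R (?t - int r) j f))"
  have ind: "indep_var (past_space ?t) (past_noise ?t) (PiM {?t} (\<lambda>_. PiM {..<k} (\<lambda>_. borel)))
      (\<lambda>\<omega>. \<lambda>s\<in>{?t}. \<lambda>j\<in>{..<k}. \<epsilon> s j \<omega>)"
    unfolding past_noise_def by (rule indep_var_restrict[OF noise_indep]) auto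
  have "AE \<omega> in M. (\<lambda>s\<in>{?t}. \<lambda>j\<in>{..<k}. \<epsilon> s j \<omega>) ?t i * R ?t j (past_noise ?t \<omega>) + b (past_noise ?t \<omega>) \<noteq> 0"
  proof (rule indep_affine_nonzero[OF ind, where e="\<lambda>f. f ?t i"])
    show "(\<lambda>f. f ?t i) \<in> borel_measurable (PiM {?t} (\<lambda>_. PiM {..<k} (\<lambda>_. borel :: real measure)))"
      using i by (intro measurable_compose[where N="PiM {..<k} (\<lambda>_. borel)", OF _ measurable_component_singleton]
        measurable_component_singleton) auto
    show "R ?t j \<in> borel_measurable (past_space ?t)" using R j by simp
    show "b \<in> borel_measurable (past_space ?t)" unfolding b_def
      using R j g(1) i by (intro borel_measurable_add borel_measurable_times borel_measurable_sum borel_measurable_const) auto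
    show "AE \<omega> in M. R ?t j (past_noise ?t \<omega>) \<noteq> 0"
      using R(2)[OF order_refl j] centered_normal_AE_neq[OF joint_span_centered_normal[OF regressor_joint_span[OF j]] reg, of 0]
      by eventually_elim simp
    show "AE \<omega> in M. (\<lambda>s\<in>{?t}. \<lambda>j\<in>{..<k}. \<epsilon> s j \<omega>) ?t i \<noteq> x" for x
      using centered_normal_AE_neq[OF noise_centered_normal[OF i] noise] i by simp
  qed
  moreover have "AE \<omega> in M. \<forall>c\<in>{..<k * p}. regressor ?t c \<omega> = R ?t c (past_noise ?t \<omega>)"
    by (rule AE_finite_allI) (use R in auto)
  moreover have "AE \<omega> in M. \<forall>r\<in>{1..<T}. regressor (?t - int r) j \<omega> = R (?t - int r) j (past_noise ?t \<omega>)"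
    by (rule AE_finite_allI) (use R j in auto)
  moreover have "AE \<omega> in M. \<forall>r\<in>{1..<T}. y (?t - int r) i \<omega> = g (?t - int r) i (past_noise ?t \<omega>)"
    by (rule AE_finite_allI) (use g(2) i in auto)
  moreover note observation_equation[OF i, of ?t]
  ultimately show ?thesis
  proof eventually_elim
    case (elim \<omega>)
    have "(\<Sum>r<T. y (?t - int r) i \<omega> * regressor (?t - int r) j \<omega>) =
        y ?t i \<omega> * regressor ?t j \<omega> + (\<Sum>r\<in>{1..<T}. y (?t - int r) i \<omega> * regressor (?t - int r) j \<omega>)"
      using T by (simp add: lessThan_atLeast0 sum.atLeast_Suc_lessThan)
    also have "(\<Sum>r\<in>{1..<T}. y (?t - int r) i \<omega> * regressor (?t - int r) j \<omega>) =
        (\<Sum>r\<in>{1..<T}. g (?t - int r) i (past_noise ?t \<omega>) * R (?t - int r) j (past_noise ?t \<omega>))"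
      using elim(3,4) by (intro sum.cong) auto
    also have "y ?t i \<omega> = (\<Sum>c<k * p. true_param k p \<Phi> i $ c * R ?t c (past_noise ?t \<omega>)) + \<epsilon> ?t i \<omega>"
      using elim(2,5) by simp
    also have "regressor ?t j \<omega> = R ?t j (past_noise ?t \<omega>)" using elim(2) j by simp
    finally show ?case using elim(1) i by (simp add: b_def distrib_right algebra_simps)
  qed
qed

text \<open>If the noise vanished, so would the causal series.\<close>

lemma noise_nondegenerate_univariate:
  assumes k: "k = 1" and y: "second_moment (y t 0) \<noteq> 0"
  shows "expectation (\<lambda>\<omega>. (\<epsilon> s 0 \<omega>)\<^sup>2) \<noteq> 0"
proof
  assume z: "expectation (\<lambda>\<omega>. (\<epsilon> s 0 \<omega>)\<^sup>2) = 0"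
  have AE0: "AE \<omega> in M. \<epsilon> u 0 \<omega> = 0" for u
  proof -
    have "expectation (\<lambda>\<omega>. (\<epsilon> u 0 \<omega>)\<^sup>2) = 0"
      using z noise_second_moment_time_invariant[of 0 u s] k by simp
    moreover have "integrable M (\<lambda>\<omega>. (\<epsilon> u 0 \<omega>)\<^sup>2)"
      using k by (intro centered_normal_integrable_square noise_centered_normal) simp
    ultimately have "AE \<omega> in M. (\<epsilon> u 0 \<omega>)\<^sup>2 = 0"
      by (subst integral_nonneg_eq_0_iff_AE[symmetric]) simp_all
    thus ?thesis by simp
  qed
  obtain \<Psi> :: "nat \<Rightarrow> real mat" where
    \<Psi>: "AE \<omega> in M. (\<lambda>n. \<Sum>l<k. \<Psi> n $$ (0, l) * \<epsilon> (t - int n) l \<omega>) sums y t 0 \<omega>"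
    using causal k by auto
  have "AE \<omega> in M. \<forall>n. \<epsilon> (t - int n) 0 \<omega> = 0" using AE0 by (simp add: AE_all_countable)
  with \<Psi> have "AE \<omega> in M. (y t 0 \<omega>)\<^sup>2 = 0"
  proof eventually_elim
    case (elim \<omega>)
    thus ?case using k by (simp add: sums_iff)
  qed
  hence "second_moment (y t 0) = 0" by (rule integral_eq_zero_AE)
  thus False using y by simp
qed

text \<open>Least squares in a single regressor gives $0$ only if response and regressor are orthogonal.\<close>

lemma unpenalized_univariate_lasso_nonzero:
  assumes kp: "k * p = 1" and T: "0 < T" and y: "\<Gamma> $$ (0, 0) \<noteq> 0"
  shows "AE \<omega> in M. \<forall>b. is_lasso T (design_mat T k p y \<omega>) (response_vec T y 0 \<omega>) 0 b \<longrightarrow> b $ 0 \<noteq> 0"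
proof -
  have k: "k = 1" and p: "p = 1" using kp by auto
  have "second_moment (y 0 0) \<noteq> 0"
    using y kp k p by (simp add: lag_cov_mat_def lag_vec_def power2_eq_square)
  hence noise: "expectation (\<lambda>\<omega>. (\<epsilon> (int T) 0 \<omega>)\<^sup>2) \<noteq> 0" by (rule noise_nondegenerate_univariate[OF k])
  have reg: "expectation (\<lambda>\<omega>. (regressor (int T) 0 \<omega>)\<^sup>2) \<noteq> 0"
    using y regressor_second_moment[of 0 0 "int T"] kp by (simp add: power2_eq_square)
  have "AE \<omega> in M. (\<Sum>r<T. y (int T - int r) 0 \<omega> * regressor (int T - int r) 0 \<omega>) \<noteq> 0"
    by (rule response_regressor_correlation_nonzero[OF _ _ T reg noise]) (use k kp in auto)
  thus ?thesis
  proof eventually_elim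
    case (elim \<omega>)
    define u z where "u = (\<lambda>r. y (int T - int r) 0 \<omega>)" and "z = (\<lambda>r. regressor (int T - int r) 0 \<omega>)"
    define A B where "A = (\<Sum>r<T. u r * z r)" and "B = (\<Sum>r<T. (z r)\<^sup>2)"
    have A: "A \<noteq> 0" using elim by (simp add: A_def u_def z_def)
    have B: "0 \<le> B" by (simp add: B_def sum_nonneg)
    have obj: "lasso_objective T (design_mat T k p y \<omega>) (response_vec T y 0 \<omega>) 0 v =
        ((\<Sum>r<T. (u r)\<^sup>2) - 2 * v $ 0 * A + (v $ 0)\<^sup>2 * B) / real T" if "v \<in> carrier_vec 1" for v
    proof -
      have "lasso_objective T (design_mat T k p y \<omega>) (response_vec T y 0 \<omega>) 0 v = (\<Sum>r<T. (u r - z r * v $ 0)\<^sup>2) / real T"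
        using lasso_objective_eq[of v T \<omega> 0 0] that kp by (simp add: u_def z_def)
      also have "(\<Sum>r<T. (u r - z r * v $ 0)\<^sup>2) = (\<Sum>r<T. (u r)\<^sup>2) - 2 * v $ 0 * A + (v $ 0)\<^sup>2 * B"
        by (simp add: A_def B_def power2_diff sum.distrib sum_subtractf sum_distrib_left power_mult_distrib mult_ac)
      finally show ?thesis .
    qed
    show ?case
    proof (intro allI impI notI)
      fix b assume b: "is_lasso T (design_mat T k p y \<omega>) (response_vec T y 0 \<omega>) 0 b" and b0: "b $ 0 = 0"
      have bc: "b \<in> carrier_vec 1" and
        min: "\<And>v. v \<in> carrier_vec 1 \<Longrightarrow> lasso_objective T (design_mat T k p y \<omega>) (response_vec T y 0 \<omega>) 0 b
          \<le> lasso_objective T (design_mat T k p y \<omega>) (response_vec T y 0 \<omega>) 0 v"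
        using b kp by (auto simp: is_lasso_def design_mat_def)
      \<comment> \<open>A step in the direction of the correlation. The minimizer would be \<open>A / B\<close>; adding \<open>1\<close> avoids the case \<open>B = 0\<close>.\<close>
      define x where "x = A / (B + 1)"
      have "vec 1 (\<lambda>_. x) \<in> carrier_vec 1" by simp
      from min[OF this] have "0 \<le> (- 2 * x * A + x\<^sup>2 * B) / real T"
        unfolding obj[OF bc] obj[OF \<open>vec 1 (\<lambda>_. x) \<in> carrier_vec 1\<close>] b0 using T by (simp add: field_simps)
      hence "2 * x * A \<le> x\<^sup>2 * B" using T by (simp add: zero_le_divide_iff)
      moreover have "x\<^sup>2 * B \<le> x\<^sup>2 * (B + 1)" by (simp add: distrib_left)
      moreover have "x\<^sup>2 * (B + 1) = x * A" using B by (simp add: x_def power2_eq_square)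
      moreover have "0 < x * A" using A B by (simp add: x_def power2_eq_square[symmetric] divide_pos_pos)
      ultimately show False by linarith
    qed
  qed
qed

end

section \<open>Rates\<close>

text \<open>Up to null sets the event of a deviation lies in the exceptional set. The comparison of their measures is
also valid when the event is not measurable, because its measure is then $0$ by convention.\<close>

lemma tendsto_0_in_probI:
  assumes bound: "eventually (\<lambda>T. \<exists>B\<in>sets (M T). measure (M T) B \<le> f T \<and> (AE \<omega> in M T. \<omega> \<notin> B \<longrightarrow> \<bar>Y T \<omega>\<bar> \<le> r T)) sequentially"
    and prob: "eventually (\<lambda>T. prob_space (M T)) sequentially"
    and f: "f \<longlonglongrightarrow> 0" and r: "r \<longlonglongrightarrow> (0::real)"
  shows "tendsto_0_in_prob M Y"
  unfolding tendsto_0_in_prob_def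
proof (intro allI impI)
  fix e :: real assume e: "0 < e"
  have re: "eventually (\<lambda>T. r T < e) sequentially" using r e by (rule order_tendstoD)
  show "(\<lambda>T. measure (M T) {\<omega> \<in> space (M T). e < \<bar>Y T \<omega>\<bar>}) \<longlonglongrightarrow> 0"
  proof (rule tendsto_sandwich[OF _ _ tendsto_const f])
    show "eventually (\<lambda>T. measure (M T) {\<omega> \<in> space (M T). e < \<bar>Y T \<omega>\<bar>} \<le> f T) sequentially"
      using bound prob re
    proof eventually_elim
      case (elim T)
      interpret prob_space "M T" by (rule elim(2))
      obtain B where B: "B \<in> events" "prob B \<le> f T" "AE \<omega> in M T. \<omega> \<notin> B \<longrightarrow> \<bar>Y T \<omega>\<bar> \<le> r T"
        using elim(1) by blast
      have "prob {\<omega> \<in> space (M T). e < \<bar>Y T \<omega>\<bar>} \<le> prob B"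
      proof (rule finite_measure_mono_AE[OF _ B(1)])
        show "AE \<omega> in M T. \<omega> \<in> {\<omega> \<in> space (M T). e < \<bar>Y T \<omega>\<bar>} \<longrightarrow> \<omega> \<in> B"
          using B(3) by eventually_elim (use elim(3) in auto)
      qed
      thus ?case using B(2) by simp
    qed
  qed simp
qed

text \<open>The form in which a union bound over \<open>n\<close> events is absorbed by the exponent.\<close>

lemma union_exp_bound:
  fixes n x \<rho> :: real
  assumes "0 < n" "\<rho> + ln n \<le> x"
  shows "n * (4 * exp (- x)) \<le> 4 * exp (- \<rho>)"
proof -
  have "n * (4 * exp (- x)) = 4 * exp (ln n - x)"
    using assms(1) by (simp add: exp_diff exp_minus field_simps)
  thus ?thesis using assms(2) by simp
qed

text \<open>The additive constant is absorbed because $T^a \ge 1$ for $a \ge 0$.\<close>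

lemma log_growth:
  fixes k :: "nat \<Rightarrow> nat"
  assumes "(\<lambda>T. real (k T)) \<in> O(\<lambda>T. exp (real T powr a))" and a: "0 \<le> a"
  shows "\<exists>C>0. eventually (\<lambda>T. ln (1 + real (k T)) \<le> C * real T powr a) sequentially"
proof -
  obtain C where C: "C > 0" "eventually (\<lambda>T. norm (real (k T)) \<le> C * norm (exp (real T powr a))) sequentially"
    using assms(1) by (elim landau_o.bigE)
  show ?thesis
  proof (intro exI[of _ "ln (1 + C) + 1"] conjI)
    show "0 < ln (1 + C) + 1" using C(1) ln_ge_zero[of "1 + C"] by linarith
    show "eventually (\<lambda>T. ln (1 + real (k T)) \<le> (ln (1 + C) + 1) * real T powr a) sequentially"
      using C(2) eventually_ge_at_top[of 1]
    proof eventually_elim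
      case (elim T)
      let ?t = "real T powr a"
      have t: "1 \<le> ?t" using elim(2) a by (simp add: ge_one_powr_ge_zero)
      have "1 + real (k T) \<le> (1 + C) * exp ?t"
      proof -
        have "1 \<le> exp ?t" using t by simp
        moreover have "real (k T) \<le> C * exp ?t" using elim(1) by simp
        ultimately show ?thesis unfolding distrib_right by linarith
      qed
      hence "ln (1 + real (k T)) \<le> ln ((1 + C) * exp ?t)" by (subst ln_le_cancel_iff) (use C in auto)
      also have "\<dots> = ln (1 + C) + ?t" using C(1) by (subst ln_mult_pos) auto
      also have "\<dots> \<le> ln (1 + C) * ?t + ?t"
        using mult_left_mono[OF t, of "ln (1 + C)"] C(1) by simp
      finally show ?case by (simp add: distrib_right)
    qed
  qed
qed

lemma lasso_penalty_square:
  assumes "1 \<le> T" "1 \<le> k" "1 \<le> p"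
  shows "(lasso_penalty T k p \<sigma>)\<^sup>2 = 8 * ln (1 + real T) ^ 5 * ln (1 + real k) ^ 4 * ln (1 + real p) ^ 2 *
           ln (real k ^ 2 * real p) * \<sigma> ^ 4 / real T"
proof -
  have "1 \<le> k ^ 2 * p" using assms by simp
  hence "1 \<le> real (k ^ 2 * p)" by linarith
  hence "0 \<le> ln (real k ^ 2 * real p)" by simp
  moreover have "0 \<le> ln (1 + real k)" "0 \<le> ln (1 + real p)" "0 \<le> ln (1 + real T)" by simp_all
  moreover have "0 \<le> \<sigma> ^ 4" by (rule zero_le_even_power) simp
  ultimately have "0 \<le> 8 * ln (1 + real T) ^ 5 * ln (1 + real k) ^ 4 * ln (1 + real p) ^ 2 *
           ln (real k ^ 2 * real p) * \<sigma> ^ 4 / real T"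
    by (intro divide_nonneg_nonneg mult_nonneg_nonneg) simp_all
  thus ?thesis unfolding lasso_penalty_def by (rule real_sqrt_pow2)
qed

lemma lasso_penalty_nonneg: "1 \<le> k \<Longrightarrow> 1 \<le> p \<Longrightarrow> 0 \<le> lasso_penalty T k p \<sigma>"
proof -
  assume kp: "1 \<le> k" "1 \<le> p"
  have "1 \<le> k ^ 2 * p" using kp by simp
  hence "1 \<le> real (k ^ 2 * p)" by linarith
  hence "0 \<le> ln (real k ^ 2 * real p)" by simp
  moreover have "0 \<le> \<sigma> ^ 4" by (rule zero_le_even_power) simp
  ultimately show ?thesis unfolding lasso_penalty_def
    by (intro real_sqrt_ge_zero divide_nonneg_nonneg mult_nonneg_nonneg) simp_all
qed

text \<open>The logarithms of $1 + k$ and $1 + p$ are at least $\ln 2$ and $k^2 p \ge kp$. What remains is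
$\ln (kp)$ with a factor that tends to infinity with \<open>T\<close>, which outweighs the union bound.\<close>

lemma lasso_penalty_lower:
  assumes T: "1 \<le> T" and kp: "1 \<le> k" "1 \<le> p" and c: "0 \<le> c" "c \<le> \<sigma>\<^sup>2"
  shows "8 * c\<^sup>2 * ln 2 ^ 6 * ln (1 + real T) ^ 5 * ln (real (k * p)) \<le> real T * (lasso_penalty T k p \<sigma>)\<^sup>2"
proof -
  have kp1: "1 \<le> real k" "1 \<le> real p" using kp by auto
  have l: "ln 2 \<le> ln (1 + real k)" "ln 2 \<le> ln (1 + real p)" using kp1 by simp_all
  have l2: "0 \<le> ln (2::real)" by simp
  have lT: "0 \<le> ln (1 + real T)" by simp
  have a: "ln 2 ^ 6 \<le> ln (1 + real k) ^ 4 * ln (1 + real p) ^ 2"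
  proof -
    have "ln (2::real) ^ 4 * ln 2 ^ 2 \<le> ln (1 + real k) ^ 4 * ln (1 + real p) ^ 2"
      using l l2 by (intro mult_mono power_mono) auto
    thus ?thesis by (simp add: power_add[symmetric])
  qed
  have b: "ln (real (k * p)) \<le> ln (real k ^ 2 * real p)"
  proof -
    have "real k * real p \<le> (real k * real k) * real p" using kp1 by simp
    thus ?thesis using kp1 by (simp add: power2_eq_square)
  qed
  have kpln: "0 \<le> ln (real (k * p))" using kp1 mult_mono[of 1 "real k" 1 "real p"] by simp
  have d: "c\<^sup>2 \<le> \<sigma> ^ 4" using power_mono[OF c(2) c(1), of 2] by simp
  have "ln 2 ^ 6 * ln (real (k * p)) \<le> (ln (1 + real k) ^ 4 * ln (1 + real p) ^ 2) * ln (real k ^ 2 * real p)"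
    using a b kpln l2 by (intro mult_mono) auto
  from mult_mono[OF this d] have "ln 2 ^ 6 * ln (real (k * p)) * c\<^sup>2 \<le>
      ln (1 + real k) ^ 4 * ln (1 + real p) ^ 2 * ln (real k ^ 2 * real p) * \<sigma> ^ 4"
    using kpln b l2 by (simp add: mult_nonneg_nonneg)
  hence "(8 * ln (1 + real T) ^ 5) * (ln 2 ^ 6 * ln (real (k * p)) * c\<^sup>2) \<le>
      (8 * ln (1 + real T) ^ 5) * (ln (1 + real k) ^ 4 * ln (1 + real p) ^ 2 * ln (real k ^ 2 * real p) * \<sigma> ^ 4)"
    using lT by (intro mult_left_mono) simp_all
  hence "8 * c\<^sup>2 * ln 2 ^ 6 * ln (1 + real T) ^ 5 * ln (real (k * p)) \<le>
      8 * ln (1 + real T) ^ 5 * ln (1 + real k) ^ 4 * ln (1 + real p) ^ 2 * ln (real k ^ 2 * real p) * \<sigma> ^ 4"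
    by (simp only: mult_ac)
  also have "\<dots> = real T * (lasso_penalty T k p \<sigma>)\<^sup>2"
    using T by (simp add: lasso_penalty_square[OF T kp])
  finally show ?thesis .
qed

text \<open>The logarithms of the dimensions enter with total degree $7$.\<close>

lemma lasso_penalty_upper:
  assumes T: "1 \<le> T" and kp: "1 \<le> k" "1 \<le> p" and x: "ln (1 + real k) \<le> x" "ln (1 + real p) \<le> x"
    and S: "0 \<le> \<sigma>" "\<sigma> \<le> S"
  shows "(lasso_penalty T k p \<sigma>)\<^sup>2 \<le> 24 * S ^ 4 * ln (1 + real T) ^ 5 * x ^ 7 / real T"
proof -
  have kp1: "1 \<le> real k" "1 \<le> real p" using kp by auto
  have l0: "0 \<le> ln (1 + real k)" "0 \<le> ln (1 + real p)" "0 \<le> ln (1 + real T)" by simp_all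
  have x0: "0 \<le> x" using l0(1) x(1) by linarith
  have "ln (real k ^ 2 * real p) = 2 * ln (real k) + ln (real p)"
    using kp1 by (simp add: ln_mult_pos ln_realpow)
  moreover have "ln (real k) \<le> ln (1 + real k)" "ln (real p) \<le> ln (1 + real p)" using kp1 by simp_all
  ultimately have l: "ln (real k ^ 2 * real p) \<le> 3 * x" using x by linarith
  have "1 \<le> k ^ 2 * p" using kp by simp
  hence "1 \<le> real (k ^ 2 * p)" by linarith
  hence lk: "0 \<le> ln (real k ^ 2 * real p)" by simp
  have "8 * ln (1 + real T) ^ 5 * ln (1 + real k) ^ 4 * ln (1 + real p) ^ 2 * ln (real k ^ 2 * real p) * \<sigma> ^ 4 \<le>
      8 * ln (1 + real T) ^ 5 * x ^ 4 * x ^ 2 * (3 * x) * S ^ 4"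
    using x x0 l l0 lk S by (intro mult_mono power_mono mult_nonneg_nonneg zero_le_power) auto
  also have "\<dots> = 24 * S ^ 4 * ln (1 + real T) ^ 5 * x ^ 7"
    by (simp add: eval_nat_numeral)
  finally show ?thesis unfolding lasso_penalty_square[OF T kp] using T by (intro divide_right_mono) auto
qed

lemma log_growth_common:
  fixes k p :: "nat \<Rightarrow> nat"
  assumes "(\<lambda>T. real (k T)) \<in> O(\<lambda>T. exp (real T powr a))"
    and "(\<lambda>T. real (p T)) \<in> O(\<lambda>T. exp (real T powr a))" and "0 \<le> a"
  obtains C where "eventually (\<lambda>T. ln (1 + real (k T)) \<le> C * real T powr a \<and>
    ln (1 + real (p T)) \<le> C * real T powr a) sequentially"
proof -
  obtain Ck where Ck: "Ck > 0" "eventually (\<lambda>T. ln (1 + real (k T)) \<le> Ck * real T powr a) sequentially"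
    using log_growth[OF assms(1,3)] by blast
  obtain Cp where Cp: "Cp > 0" "eventually (\<lambda>T. ln (1 + real (p T)) \<le> Cp * real T powr a) sequentially"
    using log_growth[OF assms(2,3)] by blast
  have "eventually (\<lambda>T. ln (1 + real (k T)) \<le> (Ck + Cp) * real T powr a \<and>
      ln (1 + real (p T)) \<le> (Ck + Cp) * real T powr a) sequentially"
    using Ck(2) Cp(2)
  proof eventually_elim
    case (elim T)
    have "Ck * real T powr a \<le> (Ck + Cp) * real T powr a" "Cp * real T powr a \<le> (Ck + Cp) * real T powr a"
      using Ck(1) Cp(1) by (auto intro!: mult_right_mono)
    thus ?case using elim by auto
  qed
  thus ?thesis by (rule that)
qed

text \<open>With logarithms of order $T^a$ the square of the product is of order
$(\ln T)^5\, T^{7a + 2b - 1}$.\<close>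

lemma sparsity_times_penalty_tendsto_0:
  fixes k p s :: "nat \<Rightarrow> nat"
  assumes kp: "\<And>T. 1 \<le> T \<Longrightarrow> 1 \<le> k T" "\<And>T. 1 \<le> T \<Longrightarrow> 1 \<le> p T"
    and k_growth: "(\<lambda>T. real (k T)) \<in> O(\<lambda>T. exp (real T powr a))"
    and p_growth: "(\<lambda>T. real (p T)) \<in> O(\<lambda>T. exp (real T powr a))"
    and s_growth: "(\<lambda>T. real (s T)) \<in> O(\<lambda>T. real T powr b)"
    and a: "0 \<le> a" "7 * a + 2 * b < 1"
    and \<sigma>: "\<And>T. 1 \<le> T \<Longrightarrow> 0 \<le> \<sigma> T" "\<And>T. 1 \<le> T \<Longrightarrow> \<sigma> T \<le> S"
  shows "(\<lambda>T. real (s T) * lasso_penalty T (k T) (p T) (\<sigma> T)) \<longlonglongrightarrow> 0"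
proof -
  define lam where "lam = (\<lambda>T. lasso_penalty T (k T) (p T) (\<sigma> T))"
  obtain C where C: "eventually (\<lambda>T. ln (1 + real (k T)) \<le> C * real T powr a \<and>
      ln (1 + real (p T)) \<le> C * real T powr a) sequentially"
    using log_growth_common[OF k_growth p_growth a(1)] .
  obtain Cs where Cs: "Cs > 0" "eventually (\<lambda>T. norm (real (s T)) \<le> Cs * norm (real T powr b)) sequentially"
    using s_growth by (elim landau_o.bigE)
  define d where "d = 1 - 7 * a - 2 * b"
  have d: "0 < d" using a by (simp add: d_def)
  define B where "B = Cs\<^sup>2 * (24 * S ^ 4 * C ^ 7)"
  have "(\<lambda>T. real (s T) * lam T) \<longlonglongrightarrow> 0"
  proof (rule tendsto_sandwich)
    show "(\<lambda>_. 0) \<longlonglongrightarrow> (0::real)" by simp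
    show "eventually (\<lambda>T. 0 \<le> real (s T) * lam T) sequentially"
      using eventually_ge_at_top[of 1]
      by eventually_elim (use kp lasso_penalty_nonneg in \<open>auto simp: lam_def\<close>)
    show "eventually (\<lambda>T. real (s T) * lam T \<le> sqrt (B * (ln (1 + real T) ^ 5 * real T powr - d))) sequentially"
      using eventually_ge_at_top[of 1] C Cs(2)
    proof eventually_elim
      case (elim T)
      have T: "0 < real T" using elim(1) by simp
      have "(real (s T))\<^sup>2 \<le> (Cs * real T powr b)\<^sup>2" using elim(3) by (intro power_mono) auto
      moreover have "(lam T)\<^sup>2 \<le> 24 * S ^ 4 * ln (1 + real T) ^ 5 * (C * real T powr a) ^ 7 / real T"
        unfolding lam_def using elim(2) \<sigma>[OF elim(1)] kp[OF elim(1)]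
        by (intro lasso_penalty_upper elim(1)) auto
      ultimately have "(real (s T) * lam T)\<^sup>2 \<le>
          (Cs * real T powr b)\<^sup>2 * (24 * S ^ 4 * ln (1 + real T) ^ 5 * (C * real T powr a) ^ 7 / real T)"
        unfolding power_mult_distrib[of "real (s T)"] by (intro mult_mono) auto
      also have "\<dots> = B * (ln (1 + real T) ^ 5 * ((real T powr b)\<^sup>2 * (real T powr a) ^ 7 / real T))"
        by (simp add: B_def power_mult_distrib mult_ac)
      also have "(real T powr b)\<^sup>2 * (real T powr a) ^ 7 / real T = real T powr - d"
      proof -
        have "real T powr - d = real T powr (b * 2 + a * 7 - 1)" by (simp add: d_def algebra_simps)
        also have "\<dots> = real T powr (b * 2) * real T powr (a * 7) / real T powr 1"
          by (simp only: powr_add powr_diff)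
        finally show ?thesis using T by (simp add: powr_power mult.commute)
      qed
      finally show ?case by (rule real_le_rsqrt)
    qed
    have "(\<lambda>T::nat. ln (1 + real T) ^ 5 * real T powr - d) \<longlonglongrightarrow> 0" using d by real_asymp
    hence "(\<lambda>T. sqrt (B * (ln (1 + real T) ^ 5 * real T powr - d))) \<longlonglongrightarrow> sqrt (B * 0)"
      by (intro tendsto_intros)
    thus "(\<lambda>T. sqrt (B * (ln (1 + real T) ^ 5 * real T powr - d))) \<longlonglongrightarrow> 0" by simp
  qed
  thus ?thesis by (simp add: lam_def)
qed

text \<open>The bound $\mu$ for the correlations of the regressors with the noise. For $k = p = 1$ the penalty is
$0$, and any rate between $T^{-1/2}$ and $1$ can replace it, since no union bound has to be paid
for.\<close>

definition noise_level :: "nat \<Rightarrow> nat \<Rightarrow> nat \<Rightarrow> real \<Rightarrow> real" where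
  "noise_level T k p \<sigma> = (if k * p = 1 then real T powr (- 1 / 4) else lasso_penalty T k p \<sigma> / 2)"

text \<open>With at least two regressors the exponent is at least $\ln (kp)$ times a multiple of $(\ln T)^5$; one
$\ln (kp)$ pays for the union bound and the rest still tends to infinity, since $\ln (kp) \ge \ln 2$.
With one regressor the exponent is a multiple of $\sqrt{T}$.\<close>

lemma noise_failure_tendsto_0:
  fixes k p :: "nat \<Rightarrow> nat"
  assumes kp: "\<And>T. 1 \<le> T \<Longrightarrow> 1 \<le> k T" "\<And>T. 1 \<le> T \<Longrightarrow> 1 \<le> p T"
    and c: "0 < c" "\<And>T. 1 \<le> T \<Longrightarrow> c \<le> (\<sigma> T)\<^sup>2" and K: "0 < K"
  shows "(\<lambda>T. real (k T * p T) * deviation_bound K T (noise_level T (k T) (p T) (\<sigma> T)))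
    \<longlonglongrightarrow> 0" (is "?f \<longlonglongrightarrow> 0")
proof (rule tendsto_sandwich)
  define A where "A = 2 * c\<^sup>2 * ln 2 ^ 6 / (64 * K\<^sup>2)"
  have A: "0 < A" using c K by (simp add: A_def)
  let ?e1 = "\<lambda>T::nat. exp (- (sqrt (real T) / (64 * K\<^sup>2)))"
  let ?e2 = "\<lambda>T::nat. exp (- ((A * ln (1 + real T) ^ 5 - 1) * ln 2))"
  show "(\<lambda>_. 0) \<longlonglongrightarrow> (0::real)" by simp
  show "eventually (\<lambda>T. 0 \<le> ?f T) sequentially" by simp
  have "eventually (\<lambda>T::nat. 1 \<le> A * ln (1 + real T) ^ 5) sequentially"
    using A by real_asymp
  thus "eventually (\<lambda>T. ?f T \<le> 4 * ?e1 T + 4 * ?e2 T) sequentially"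
    using eventually_ge_at_top[of 1]
  proof eventually_elim
    case (elim T)
    define d \<mu> where "d = k T * p T" and "\<mu> = noise_level T (k T) (p T) (\<sigma> T)"
    have T: "0 < real T" using elim(2) by simp
    have d1: "1 \<le> d" using kp[OF elim(2)] by (simp add: d_def)
    have "real d * deviation_bound K T \<mu> \<le> 4 * ?e1 T + 4 * ?e2 T"
    proof (cases "d = 1")
      case True
      have "real T * \<mu>\<^sup>2 = real T powr 1 * real T powr (- 1 / 4 * 2)"
        using True T by (simp add: \<mu>_def d_def noise_level_def powr_power)
      also have "\<dots> = real T powr (1 / 2)" by (simp only: powr_add[symmetric]) simp
      finally have "real T * \<mu>\<^sup>2 = sqrt (real T)" using T by (simp add: powr_half_sqrt)
      thus ?thesis using True by simp
    next
      case False
      hence ld: "ln 2 \<le> ln (real d)" using d1 by simp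
      define P where "P = A * ln (1 + real T) ^ 5"
      have "P * ln (real d) \<le> real T * \<mu>\<^sup>2 / (64 * K\<^sup>2)"
      proof -
        have "8 * c\<^sup>2 * ln 2 ^ 6 * ln (1 + real T) ^ 5 * ln (real d) \<le> real T * (2 * \<mu>)\<^sup>2"
        proof -
          have "2 * \<mu> = lasso_penalty T (k T) (p T) (\<sigma> T)"
            using False unfolding \<mu>_def noise_level_def d_def[symmetric] by simp
          thus ?thesis using lasso_penalty_lower[OF elim(2) kp[OF elim(2)] _ c(2)[OF elim(2)]] c(1)
            unfolding d_def by simp
        qed
        hence "8 * c\<^sup>2 * ln 2 ^ 6 * ln (1 + real T) ^ 5 * ln (real d) / 4 / (64 * K\<^sup>2)
            \<le> real T * (2 * \<mu>)\<^sup>2 / 4 / (64 * K\<^sup>2)"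
          by (intro divide_right_mono) simp_all
        thus ?thesis by (simp add: P_def A_def power_mult_distrib mult_ac)
      qed
      moreover have "(P - 1) * ln 2 \<le> (P - 1) * ln (real d)"
        using ld elim(1) by (intro mult_left_mono) (auto simp: P_def)
      ultimately have le: "(P - 1) * ln 2 + ln (real d) \<le> real T * \<mu>\<^sup>2 / (64 * K\<^sup>2)"
        by (simp add: left_diff_distrib)
      have "0 < real d" using d1 by simp
      from union_exp_bound[OF this le]
      have "real d * deviation_bound K T \<mu> \<le> 4 * ?e2 T" unfolding P_def .
      moreover have "0 \<le> 4 * ?e1 T" by simp
      ultimately show ?thesis by linarith
    qed
    thus ?case by (simp only: d_def \<mu>_def)
  qed
  have "?e1 \<longlonglongrightarrow> 0"
  proof -
    have "0 < 64 * K\<^sup>2" using K by simp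
    thus ?thesis by real_asymp
  qed
  moreover have "?e2 \<longlonglongrightarrow> 0" using A by real_asymp
  ultimately have "(\<lambda>T. 4 * ?e1 T + 4 * ?e2 T) \<longlonglongrightarrow> 4 * 0 + 4 * 0" by (intro tendsto_intros)
  thus "(\<lambda>T. 4 * ?e1 T + 4 * ?e2 T) \<longlonglongrightarrow> 0" by simp
qed

text \<open>The exponent is of order $T^{1 - 2b}$ and the logarithm of the number of entries of order $T^a$.\<close>

lemma gram_failure_tendsto_0:
  fixes k p s :: "nat \<Rightarrow> nat"
  assumes kp: "\<And>T. 1 \<le> T \<Longrightarrow> 1 \<le> k T" "\<And>T. 1 \<le> T \<Longrightarrow> 1 \<le> p T"
    and s: "\<And>T. 1 \<le> T \<Longrightarrow> 1 \<le> s T"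
    and k_growth: "(\<lambda>T. real (k T)) \<in> O(\<lambda>T. exp (real T powr a))"
    and p_growth: "(\<lambda>T. real (p T)) \<in> O(\<lambda>T. exp (real T powr a))"
    and s_growth: "(\<lambda>T. real (s T)) \<in> O(\<lambda>T. real T powr b)"
    and a: "0 \<le> a" "a + 2 * b < 1" and g: "0 < g" and K: "0 < K"
  shows "(\<lambda>T. (real (k T * p T))\<^sup>2 * deviation_bound K T (g / (16 * real (s T))))
    \<longlonglongrightarrow> 0" (is "?f \<longlonglongrightarrow> 0")
proof -
  obtain C where C: "eventually (\<lambda>T. ln (1 + real (k T)) \<le> C * real T powr a \<and>
      ln (1 + real (p T)) \<le> C * real T powr a) sequentially"
    using log_growth_common[OF k_growth p_growth a(1)] .
  obtain Cs where Cs: "Cs > 0" "eventually (\<lambda>T. norm (real (s T)) \<le> Cs * norm (real T powr b)) sequentially"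
    using s_growth by (elim landau_o.bigE)
  define A where "A = (g / (16 * Cs))\<^sup>2 / (64 * K\<^sup>2)"
  have A: "0 < A" using g K Cs(1) by (simp add: A_def)
  define \<gamma> where "\<gamma> = 1 - 2 * b - a"
  have \<gamma>: "0 < \<gamma>" using a by (simp add: \<gamma>_def)
  let ?e = "\<lambda>T::nat. exp (- (A * real T powr \<gamma> - 4 * C))"
  show ?thesis
  proof (rule tendsto_sandwich)
    show "(\<lambda>_. 0) \<longlonglongrightarrow> (0::real)" by simp
    show "eventually (\<lambda>T. 0 \<le> ?f T) sequentially" by simp
    have "eventually (\<lambda>T::nat. 4 * C \<le> A * real T powr \<gamma>) sequentially"
      using A \<gamma> by real_asymp
    thus "eventually (\<lambda>T. ?f T \<le> 4 * ?e T) sequentially"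
      using eventually_ge_at_top[of 1] C Cs(2)
    proof eventually_elim
      case (elim T)
      note T1 = elim(2)
      have T: "0 < real T" using T1 by simp
      have Ta: "1 \<le> real T powr a" using T1 a(1) by (simp add: ge_one_powr_ge_zero)
      have kp1: "0 < real (k T)" "0 < real (p T)" using kp[OF T1] by auto
      show ?case
      proof (rule union_exp_bound)
        show "0 < (real (k T * p T))\<^sup>2" using kp1 by simp
        have ln_d: "ln ((real (k T * p T))\<^sup>2) \<le> 4 * C * real T powr a"
        proof -
          have "ln (real (k T)) \<le> ln (1 + real (k T))" "ln (real (p T)) \<le> ln (1 + real (p T))"
            using kp1 by simp_all
          hence "ln (real (k T)) \<le> C * real T powr a" "ln (real (p T)) \<le> C * real T powr a"
            using elim(3) by linarith+
          hence "2 * (ln (real (k T)) + ln (real (p T))) \<le> 2 * (C * real T powr a + C * real T powr a)"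
            by (intro mult_left_mono add_mono) auto
          moreover have "ln ((real (k T * p T))\<^sup>2) = 2 * (ln (real (k T)) + ln (real (p T)))"
            using kp1 by (simp add: ln_realpow ln_mult_pos)
          ultimately show ?thesis by simp
        qed
        have "A * (real T powr \<gamma> * real T powr a) \<le> real T * (g / (16 * real (s T)))\<^sup>2 / (64 * K\<^sup>2)"
        proof -
          have s0: "0 < real (s T)" using s[OF T1] by simp
          have "g / (16 * (Cs * real T powr b)) \<le> g / (16 * real (s T))"
            using elim(4) s0 g Cs(1) T by (intro divide_left_mono mult_pos_pos) auto
          hence "(g / (16 * (Cs * real T powr b)))\<^sup>2 \<le> (g / (16 * real (s T)))\<^sup>2"
            using g Cs(1) by (intro power_mono) auto
          hence "real T * (g / (16 * (Cs * real T powr b)))\<^sup>2 / (64 * K\<^sup>2)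
              \<le> real T * (g / (16 * real (s T)))\<^sup>2 / (64 * K\<^sup>2)"
            by (intro divide_right_mono mult_left_mono) auto
          moreover have "real T * (g / (16 * (Cs * real T powr b)))\<^sup>2 / (64 * K\<^sup>2) =
              A * (real T / (real T powr b)\<^sup>2)"
            by (simp add: A_def power_divide power_mult_distrib mult_ac)
          moreover have "real T / (real T powr b)\<^sup>2 = real T powr \<gamma> * real T powr a"
          proof -
            have "real T powr \<gamma> * real T powr a = real T powr (1 - b * 2)"
              by (simp add: \<gamma>_def powr_add[symmetric] mult.commute)
            also have "\<dots> = real T powr 1 / real T powr (b * 2)" by (simp only: powr_diff)
            finally show ?thesis using T by (simp add: powr_power mult.commute)
          qed
          ultimately show ?thesis by simp
        qed
        moreover have "A * real T powr \<gamma> - 4 * C \<le> (A * real T powr \<gamma> - 4 * C) * real T powr a"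
          using mult_left_mono[OF Ta, of "A * real T powr \<gamma> - 4 * C"] elim(1) by simp
        ultimately show "A * real T powr \<gamma> - 4 * C + ln ((real (k T * p T))\<^sup>2) \<le>
            real T * (g / (16 * real (s T)))\<^sup>2 / (64 * K\<^sup>2)"
          using ln_d unfolding left_diff_distrib mult.assoc by linarith
      qed
    qed
    have "?e \<longlonglongrightarrow> 0" using A \<gamma> by real_asymp
    hence "(\<lambda>T. 4 * ?e T) \<longlonglongrightarrow> 4 * 0" by (intro tendsto_intros)
    thus "(\<lambda>T. 4 * ?e T) \<longlonglongrightarrow> 0" by simp
  qed
qed

section \<open>Consistency of the Lasso\<close>

theorem theorem3:
  fixes M :: "nat \<Rightarrow> 'a measure"
    and k p :: "nat \<Rightarrow> nat"
    and \<Phi> :: "nat \<Rightarrow> nat \<Rightarrow> real mat"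
    and \<Sigma> :: "nat \<Rightarrow> real mat"
    and y \<epsilon> :: "nat \<Rightarrow> int \<Rightarrow> nat \<Rightarrow> 'a \<Rightarrow> real"
    and i s :: "nat \<Rightarrow> nat"
    and \<beta> :: "nat \<Rightarrow> real vec"
    and \<Gamma> F :: "nat \<Rightarrow> real mat"
    and \<sigma> lam :: "nat \<Rightarrow> real"
    and X :: "nat \<Rightarrow> 'a \<Rightarrow> real mat"
    and \<beta>hat :: "nat \<Rightarrow> 'a \<Rightarrow> real vec"
    and a b c q :: real
  defines "\<beta> \<equiv> \<lambda>T. true_param (k T) (p T) (\<Phi> T) (i T)"
    and "s \<equiv> \<lambda>T. card (active_set (\<beta> T))"
    and "\<Gamma> \<equiv> \<lambda>T. lag_cov_mat (M T) (k T) (p T) (y T)"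
    and "F \<equiv> \<lambda>T. companion_mat (k T) (p T) (\<Phi> T)"
    and "\<sigma> \<equiv> \<lambda>T. max_sd (M T) (k T) (y T) (\<epsilon> T)"
    and "lam \<equiv> \<lambda>T. lasso_penalty T (k T) (p T) (\<sigma> T)"
    and "X \<equiv> \<lambda>T. design_mat T (k T) (p T) (y T)"
  assumes var: "\<And>T. T \<ge> 1 \<Longrightarrow>
        stationary_gaussian_var (M T) (k T) (p T) (\<Phi> T) (\<Sigma> T) (y T) (\<epsilon> T)"
    and equation: "\<And>T. T \<ge> 1 \<Longrightarrow> i T < k T"
    and sparsity_pos: "\<And>T. T \<ge> 1 \<Longrightarrow> s T \<ge> 1"
    and exponents: "a \<ge> 0" "b \<ge> 0" "7 * a + 2 * b < 1"
    and k_growth: "(\<lambda>T. real (k T)) \<in> O(\<lambda>T. exp (real T powr a))"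
    and p_growth: "(\<lambda>T. real (p T)) \<in> O(\<lambda>T. exp (real T powr a))"
    and s_growth: "(\<lambda>T. real (s T)) \<in> O(\<lambda>T. real T powr b)"
    and c_pos: "c > 0"
    and kappa: "\<And>T. T \<ge> 1 \<Longrightarrow> restricted_eigenvalue_sq (\<Gamma> T) (s T) \<ge> c"
    and sd_bounded: "bdd_above (\<sigma> ` {1..})"
    and dependence_bounded:
      "bdd_above ((\<lambda>T. spectral_norm (\<Gamma> T) * (\<Sum>j=0..T. spectral_norm (F T ^\<^sub>m j))) ` {1..})"
    and q: "0 < q" "q < 1"
    and lasso_measurable: "\<And>T j. T \<ge> 1 \<Longrightarrow> j < k T * p T \<Longrightarrow>
        (\<lambda>\<omega>. \<beta>hat T \<omega> $ j) \<in> borel_measurable (M T)"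
    and lasso: "\<And>T \<omega>. T \<ge> 1 \<Longrightarrow> \<omega> \<in> space (M T) \<Longrightarrow>
        is_lasso T (X T \<omega>) (response_vec T (y T) (i T) \<omega>) (lam T) (\<beta>hat T \<omega>)"
  shows "tendsto_0_in_prob M
           (\<lambda>T \<omega>. (l2_norm (X T \<omega> *\<^sub>v \<beta>hat T \<omega> - X T \<omega> *\<^sub>v \<beta> T))\<^sup>2 / real T) \<and>
         tendsto_0_in_prob M (\<lambda>T \<omega>. l1_norm (\<beta>hat T \<omega> - \<beta> T)) \<and>
         ((\<exists>T0\<ge>1. \<forall>T\<ge>T0. beta_min (\<beta> T) > 16 / (q * c) * real (s T) * lam T) \<longrightarrow>
          (\<lambda>T. measure (M T) {\<omega> \<in> space (M T). \<forall>j\<in>active_set (\<beta> T). \<beta>hat T \<omega> $ j \<noteq> 0})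
            \<longlonglongrightarrow> 1)"
proof -
  have V: "stationary_gaussian_var (M T) (k T) (p T) (\<Phi> T) (\<Sigma> T) (y T) (\<epsilon> T)" if "1 \<le> T" for T
    using var[OF that] .
  have kp: "1 \<le> k T" "1 \<le> p T" if "1 \<le> T" for T
    using stationary_gaussian_var.k_pos[OF V[OF that]] stationary_gaussian_var.p_pos[OF V[OF that]] .
  define d where "d = (\<lambda>T. k T * p T)"
  have d1: "1 \<le> d T" if "1 \<le> T" for T using kp[OF that] by (simp add: d_def)
  have \<beta>dim: "dim_vec (\<beta> T) = d T" for T by (simp add: \<beta>_def true_param_def d_def)
  have act: "active_set (\<beta> T) \<subseteq> {..<d T}" for T by (auto simp: active_set_def \<beta>dim)
  have act1: "active_set (\<beta> T) = {..<1}" "s T = 1" if "1 \<le> T" "d T = 1" for T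
  proof -
    have "active_set (\<beta> T) \<noteq> {}" using sparsity_pos[OF that(1)] by (auto simp: s_def)
    thus "active_set (\<beta> T) = {..<1}" using act[of T] that(2) by auto
    thus "s T = 1" by (simp add: s_def)
  qed
  have c\<Gamma>: "c \<le> \<Gamma> T $$ (0, 0)" and c\<sigma>: "c \<le> (\<sigma> T)\<^sup>2" and \<sigma>0: "0 \<le> \<sigma> T" if "1 \<le> T" for T
    using stationary_gaussian_var.restricted_eigenvalue_le_variance[OF V[OF that] kappa[OF that, unfolded \<Gamma>_def] sparsity_pos[OF that]]
      stationary_gaussian_var.max_sd_nonneg[OF V[OF that]]
    by (simp_all add: \<Gamma>_def \<sigma>_def)
  have lam0: "0 \<le> lam T" if "1 \<le> T" for T
    unfolding lam_def by (rule lasso_penalty_nonneg[OF kp[OF that]])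
  have lam_lower: "8 * c\<^sup>2 * ln 2 ^ 6 * ln (1 + real T) ^ 5 * ln (real (d T)) \<le> real T * (lam T)\<^sup>2" if "1 \<le> T" for T
    unfolding lam_def d_def using c_pos c\<sigma>[OF that] by (intro lasso_penalty_lower that kp) auto
  have lam_pos: "0 < lam T" if T: "1 \<le> T" and d: "d T \<noteq> 1" for T
  proof -
    have "2 \<le> d T" using d d1[OF T] by simp
    hence "0 < ln (real (d T))" by simp
    hence "0 < 8 * c\<^sup>2 * ln 2 ^ 6 * ln (1 + real T) ^ 5 * ln (real (d T))"
      using c_pos T by (intro mult_pos_pos zero_less_power) auto
    hence "0 < real T * (lam T)\<^sup>2" using lam_lower[OF T] by linarith
    hence "lam T \<noteq> 0" by auto
    thus ?thesis using lam0[OF T] by simp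
  qed
  have lam_zero: "lam T = 0" if "d T = 1" for T
    using that by (simp add: lam_def lasso_penalty_def d_def)

  obtain S where S: "\<And>T. 1 \<le> T \<Longrightarrow> \<sigma> T \<le> S" using sd_bounded by (auto simp: bdd_above_def)
  obtain D where D: "\<And>T. 1 \<le> T \<Longrightarrow> spectral_norm (\<Gamma> T) * (\<Sum>j=0..T. spectral_norm (F T ^\<^sub>m j)) \<le> D"
    using dependence_bounded by (auto simp: bdd_above_def)
  \<comment> \<open>\<open>2 D\<close> bounds the covariance matrices of the regressor paths, \<open>S^2\<close> those of the noise; \<open>1 + c\<close> lets the deviations \<open>\<mu>\<close> and \<open>\<eta>\<close> stay below \<open>4 K\<close> eventually.\<close>
  define K where "K = 1 + c + 2 * \<bar>D\<bar> + S\<^sup>2"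
  have K1: "1 \<le> K" "c \<le> K" using c_pos by (simp_all add: K_def)
  hence K0: "0 < K" by simp
  have depK: "2 * (spectral_norm (\<Gamma> T) * (\<Sum>j=0..T. spectral_norm (F T ^\<^sub>m j))) \<le> K" if "1 \<le> T" for T
    using D[OF that] c_pos abs_ge_self[of D] zero_le_power2[of S] unfolding K_def by linarith
  have \<sigma>K: "(\<sigma> T)\<^sup>2 \<le> K" if "1 \<le> T" for T
    using power_mono[OF S[OF that] \<sigma>0[OF that], of 2] c_pos abs_ge_zero[of D] unfolding K_def by linarith

  define \<mu> where "\<mu> = (\<lambda>T. noise_level T (k T) (p T) (\<sigma> T))"
  have \<mu>_uni: "\<mu> T = real T powr (- 1 / 4)" if "d T = 1" for T
    using that by (simp add: \<mu>_def noise_level_def d_def)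
  have \<mu>_lam: "\<mu> T = lam T / 2" if "d T \<noteq> 1" for T
    using that unfolding \<mu>_def noise_level_def lam_def d_def by (rule if_not_P)
  have \<mu>0: "0 \<le> \<mu> T" if "1 \<le> T" for T
    using lam0[OF that] \<mu>_uni[of T] \<mu>_lam[of T] by (cases "d T = 1") auto
  define h where "h = (\<lambda>T. real (s T) * \<mu> T)"
  have \<mu>h: "\<mu> T \<le> h T" if "1 \<le> T" for T
    using mult_right_mono[of 1 "real (s T)" "\<mu> T"] sparsity_pos[OF that] \<mu>0[OF that] by (simp add: h_def)
  have h0: "h \<longlonglongrightarrow> 0"
  proof (rule tendsto_sandwich)
    show "(\<lambda>_. 0) \<longlonglongrightarrow> (0::real)" by simp
    show "eventually (\<lambda>T. 0 \<le> h T) sequentially"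
      using eventually_ge_at_top[of 1] by eventually_elim (use \<mu>0 in \<open>auto simp: h_def\<close>)
    show "eventually (\<lambda>T. h T \<le> real T powr (- 1 / 4) + real (s T) * lam T) sequentially"
      using eventually_ge_at_top[of 1]
    proof eventually_elim
      case (elim T)
      have "0 \<le> real (s T) * lam T" using lam0[OF elim] by simp
      moreover have "0 \<le> real T powr (- 1 / 4)" by simp
      moreover have "h T = real T powr (- 1 / 4) \<or> h T = real (s T) * lam T / 2"
        using act1(2)[OF elim] \<mu>_uni[of T] \<mu>_lam[of T] by (cases "d T = 1") (simp_all add: h_def)
      ultimately show ?case by linarith
    qed
    have "(\<lambda>T::nat. real T powr (- 1 / 4)) \<longlonglongrightarrow> 0" by real_asymp
    moreover have "(\<lambda>T. real (s T) * lam T) \<longlonglongrightarrow> 0"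
      unfolding lam_def by (rule sparsity_times_penalty_tendsto_0[OF kp k_growth p_growth s_growth exponents(1,3) \<sigma>0 S])
    ultimately have "(\<lambda>T. real T powr (- 1 / 4) + real (s T) * lam T) \<longlonglongrightarrow> 0 + 0" by (rule tendsto_add)
    thus "(\<lambda>T. real T powr (- 1 / 4) + real (s T) * lam T) \<longlonglongrightarrow> 0" by simp
  qed

  define fail where "fail = (\<lambda>T. real (k T * p T) * deviation_bound K T (\<mu> T) +
      (real (k T * p T))\<^sup>2 * deviation_bound K T ((1 - q) * c / (16 * real (s T))))"
  have fail0: "fail \<longlonglongrightarrow> 0"
  proof -
    have "fail \<longlonglongrightarrow> 0 + 0" unfolding fail_def \<mu>_def
      using exponents q c_pos
      by (intro tendsto_add noise_failure_tendsto_0[OF kp c_pos c\<sigma> K0]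
        gram_failure_tendsto_0[OF kp sparsity_pos k_growth p_growth s_growth exponents(1) _ _ K0]) auto
    thus ?thesis by simp
  qed

  let ?E1 = "\<lambda>T \<omega>. (l2_norm (X T \<omega> *\<^sub>v \<beta>hat T \<omega> - X T \<omega> *\<^sub>v \<beta> T))\<^sup>2 / real T"
  let ?E2 = "\<lambda>T \<omega>. l1_norm (\<beta>hat T \<omega> - \<beta> T)"
  define r where "r = (\<lambda>T. 32 * h T / (q * c))"
  have h1: "eventually (\<lambda>T. h T < 1) sequentially" using h0 by (rule order_tendstoD) simp
  have bounds: "eventually (\<lambda>T. \<exists>B\<in>sets (M T). measure (M T) B \<le> fail T \<and>
      (AE \<omega> in M T. \<omega> \<notin> B \<longrightarrow> ?E1 T \<omega> \<le> 64 * real (s T) * (\<mu> T)\<^sup>2 / (q * c) \<and> ?E2 T \<omega> \<le> r T)) sequentially"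
    using eventually_ge_at_top[of 1] h1
  proof eventually_elim
    case (elim T)
    note T1 = elim(1)
    have pen: "(0 < lam T \<and> lam T = 2 * \<mu> T) \<or> (lam T = 0 \<and> active_set (\<beta> T) = {..<k T * p T})"
    proof (cases "d T = 1")
      case True
      hence "k T * p T = 1" by (simp add: d_def)
      thus ?thesis using lam_zero[OF True] act1(1)[OF T1 True] by simp
    next
      case False
      thus ?thesis using lam_pos[OF T1 False] \<mu>_lam[OF False] by simp
    qed
    have "\<mu> T \<le> 4 * K" using \<mu>h[OF T1] elim(2) K1 by linarith
    from stationary_gaussian_var.lasso_error_bounds[OF V[OF T1], of T "i T" c q K "\<mu> T" "lam T" "\<beta>hat T"]
    show ?case
      using T1 equation[OF T1] sparsity_pos[OF T1] kappa[OF T1] c_pos q depK[OF T1] \<sigma>K[OF T1] K1 \<mu>0[OF T1] \<open>\<mu> T \<le> 4 * K\<close> pen lasso[OF T1]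
      unfolding fail_def r_def h_def \<beta>_def s_def \<Gamma>_def F_def \<sigma>_def X_def d_def by (simp add: mult.assoc)
  qed
  have ps: "eventually (\<lambda>T. prob_space (M T)) sequentially"
    using eventually_ge_at_top[of 1]
    by eventually_elim (rule stationary_gaussian_var.axioms(1)[OF V])
  have r0: "r \<longlonglongrightarrow> 0"
  proof -
    have "r \<longlonglongrightarrow> 32 * 0 / (q * c)" unfolding r_def using q c_pos by (intro tendsto_intros h0) auto
    thus ?thesis by simp
  qed
  have "tendsto_0_in_prob M ?E1"
  proof (rule tendsto_0_in_probI[OF _ ps fail0])
    show "(\<lambda>T. 64 * (h T)\<^sup>2 / (q * c)) \<longlonglongrightarrow> 0"
    proof -
      have "(\<lambda>T. 64 * (h T)\<^sup>2 / (q * c)) \<longlonglongrightarrow> 64 * 0\<^sup>2 / (q * c)" using q c_pos by (intro tendsto_intros h0) auto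
      thus ?thesis by simp
    qed
    show "eventually (\<lambda>T. \<exists>B\<in>sets (M T). measure (M T) B \<le> fail T \<and>
        (AE \<omega> in M T. \<omega> \<notin> B \<longrightarrow> \<bar>?E1 T \<omega>\<bar> \<le> 64 * (h T)\<^sup>2 / (q * c))) sequentially"
      using bounds eventually_ge_at_top[of 1]
    proof eventually_elim
      case (elim T)
      have "real (s T) * (\<mu> T)\<^sup>2 \<le> (h T)\<^sup>2"
      proof -
        have "real (s T) \<le> (real (s T))\<^sup>2" using sparsity_pos[OF elim(2)] by (simp add: power2_eq_square)
        thus ?thesis unfolding h_def power_mult_distrib by (intro mult_right_mono) auto
      qed
      hence le: "64 * real (s T) * (\<mu> T)\<^sup>2 / (q * c) \<le> 64 * (h T)\<^sup>2 / (q * c)"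
        using q c_pos by (intro divide_right_mono) auto
      obtain B where "B \<in> sets (M T)" "measure (M T) B \<le> fail T"
        and AE: "AE \<omega> in M T. \<omega> \<notin> B \<longrightarrow> ?E1 T \<omega> \<le> 64 * real (s T) * (\<mu> T)\<^sup>2 / (q * c) \<and> ?E2 T \<omega> \<le> r T"
        using elim(1) by blast
      moreover have "AE \<omega> in M T. \<omega> \<notin> B \<longrightarrow> \<bar>?E1 T \<omega>\<bar> \<le> 64 * (h T)\<^sup>2 / (q * c)"
        using AE by eventually_elim (use le in auto)
      ultimately show ?case by blast
    qed
  qed
  moreover have "tendsto_0_in_prob M ?E2"
  proof (rule tendsto_0_in_probI[OF _ ps fail0 r0])
    have n: "0 \<le> l1_norm v" for v by (simp add: l1_norm_def sum_nonneg)
    show "eventually (\<lambda>T. \<exists>B\<in>sets (M T). measure (M T) B \<le> fail T \<and>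
        (AE \<omega> in M T. \<omega> \<notin> B \<longrightarrow> \<bar>?E2 T \<omega>\<bar> \<le> r T)) sequentially"
      using bounds
    proof eventually_elim
      case (elim T)
      then obtain B where "B \<in> sets (M T)" "measure (M T) B \<le> fail T"
        and AE: "AE \<omega> in M T. \<omega> \<notin> B \<longrightarrow> ?E1 T \<omega> \<le> 64 * real (s T) * (\<mu> T)\<^sup>2 / (q * c) \<and> ?E2 T \<omega> \<le> r T"
        by blast
      moreover have "AE \<omega> in M T. \<omega> \<notin> B \<longrightarrow> \<bar>?E2 T \<omega>\<bar> \<le> r T"
        using AE by eventually_elim (use n in \<open>auto simp: abs_of_nonneg\<close>)
      ultimately show ?case by blast
    qed
  qed
  moreover have "(\<lambda>T. measure (M T) {\<omega> \<in> space (M T). \<forall>j\<in>active_set (\<beta> T). \<beta>hat T \<omega> $ j \<noteq> 0}) \<longlonglongrightarrow> 1"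
    if ex: "\<exists>T0\<ge>1. \<forall>T\<ge>T0. beta_min (\<beta> T) > 16 / (q * c) * real (s T) * lam T"
  proof -
    obtain T0 where T0: "T0 \<ge> 1" "\<And>T. T \<ge> T0 \<Longrightarrow> beta_min (\<beta> T) > 16 / (q * c) * real (s T) * lam T" using ex by blast
    let ?A = "\<lambda>T. {\<omega> \<in> space (M T). \<forall>j\<in>active_set (\<beta> T). \<beta>hat T \<omega> $ j \<noteq> 0}"
    show ?thesis
    proof (rule tendsto_sandwich[where f="\<lambda>T. 1 - fail T" and h="\<lambda>_. 1"])
      show "eventually (\<lambda>T. measure (M T) (?A T) \<le> 1) sequentially"
        using ps by eventually_elim (rule prob_space.prob_le_1)
      show "(\<lambda>_. 1) \<longlonglongrightarrow> (1::real)" by simp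
      show "(\<lambda>T. 1 - fail T) \<longlonglongrightarrow> 1" using tendsto_diff[OF tendsto_const fail0, of 1] by simp
      show "eventually (\<lambda>T. 1 - fail T \<le> measure (M T) (?A T)) sequentially"
        using bounds eventually_ge_at_top[of T0] ps
      proof eventually_elim
        case (elim T)
        have T1: "1 \<le> T" using elim(2) T0(1) by simp
        interpret P: prob_space "M T" by (rule elim(3))
        have fin: "finite (active_set (\<beta> T))" using finite_subset[OF act] by simp
        have meas: "?A T \<in> sets (M T)"
        proof -
          have "{\<omega> \<in> space (M T). \<beta>hat T \<omega> $ j \<noteq> 0} \<in> sets (M T)" if "j \<in> active_set (\<beta> T)" for j
          proof -
            have "j < k T * p T" using that act[of T] by (auto simp: d_def)
            note [measurable] = lasso_measurable[OF T1 this]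
            show ?thesis by measurable
          qed
          thus ?thesis using fin by (intro sets.sets_Collect_finite_All) auto
        qed
        obtain B where B: "B \<in> sets (M T)" "measure (M T) B \<le> fail T"
          and AE: "AE \<omega> in M T. \<omega> \<notin> B \<longrightarrow> ?E1 T \<omega> \<le> 64 * real (s T) * (\<mu> T)\<^sup>2 / (q * c) \<and> ?E2 T \<omega> \<le> r T"
          using elim(1) by blast
        have "AE \<omega> in M T. \<omega> \<in> space (M T) - B \<longrightarrow> \<omega> \<in> ?A T"
        \<comment> \<open>With one regressor the penalty is zero and \<open>r T\<close> can exceed the coefficient, so the error bound is of no use here.\<close>
        proof (cases "d T = 1")
          case True
          have kp1: "k T * p T = 1" using True by (simp add: d_def)
          hence i0: "i T = 0" using equation[OF T1] by simp
          have "\<Gamma> T $$ (0, 0) \<noteq> 0" using c\<Gamma>[OF T1] c_pos by linarith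
          hence "AE \<omega> in M T. \<forall>b. is_lasso T (X T \<omega>) (response_vec T (y T) 0 \<omega>) 0 b \<longrightarrow> b $ 0 \<noteq> 0"
            unfolding X_def \<Gamma>_def using T1
            by (intro stationary_gaussian_var.unpenalized_univariate_lasso_nonzero[OF V[OF T1] kp1]) auto
          thus ?thesis using AE_space
          proof eventually_elim
            case (elim \<omega>)
            have "\<beta>hat T \<omega> $ 0 \<noteq> 0"
              using elim(1) lasso[OF T1 elim(2)] lam_zero[OF True] i0 by simp
            thus ?case using act1(1)[OF T1 True] by auto
          qed
        next
          case False
          have gap: "r T < \<bar>\<beta> T $ j\<bar>" if "j \<in> active_set (\<beta> T)" for j
          proof -
            have "r T = 16 / (q * c) * real (s T) * lam T" using \<mu>_lam[OF False] by (simp add: r_def h_def)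
            also have "\<dots> < beta_min (\<beta> T)" using T0(2) elim(2) by blast
            also have "\<dots> \<le> \<bar>\<beta> T $ j\<bar>" unfolding beta_min_def using fin that by (intro Min_le) auto
            finally show ?thesis .
          qed
          show ?thesis using AE
          proof eventually_elim
            case (elim \<omega>)
            show ?case
            proof
              assume \<omega>: "\<omega> \<in> space (M T) - B"
              have "\<beta>hat T \<omega> $ j \<noteq> 0" if j: "j \<in> active_set (\<beta> T)" for j
              proof
                assume 0: "\<beta>hat T \<omega> $ j = 0"
                have jd: "j < dim_vec (\<beta>hat T \<omega> - \<beta> T)" using j by (simp add: active_set_def)
                have "\<bar>(\<beta>hat T \<omega> - \<beta> T) $ j\<bar> \<le> l1_norm (\<beta>hat T \<omega> - \<beta> T)"
                  unfolding l1_norm_def using jd by (intro member_le_sum) auto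
                hence "\<bar>\<beta> T $ j\<bar> \<le> r T" using 0 jd elim \<omega> by simp
                thus False using gap[OF j] by simp
              qed
              thus "\<omega> \<in> ?A T" using \<omega> by simp
            qed
          qed
        qed
        hence "P.prob (space (M T) - B) \<le> P.prob (?A T)" by (rule P.finite_measure_mono_AE[OF _ meas])
        thus ?case using P.prob_compl[OF B(1)] B(2) by simp
      qed
    qed
  qed
  ultimately show ?thesis by blast
qed

end
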